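(* Let $m,N\ge 1$ and let $\overline U$ be the set of complex $m\times m$ matrices with pairwise distinct eigenvalues, equipped with a chosen ordering of the eigenvalues. For $\sigma\in S_{mN}$ and generic $(b_1,\dots,b_N)\in\overline U^N$ put $\sigma(b_1,\dots,b_N)=(b_1',\dots,b_N')$, where $(b_1',\dots,b_N')\in\overline U^N$ is determined by $$(t-b_1)\cdots(t-b_N)=(t-b_1')\cdots(t-b_N')$$ (an identity of matrix polynomials in the commuting variable $t$) together with the requirement that the list $(\overline S(b_1'),\dots,\overline S(b_N'))$ of length $mN$ is obtained by applying the permutation $\sigma$ to the list $(\overline S(b_1),\dots,\overline S(b_N))$. Then: 1. This defines an action of the symmetric group $S_{mN}$ on $\overline U^N$ by birational automorphisms. 2. The action is local: for $0\le\alpha\le N-1$ and $\alpha m<i<(\alpha+1)m$, the transposition $(i,i+1)$ acts only inside the $(\alpha+1)$-th factor of $\overline U^N$; and for $1\le\alpha\le N-1$ the transposition $(\alpha m,\alpha m+1)$ acts only inside the product of the $\alpha$-th and $(\alpha+1)$-th factors. 3. For $N=2$, the action of the element $(1,m+1)(2,m+2)\cdots(m,2m)\in S_{2m}$ is a twisted transposition $\mu:\overline U\times\overline U\to\overline U\times\overline U$.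
   Context: An element of $\overline U$ is a pair consisting of a complex $m\times m$ matrix $b$ with $m$ distinct eigenvalues and an ordered list $\overline S(b)=(\lambda_1,\dots,\lambda_m)$ of these eigenvalues; $\overline U$ is a complex manifold (an algebraic variety). For $(b_1,\dots,b_N)\in\overline U^N$, the concatenation of the lists $\overline S(b_1),\dots,\overline S(b_N)$ is a list of length $mN$, on which $S_{mN}$ acts by permuting positions: $\sigma\cdot(\lambda_1,\dots,\lambda_{mN})=(\lambda_{\sigma^{-1}(1)},\dots,\lambda_{\sigma^{-1}(mN)})$. "Generic" means: for all points of some nonempty Zariski-open subset. A birational automorphism of $\overline U^N$ "acts only inside" certain factors if it is the product of a birational automorphism of the product of those factors with the identity on the remaining factors. Let $W$ be a complex manifold and $\mu:W\times W\to W\times W$ a birational automorphism of $W\times W$. Define birational automorphisms of $W\times W\times W$ by $\sigma_1=\mu\times\mathrm{id}$ and $\sigma_2=\mathrm{id}\times\mu$. The map $\mu$ is called a twisted transposition if $\sigma_1^2=\sigma_2^2=\mathrm{id}$ and $\sigma_1\sigma_2\sigma_1=\sigma_2\sigma_1\sigma_2$ as birational automorphisms (wherever the compositions are defined, on a dense open subset). *)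

theory Defs
  imports
    "Jordan_Normal_Form.Char_Poly"
    "HOL-Combinatorics.Permutations"
begin

text \<open>
  A (quasi-affine) complex variety is represented by its set of points together with the
  coordinate functions of its embedding into an affine space.
  Regular functions, regular maps and the Zariski topology are the usual ones for a subset of
  affine space. Polynomials are taken as polynomial functions, which loses nothing over the
  infinite field of complex numbers.
\<close>

record 'a variety =
  points :: "'a set"
  coords :: "('a \<Rightarrow> complex) set"

inductive_set polynomial_functions :: "('a \<Rightarrow> complex) set \<Rightarrow> ('a \<Rightarrow> complex) set"
  for C :: "('a \<Rightarrow> complex) set" where
  const: "(\<lambda>_. c) \<in> polynomial_functions C"
| coord: "f \<in> C \<Longrightarrow> f \<in> polynomial_functions C"
| add: "p \<in> polynomial_functions C \<Longrightarrow> q \<in> polynomial_functions C \<Longrightarrow>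
    (\<lambda>x. p x + q x) \<in> polynomial_functions C"
| mult: "p \<in> polynomial_functions C \<Longrightarrow> q \<in> polynomial_functions C \<Longrightarrow>
    (\<lambda>x. p x * q x) \<in> polynomial_functions C"

definition zariski_closed :: "'a variety \<Rightarrow> 'a set \<Rightarrow> bool" where
  "zariski_closed X Z \<longleftrightarrow>
    (\<exists>S \<subseteq> polynomial_functions (coords X). Z = {x \<in> points X. \<forall>p\<in>S. p x = 0})"

definition zariski_open :: "'a variety \<Rightarrow> 'a set \<Rightarrow> bool" where
  "zariski_open X V \<longleftrightarrow> V \<subseteq> points X \<and> zariski_closed X (points X - V)"

definition dense_open :: "'a variety \<Rightarrow> 'a set \<Rightarrow> bool" where
  "dense_open X V \<longleftrightarrow> zariski_open X V \<and> V \<noteq> {} \<and>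
    (\<forall>V'. zariski_open X V' \<and> V' \<noteq> {} \<longrightarrow> V \<inter> V' \<noteq> {})"

text \<open>
  On an irreducible variety every nonempty Zariski-open subset is dense; asking for density
  explicitly makes the following notions meaningful without assuming irreducibility.
\<close>

definition generically :: "'a variety \<Rightarrow> ('a \<Rightarrow> bool) \<Rightarrow> bool" where
  "generically X P \<longleftrightarrow> (\<exists>V. dense_open X V \<and> (\<forall>x\<in>V. P x))"

definition regular_on :: "'a variety \<Rightarrow> 'a set \<Rightarrow> ('a \<Rightarrow> complex) \<Rightarrow> bool" where
  "regular_on X V f \<longleftrightarrow>
    (\<forall>x\<in>V. \<exists>V' p q. zariski_open X V' \<and> x \<in> V' \<and> V' \<subseteq> V \<and>
      p \<in> polynomial_functions (coords X) \<and> q \<in> polynomial_functions (coords X) \<and>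
      (\<forall>y\<in>V'. q y \<noteq> 0 \<and> f y = p y / q y))"

definition regular_map :: "'a variety \<Rightarrow> 'a set \<Rightarrow> 'b variety \<Rightarrow> ('a \<Rightarrow> 'b) \<Rightarrow> bool" where
  "regular_map X V Y f \<longleftrightarrow>
    f ` V \<subseteq> points Y \<and> (\<forall>c\<in>coords Y. regular_on X V (\<lambda>x. c (f x)))"

text \<open>
  Rational maps are represented by total HOL functions whose values outside a dense open set
  are irrelevant; equality of rational maps is equality on a dense open set.
  A birational automorphism is an isomorphism between two dense open subsets.
\<close>

definition birational_automorphism :: "'a variety \<Rightarrow> ('a \<Rightarrow> 'a) \<Rightarrow> bool" where
  "birational_automorphism X f \<longleftrightarrow>
    (\<exists>V V' g. dense_open X V \<and> dense_open X V' \<and>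
      regular_map X V X f \<and> regular_map X V' X g \<and> f ` V \<subseteq> V' \<and> g ` V' \<subseteq> V \<and>
      (\<forall>x\<in>V. g (f x) = x) \<and> (\<forall>y\<in>V'. f (g y) = y))"

definition rational_eq :: "'a variety \<Rightarrow> ('a \<Rightarrow> 'a) \<Rightarrow> ('a \<Rightarrow> 'a) \<Rightarrow> bool" where
  "rational_eq X f g \<longleftrightarrow> generically X (\<lambda>x. f x = g x)"

definition birational_action ::
  "('g \<Rightarrow> 'g) set \<Rightarrow> 'a variety \<Rightarrow> (('g \<Rightarrow> 'g) \<Rightarrow> 'a \<Rightarrow> 'a) \<Rightarrow> bool" where
  "birational_action G X A \<longleftrightarrow>
    (\<forall>\<sigma>\<in>G. birational_automorphism X (A \<sigma>)) \<and>
    rational_eq X (A id) id \<and>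
    (\<forall>\<sigma>\<in>G. \<forall>\<tau>\<in>G. rational_eq X (A (\<sigma> \<circ> \<tau>)) (A \<sigma> \<circ> A \<tau>))"

definition power_variety :: "'a variety \<Rightarrow> nat \<Rightarrow> 'a list variety" where
  "power_variety X n =
    \<lparr>points = {xs. length xs = n \<and> set xs \<subseteq> points X},
     coords = {\<lambda>xs. c (xs ! k) | c k. c \<in> coords X \<and> k < n}\<rparr>"

text \<open>
  The product of a map \<open>g\<close> on the \<open>k\<close> consecutive factors following the first \<open>a\<close> ones
  with the identity on all other factors.
\<close>

definition on_factors :: "nat \<Rightarrow> nat \<Rightarrow> ('a list \<Rightarrow> 'a list) \<Rightarrow> 'a list \<Rightarrow> 'a list" where
  "on_factors a k g xs = take a xs @ g (take k (drop a xs)) @ drop (a + k) xs"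

definition acts_only_inside ::
  "'a variety \<Rightarrow> nat \<Rightarrow> nat \<Rightarrow> nat \<Rightarrow> ('a list \<Rightarrow> 'a list) \<Rightarrow> bool" where
  "acts_only_inside X n a k f \<longleftrightarrow>
    (\<exists>g. birational_automorphism (power_variety X k) g \<and>
         rational_eq (power_variety X n) f (on_factors a k g))"

definition twisted_transposition :: "'a variety \<Rightarrow> ('a list \<Rightarrow> 'a list) \<Rightarrow> bool" where
  "twisted_transposition X \<mu> \<longleftrightarrow>
    birational_automorphism (power_variety X 2) \<mu> \<and>
    (let \<sigma>\<^sub>1 = on_factors 0 2 \<mu>; \<sigma>\<^sub>2 = on_factors 1 2 \<mu>; X3 = power_variety X 3 in
      rational_eq X3 (\<sigma>\<^sub>1 \<circ> \<sigma>\<^sub>1) id \<and>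
      rational_eq X3 (\<sigma>\<^sub>2 \<circ> \<sigma>\<^sub>2) id \<and>
      rational_eq X3 (\<sigma>\<^sub>1 \<circ> \<sigma>\<^sub>2 \<circ> \<sigma>\<^sub>1) (\<sigma>\<^sub>2 \<circ> \<sigma>\<^sub>1 \<circ> \<sigma>\<^sub>2))"

text \<open>
  Points are matrices with simple spectrum and an ordered list of their eigenvalues; the
  coordinates are the matrix entries and the listed eigenvalues.
\<close>

definition Ubar :: "nat \<Rightarrow> (complex mat \<times> complex list) variety" where
  "Ubar m =
    \<lparr>points = {(b, ls). b \<in> carrier_mat m m \<and> length ls = m \<and> distinct ls \<and>
       set ls = {l. eigenvalue b l}},
     coords = {\<lambda>x. fst x $$ (i, j) | i j. i < m \<and> j < m} \<union>
       {\<lambda>x. snd x ! i | i. i < m}\<rparr>"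

text \<open>
  The matrix polynomial \<open>(t - b\<^sub>1) \<cdots> (t - b\<^sub>N)\<close>, as a matrix over the polynomial ring;
  the library's \<^const>\<open>char_poly_matrix\<close> of \<open>b\<close> is \<open>t - b\<close>.
\<close>

definition matrix_polynomial :: "nat \<Rightarrow> (complex mat \<times> complex list) list \<Rightarrow> complex poly mat" where
  "matrix_polynomial m bs = foldr (\<lambda>b P. char_poly_matrix (fst b) * P) bs (1\<^sub>m m)"

definition spectrum_list :: "(complex mat \<times> complex list) list \<Rightarrow> complex list" where
  "spectrum_list bs = concat (map snd bs)"

text \<open>
  Permutations act on the positions \<open>1, \<dots>, n\<close>, whereas list indices start from \<open>0\<close>.
\<close>

definition permute_positions :: "(nat \<Rightarrow> nat) \<Rightarrow> 'a list \<Rightarrow> 'a list" where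
  "permute_positions \<sigma> xs = map (\<lambda>i. xs ! (inv_into UNIV \<sigma> i - 1)) [1..<length xs + 1]"

definition refactorization ::
  "nat \<Rightarrow> nat \<Rightarrow> (nat \<Rightarrow> nat) \<Rightarrow> (complex mat \<times> complex list) list \<Rightarrow>
    (complex mat \<times> complex list) list \<Rightarrow> bool" where
  "refactorization m N \<sigma> b b' \<longleftrightarrow>
    b' \<in> points (power_variety (Ubar m) N) \<and>
    matrix_polynomial m b = matrix_polynomial m b' \<and>
    spectrum_list b' = permute_positions \<sigma> (spectrum_list b)"

definition perm_act ::
  "nat \<Rightarrow> nat \<Rightarrow> (nat \<Rightarrow> nat) \<Rightarrow> (complex mat \<times> complex list) list \<Rightarrow>
    (complex mat \<times> complex list) list" where
  "perm_act m N \<sigma> b = (THE b'. refactorization m N \<sigma> b b')"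

text \<open>The permutation \<open>(1, m + 1) (2, m + 2) \<cdots> (m, 2 m)\<close>.\<close>

definition block_swap :: "nat \<Rightarrow> nat \<Rightarrow> nat" where
  "block_swap m =
    foldr (\<lambda>j \<pi>. Transposition.transpose j (m + j) \<circ> \<pi>) [1..<m + 1] id"

end

theory Submission
  imports Defs
begin

text \<open>
  A factorization \<open>P(t) = (t - b\<^sub>1) \<cdots> (t - b\<^sub>N)\<close> whose \<open>m N\<close> eigenvalues are
  pairwise distinct is determined by \<open>P\<close> and the list of eigenvalues
  (\<open>factorization_unique\<close>): if \<open>l\<close> is an eigenvalue of \<open>b\<^sub>1\<close>, the other factors are invertible at
  \<open>t = l\<close>, so the left kernel of \<open>P(l)\<close> is the left eigenspace of \<open>b\<^sub>1\<close> at \<open>l\<close>; the \<open>m\<close> left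
  eigenvectors found in this way determine \<open>b\<^sub>1\<close>, and \<open>t - b\<^sub>1\<close> can be cancelled. Consequently all
  relations between the maps of the action (the group law, involutivity, the braid relation) follow
  from the corresponding relations between permutations of eigenvalues, as soon as both sides are
  defined.

  Existence is reduced to adjacent transpositions, because birational maps can be composed. A
  transposition inside a block only permutes the list of eigenvalues of one factor. For the one that
  exchanges an eigenvalue \<open>l\<close> of \<open>b\<^sub>1\<close> with an eigenvalue \<open>k\<close> of \<open>b\<^sub>2\<close> there is an explicit
  formula (\<open>exchange_identities\<close>): if \<open>u\<close> is a right eigenvector of \<open>b\<^sub>1\<close> at \<open>l\<close>, \<open>w\<close> a left
  eigenvector of \<open>b\<^sub>2\<close> at \<open>k\<close> and \<open>w u \<noteq> 0\<close>, then \<open>p = u w / (w u)\<close> is idempotent and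
  \<open>b\<^sub>1 + (k - l) p\<close>, \<open>b\<^sub>2 - (k - l) p\<close> are the new factors. Columns of the product of
  \<open>b\<^sub>1 - s\<close> over the other eigenvalues \<open>s\<close> of \<open>b\<^sub>1\<close>, and rows of the analogous product for
  \<open>b\<^sub>2\<close>, serve as \<open>u\<close> and \<open>w\<close>, so that the formula is rational in the coordinates. The open
  set where \<open>w u \<noteq> 0\<close> is mapped to itself
    and the map is an involution on it (\<open>acts_birationally_boundary\<close>).

  "Generic" requires that nonempty Zariski-open sets are dense, that is, that the powers of the
  variety are irreducible. Writing \<open>b = G D G\<inverse>\<close> with \<open>D\<close> diagonal and joining two such
  parametrizations by line segments in the entries of \<open>G\<close> and \<open>D\<close>, any two points lie on a rational
  curve, and this forces irreducibility (\<open>irreducible_if_rationally_connected\<close>). Only polynomials in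
  one variable are needed.
\<close>

section \<open>Regular functions and generic properties\<close>

abbreviation (input) poly_funs :: "'a variety \<Rightarrow> ('a \<Rightarrow> complex) set" where
  "poly_funs X \<equiv> polynomial_functions (coords X)"

lemma zariski_open_subset: "zariski_open X V \<Longrightarrow> V \<subseteq> points X"
  unfolding zariski_open_def by blast

text \<open>
  The sets where a single polynomial does not vanish form a basis of the topology. This
  description is local, which makes unions and preimages of open sets easy to handle.
\<close>

lemma zariski_open_iff:
  "zariski_open X V \<longleftrightarrow> V \<subseteq> points X \<and>
    (\<forall>x\<in>V. \<exists>p\<in>poly_funs X. p x \<noteq> 0 \<and>
      (\<forall>y\<in>points X. p y \<noteq> 0 \<longrightarrow> y \<in> V))" (is "_ \<longleftrightarrow> ?R")
proof
  assume "zariski_open X V"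
  then obtain S where V: "V \<subseteq> points X" and S: "S \<subseteq> poly_funs X"
    and eq: "points X - V = {x \<in> points X. \<forall>p\<in>S. p x = 0}"
    unfolding zariski_open_def zariski_closed_def by auto
  show ?R
  proof (intro conjI ballI V)
    fix x assume x: "x \<in> V"
    then obtain p where "p \<in> S" "p x \<noteq> 0" using V eq by blast
    then show "\<exists>p\<in>poly_funs X. p x \<noteq> 0 \<and>
      (\<forall>y\<in>points X. p y \<noteq> 0 \<longrightarrow> y \<in> V)" using S eq by blast
  qed
next
  assume R: ?R
  let ?S = "{p \<in> poly_funs X. \<forall>y\<in>points X - V. p y = 0}"
  have "points X - V = {x \<in> points X. \<forall>p\<in>?S. p x = 0}"
  proof (intro Set.equalityI subsetI)
    fix x assume x: "x \<in> {x \<in> points X. \<forall>p\<in>?S. p x = 0}"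
    have "x \<notin> V"
    proof
      assume "x \<in> V"
      then obtain p where "p \<in> poly_funs X" "p x \<noteq> 0"
        "\<forall>y\<in>points X. p y \<noteq> 0 \<longrightarrow> y \<in> V" using R by meson
      then have "p \<in> ?S" by auto
      then show False using x \<open>p x \<noteq> 0\<close> by auto
    qed
    then show "x \<in> points X - V" using x by simp
  next
    fix x assume "x \<in> points X - V"
    then show "x \<in> {x \<in> points X. \<forall>p\<in>?S. p x = 0}" by simp
  qed
  moreover have "?S \<subseteq> poly_funs X" by blast
  ultimately have "zariski_closed X (points X - V)" unfolding zariski_closed_def by blast
  with R show "zariski_open X V" unfolding zariski_open_def by simp
qed

lemma zariski_openD:
  assumes "zariski_open X V" "x \<in> V"
  obtains p where "p \<in> poly_funs X" "p x \<noteq> 0"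
    "\<And>y. y \<in> points X \<Longrightarrow> p y \<noteq> 0 \<Longrightarrow> y \<in> V"
  using assms unfolding zariski_open_iff by blast

lemma zariski_open_points: "zariski_open X (points X)"
  unfolding zariski_open_iff by (auto intro!: bexI[OF _ polynomial_functions.const[of 1]])

lemma zariski_open_Int:
  assumes "zariski_open X V" "zariski_open X W"
  shows "zariski_open X (V \<inter> W)"
  unfolding zariski_open_iff
proof (intro conjI ballI)
  show "V \<inter> W \<subseteq> points X" using assms zariski_open_subset by blast
  fix x assume x: "x \<in> V \<inter> W"
  obtain p where p: "p \<in> poly_funs X" "p x \<noteq> 0"
    "\<And>y. y \<in> points X \<Longrightarrow> p y \<noteq> 0 \<Longrightarrow> y \<in> V"
    using zariski_openD[OF assms(1)] x by blast
  obtain q where q: "q \<in> poly_funs X" "q x \<noteq> 0"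
    "\<And>y. y \<in> points X \<Longrightarrow> q y \<noteq> 0 \<Longrightarrow> y \<in> W"
    using zariski_openD[OF assms(2)] x by blast
  show "\<exists>p\<in>poly_funs X. p x \<noteq> 0 \<and>
      (\<forall>y\<in>points X. p y \<noteq> 0 \<longrightarrow> y \<in> V \<inter> W)"
    using p q by (intro bexI[OF _ polynomial_functions.mult[OF p(1) q(1)]]) auto
qed

lemma zariski_open_local:
  assumes "\<And>x. x \<in> V \<Longrightarrow> \<exists>W. zariski_open X W \<and> x \<in> W \<and> W \<subseteq> V"
  shows "zariski_open X V"
  unfolding zariski_open_iff
proof (intro conjI ballI)
  show "V \<subseteq> points X" using assms unfolding zariski_open_iff by blast
  fix x assume "x \<in> V"
  then obtain W where W: "zariski_open X W" "x \<in> W" "W \<subseteq> V" using assms by blast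
  obtain p where "p \<in> poly_funs X" "p x \<noteq> 0"
    "\<And>y. y \<in> points X \<Longrightarrow> p y \<noteq> 0 \<Longrightarrow> y \<in> W"
    using zariski_openD[OF W(1,2)] by blast
  then show "\<exists>p\<in>poly_funs X. p x \<noteq> 0 \<and>
      (\<forall>y\<in>points X. p y \<noteq> 0 \<longrightarrow> y \<in> V)" using W by blast
qed

lemma zariski_open_nonzero:
  assumes "p \<in> poly_funs X" "zariski_open X V"
  shows "zariski_open X {x \<in> V. p x \<noteq> 0}"
proof -
  have "zariski_open X {x \<in> points X. p x \<noteq> 0}"
    unfolding zariski_open_iff using assms by blast
  then have "zariski_open X ({x \<in> points X. p x \<noteq> 0} \<inter> V)"
    using assms zariski_open_Int by blast
  moreover have "{x \<in> points X. p x \<noteq> 0} \<inter> V = {x \<in> V. p x \<noteq> 0}"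
    using assms(2) unfolding zariski_open_iff by blast
  ultimately show ?thesis by simp
qed

text \<open>
  Matrix operations are unspecified on arguments of unsuitable dimensions, so an expression in
  the entries is in general a polynomial on the points of the variety only, and not on the whole
  type.
\<close>

definition polynomial_on :: "'a variety \<Rightarrow> ('a \<Rightarrow> complex) \<Rightarrow> bool" where
  "polynomial_on X f \<longleftrightarrow> (\<exists>p\<in>poly_funs X. \<forall>x\<in>points X. f x = p x)"

lemma polynomial_on_const: "polynomial_on X (\<lambda>_. c)"
  unfolding polynomial_on_def by (intro bexI[OF _ polynomial_functions.const]) auto

lemma polynomial_on_coord: "c \<in> coords X \<Longrightarrow> polynomial_on X c"
  unfolding polynomial_on_def by (auto intro: polynomial_functions.coord)

lemma polynomial_on_cong:
  assumes "\<And>x. x \<in> points X \<Longrightarrow> f x = g x"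
  shows "polynomial_on X f \<longleftrightarrow> polynomial_on X g"
  unfolding polynomial_on_def using assms by auto

lemma polynomial_on_if_eq:
  assumes "polynomial_on X g" "\<And>x. x \<in> points X \<Longrightarrow> f x = g x"
  shows "polynomial_on X f"
  using assms polynomial_on_cong[of X f g] by simp

lemma polynomial_on_add:
  assumes "polynomial_on X f" "polynomial_on X g"
  shows "polynomial_on X (\<lambda>x. f x + g x)"
  using assms unfolding polynomial_on_def by (auto intro: polynomial_functions.add)

lemma polynomial_on_mult:
  assumes "polynomial_on X f" "polynomial_on X g"
  shows "polynomial_on X (\<lambda>x. f x * g x)"
  using assms unfolding polynomial_on_def by (auto intro: polynomial_functions.mult)

lemma polynomial_on_diff:
  assumes "polynomial_on X f" "polynomial_on X g"
  shows "polynomial_on X (\<lambda>x. f x - g x)"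
  using polynomial_on_add[OF assms(1) polynomial_on_mult[OF polynomial_on_const assms(2), of "-1"]]
  by simp

lemma polynomial_on_sum:
  assumes "\<And>i. i \<in> I \<Longrightarrow> polynomial_on X (f i)"
  shows "polynomial_on X (\<lambda>x. \<Sum>i\<in>I. f i x)"
  using assms
  by (induction I rule: infinite_finite_induct)
    (auto intro: polynomial_on_const polynomial_on_add)

lemma polynomial_on_prod:
  assumes "\<And>i. i \<in> I \<Longrightarrow> polynomial_on X (f i)"
  shows "polynomial_on X (\<lambda>x. \<Prod>i\<in>I. f i x)"
  using assms
  by (induction I rule: infinite_finite_induct)
    (auto intro: polynomial_on_const polynomial_on_mult)

lemma polynomial_on_functions:
  "p \<in> poly_funs X \<Longrightarrow> polynomial_on X p"
  unfolding polynomial_on_def by blast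

lemma zariski_open_polynomial_on:
  assumes "polynomial_on X f" "zariski_open X V"
  shows "zariski_open X {x \<in> V. f x \<noteq> 0}"
proof -
  obtain p where p: "p \<in> poly_funs X" "\<forall>x\<in>points X. f x = p x"
    using assms unfolding polynomial_on_def by blast
  have "{x \<in> V. f x \<noteq> 0} = {x \<in> V. p x \<noteq> 0}"
    using p assms(2) unfolding zariski_open_iff by auto
  then show ?thesis using zariski_open_nonzero[OF p(1) assms(2)] by simp
qed

definition quotient_at :: "'a variety \<Rightarrow> 'a set \<Rightarrow> ('a \<Rightarrow> complex) \<Rightarrow> 'a \<Rightarrow> bool" where
  "quotient_at X V f x \<longleftrightarrow> (\<exists>p q. polynomial_on X p \<and> polynomial_on X q \<and>
    q x \<noteq> 0 \<and> (\<forall>y\<in>V. q y \<noteq> 0 \<longrightarrow> f y = p y / q y))"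

lemma quotient_atI:
  assumes "polynomial_on X p" "polynomial_on X q" "q x \<noteq> 0"
    "\<And>y. y \<in> V \<Longrightarrow> q y \<noteq> 0 \<Longrightarrow> f y = p y / q y"
  shows "quotient_at X V f x"
  unfolding quotient_at_def by (rule exI[of _ p], rule exI[of _ q]) (use assms in auto)

text \<open>
  The neighbourhood in the definition of regularity can be absorbed into the denominator: after
  multiplying numerator and denominator by a polynomial that vanishes outside it, the formula
  holds wherever the denominator is nonzero.
\<close>

lemma regular_on_iff:
  assumes "zariski_open X V"
  shows "regular_on X V f \<longleftrightarrow> (\<forall>x\<in>V. quotient_at X V f x)" (is "_ \<longleftrightarrow> ?R")
proof
  assume reg: "regular_on X V f"
  have V: "V \<subseteq> points X" using zariski_open_subset[OF assms] .
  show ?R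
  proof
    fix x assume "x \<in> V"
    then obtain V' p q where V': "zariski_open X V'" "x \<in> V'" "V' \<subseteq> V"
      and pq: "p \<in> poly_funs X" "q \<in> poly_funs X"
        "\<forall>y\<in>V'. q y \<noteq> 0 \<and> f y = p y / q y"
      using reg unfolding regular_on_def by meson
    obtain h where h: "h \<in> poly_funs X" "h x \<noteq> 0"
      "\<And>y. y \<in> points X \<Longrightarrow> h y \<noteq> 0 \<Longrightarrow> y \<in> V'"
      using zariski_openD[OF V'(1,2)] by metis
    show "quotient_at X V f x"
      by (rule quotient_atI[of _ "\<lambda>y. p y * h y" "\<lambda>y. q y * h y"])
        (use pq h V' V in \<open>auto intro!: polynomial_on_functions polynomial_functions.mult\<close>)
  qed
next
  assume R: ?R
  show "regular_on X V f"
    unfolding regular_on_def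
  proof
    fix x assume x: "x \<in> V"
    \<comment> \<open>The given functions are polynomials on the points only; representatives in the polynomial
      ring are needed to describe an open set.\<close>
    from bspec[OF R this] obtain p' q' where pq': "polynomial_on X p'" "polynomial_on X q'"
      and nz: "q' x \<noteq> 0" and eq: "\<forall>y\<in>V. q' y \<noteq> 0 \<longrightarrow> f y = p' y / q' y"
      unfolding quotient_at_def by (elim exE conjE)
    obtain p where p: "p \<in> poly_funs X" "\<forall>x\<in>points X. p' x = p x"
      using pq'(1) unfolding polynomial_on_def by blast
    obtain q where q: "q \<in> poly_funs X" "\<forall>x\<in>points X. q' x = q x"
      using pq'(2) unfolding polynomial_on_def by blast
    have "V \<subseteq> points X" using zariski_open_subset[OF assms] .
    show "\<exists>V' p q. zariski_open X V' \<and> x \<in> V' \<and> V' \<subseteq> V \<and>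
      p \<in> poly_funs X \<and> q \<in> poly_funs X \<and>
      (\<forall>y\<in>V'. q y \<noteq> 0 \<and> f y = p y / q y)"
      by (rule exI[of _ "{y \<in> V. q y \<noteq> 0}"], rule exI[of _ p], rule exI[of _ q])
        (use \<open>V \<subseteq> points X\<close> p q nz eq x zariski_open_nonzero[OF q(1) assms]
          in \<open>auto simp: subset_iff\<close>)
  qed
qed

lemma regular_onE:
  assumes "zariski_open X V" "regular_on X V f" "x \<in> V"
  obtains p q where "polynomial_on X p" "polynomial_on X q" "q x \<noteq> 0"
    "\<And>y. y \<in> V \<Longrightarrow> q y \<noteq> 0 \<Longrightarrow> f y = p y / q y"
proof -
  have "quotient_at X V f x"
    using assms(2,3) unfolding regular_on_iff[OF assms(1)] by (rule bspec)
  then show thesis unfolding quotient_at_def by (elim exE conjE) (rule that, auto)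
qed

lemma regular_on_polynomial:
  assumes "zariski_open X V" "polynomial_on X f"
  shows "regular_on X V f"
  unfolding regular_on_iff[OF assms(1)]
  by (intro ballI, rule quotient_atI[of _ f "\<lambda>_. 1"])
    (use assms in \<open>auto intro: polynomial_on_const\<close>)

lemma regular_on_add:
  assumes V: "zariski_open X V" and f: "regular_on X V f" and g: "regular_on X V g"
  shows "regular_on X V (\<lambda>x. f x + g x)"
  unfolding regular_on_iff[OF V]
proof
  fix x assume x: "x \<in> V"
  obtain p q where pq: "polynomial_on X p" "polynomial_on X q" "q x \<noteq> 0"
    "\<And>y. y \<in> V \<Longrightarrow> q y \<noteq> 0 \<Longrightarrow> f y = p y / q y"
    using regular_onE[OF V f x] by metis
  obtain r s where rs: "polynomial_on X r" "polynomial_on X s" "s x \<noteq> 0"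
    "\<And>y. y \<in> V \<Longrightarrow> s y \<noteq> 0 \<Longrightarrow> g y = r y / s y"
    using regular_onE[OF V g x] by metis
  show "quotient_at X V (\<lambda>y. f y + g y) x"
    by (rule quotient_atI[of _ "\<lambda>y. p y * s y + r y * q y" "\<lambda>y. q y * s y"])
        (use pq rs in \<open>auto intro!: polynomial_on_add polynomial_on_mult simp: add_frac_eq\<close>)
qed

lemma regular_on_mult:
  assumes V: "zariski_open X V" and f: "regular_on X V f" and g: "regular_on X V g"
  shows "regular_on X V (\<lambda>x. f x * g x)"
  unfolding regular_on_iff[OF V]
proof
  fix x assume x: "x \<in> V"
  obtain p q where pq: "polynomial_on X p" "polynomial_on X q" "q x \<noteq> 0"
    "\<And>y. y \<in> V \<Longrightarrow> q y \<noteq> 0 \<Longrightarrow> f y = p y / q y"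
    using regular_onE[OF V f x] by metis
  obtain r s where rs: "polynomial_on X r" "polynomial_on X s" "s x \<noteq> 0"
    "\<And>y. y \<in> V \<Longrightarrow> s y \<noteq> 0 \<Longrightarrow> g y = r y / s y"
    using regular_onE[OF V g x] by metis
  show "quotient_at X V (\<lambda>y. f y * g y) x"
    by (rule quotient_atI[of _ "\<lambda>y. p y * r y" "\<lambda>y. q y * s y"])
        (use pq rs in \<open>auto intro!: polynomial_on_mult\<close>)
qed

text \<open>
  From \<open>f = p / q\<close> one gets \<open>1 / f = q\<^sup>2 / (p q)\<close>. The factor \<open>q\<close> is kept in the denominator
  because the formula for \<open>f\<close> is only known where \<open>q \<noteq> 0\<close>.
\<close>

lemma regular_on_inverse:
  assumes V: "zariski_open X V" and f: "regular_on X V f" and nz: "\<And>x. x \<in> V \<Longrightarrow> f x \<noteq> 0"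
  shows "regular_on X V (\<lambda>x. inverse (f x))"
  unfolding regular_on_iff[OF V]
proof
  fix x assume x: "x \<in> V"
  obtain p q where pq: "polynomial_on X p" "polynomial_on X q" "q x \<noteq> 0"
    "\<And>y. y \<in> V \<Longrightarrow> q y \<noteq> 0 \<Longrightarrow> f y = p y / q y"
    using regular_onE[OF V f x] by metis
  have "p x \<noteq> 0" using pq nz[OF x] x by auto
  show "quotient_at X V (\<lambda>y. inverse (f y)) x"
    by (rule quotient_atI[of _ "\<lambda>y. q y * q y" "\<lambda>y. p y * q y"])
        (use \<open>p x \<noteq> 0\<close> pq in \<open>auto intro!: polynomial_on_mult\<close>)
qed

lemma regular_on_divide:
  assumes "zariski_open X V" "regular_on X V f" "regular_on X V g" "\<And>x. x \<in> V \<Longrightarrow> g x \<noteq> 0"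
  shows "regular_on X V (\<lambda>x. f x / g x)"
  using regular_on_mult[OF assms(1,2) regular_on_inverse[OF assms(1,3,4)]]
  by (simp add: divide_inverse)

lemma regular_on_subset:
  assumes "zariski_open X V" "zariski_open X W" "W \<subseteq> V" "regular_on X V f"
  shows "regular_on X W f"
  unfolding regular_on_iff[OF assms(2)]
proof
  fix x assume "x \<in> W"
  then have "x \<in> V" using assms(3) by blast
  from regular_onE[OF assms(1,4) this] obtain p q where
    pq: "polynomial_on X p" "polynomial_on X q" "q x \<noteq> 0"
    "\<And>y. y \<in> V \<Longrightarrow> q y \<noteq> 0 \<Longrightarrow> f y = p y / q y" by metis
  show "quotient_at X W (\<lambda>y. f y) x"
    by (rule quotient_atI[of _ p q]) (use pq assms(3) in auto)
qed

lemma regular_on_cong: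
  assumes "\<And>x. x \<in> V \<Longrightarrow> f x = g x"
  shows "regular_on X V f \<longleftrightarrow> regular_on X V g"
proof -
  have "(\<forall>y\<in>V'. q y \<noteq> 0 \<and> f y = p y / q y) \<longleftrightarrow> (\<forall>y\<in>V'. q y \<noteq> 0 \<and> g y = p y / q y)"
    if "V' \<subseteq> V" for V' and p q :: "'a \<Rightarrow> complex"
    using that assms by (intro ball_cong) auto
  then show ?thesis unfolding regular_on_def by (simp cong: conj_cong)
qed

lemma regular_on_if_eq:
  assumes "regular_on X V g" "\<And>x. x \<in> V \<Longrightarrow> f x = g x"
  shows "regular_on X V f"
  using assms regular_on_cong[of V f g X] by simp

lemma regular_on_local:
  assumes "\<And>x. x \<in> V \<Longrightarrow> \<exists>W. zariski_open X W \<and> x \<in> W \<and> W \<subseteq> V \<and> regular_on X W f"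
  shows "regular_on X V f"
  unfolding regular_on_def
proof
  fix x assume "x \<in> V"
  then obtain W where W: "x \<in> W" "W \<subseteq> V" "regular_on X W f" using assms by blast
  from W(3) W(1) have "\<exists>V' p q. zariski_open X V' \<and> x \<in> V' \<and> V' \<subseteq> W \<and>
      p \<in> poly_funs X \<and> q \<in> poly_funs X \<and>
      (\<forall>y\<in>V'. q y \<noteq> 0 \<and> f y = p y / q y)" unfolding regular_on_def by (rule bspec)
  then show "\<exists>V' p q. zariski_open X V' \<and> x \<in> V' \<and> V' \<subseteq> V \<and>
      p \<in> poly_funs X \<and> q \<in> poly_funs X \<and>
      (\<forall>y\<in>V'. q y \<noteq> 0 \<and> f y = p y / q y)"
    using W(2) by (elim ex_forward conj_forward) auto
qed

lemma regular_mapD: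
  "regular_map X V Y f \<Longrightarrow> c \<in> coords Y \<Longrightarrow> regular_on X V (\<lambda>x. c (f x))"
  unfolding regular_map_def by blast

lemma regular_on_polynomial_functions_comp:
  assumes V: "zariski_open X V" and g: "regular_map X V Y g"
    and p: "p \<in> poly_funs Y"
  shows "regular_on X V (\<lambda>x. p (g x))"
  using p
proof induction
  case (const c)
  show ?case by (rule regular_on_polynomial[OF V polynomial_on_const])
next
  case (coord f)
  then show ?case using g unfolding regular_map_def by blast
next
  case (add p q)
  then show ?case using regular_on_add[OF V] by blast
next
  case (mult p q)
  then show ?case using regular_on_mult[OF V] by blast
qed

lemma regular_on_polynomial_on_comp:
  assumes V: "zariski_open X V" and g: "regular_map X V Y g" and f: "polynomial_on Y f"
  shows "regular_on X V (\<lambda>x. f (g x))"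
proof -
  obtain p where p: "p \<in> poly_funs Y" "\<forall>y\<in>points Y. f y = p y"
    using f unfolding polynomial_on_def by blast
  have "regular_on X V (\<lambda>x. f (g x)) \<longleftrightarrow> regular_on X V (\<lambda>x. p (g x))"
    using p g unfolding regular_map_def by (intro regular_on_cong) auto
  then show ?thesis using regular_on_polynomial_functions_comp[OF V g p(1)] by simp
qed

lemma zariski_open_regular_nonzero:
  assumes V: "zariski_open X V" and f: "regular_on X V f"
  shows "zariski_open X {x \<in> V. f x \<noteq> 0}"
proof (rule zariski_open_local)
  fix x assume x: "x \<in> {x \<in> V. f x \<noteq> 0}"
  then obtain p q where pq: "polynomial_on X p" "polynomial_on X q" "q x \<noteq> 0"
    "\<And>y. y \<in> V \<Longrightarrow> q y \<noteq> 0 \<Longrightarrow> f y = p y / q y"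
    using regular_onE[OF V f, of x] by blast
  have "zariski_open X {y \<in> V. p y * q y \<noteq> 0}"
    using zariski_open_polynomial_on[OF polynomial_on_mult[OF pq(1,2)] V] .
  then show "\<exists>W. zariski_open X W \<and> x \<in> W \<and> W \<subseteq> {x \<in> V. f x \<noteq> 0}"
    using x pq by (intro exI[of _ "{y \<in> V. p y * q y \<noteq> 0}"]) auto
qed

lemma zariski_open_preimage:
  assumes V: "zariski_open X V" and g: "regular_map X V Y g" and W: "zariski_open Y W"
  shows "zariski_open X {x \<in> V. g x \<in> W}"
proof (rule zariski_open_local)
  fix x assume x: "x \<in> {x \<in> V. g x \<in> W}"
  then obtain p where p: "p \<in> poly_funs Y" "p (g x) \<noteq> 0"
    "\<And>y. y \<in> points Y \<Longrightarrow> p y \<noteq> 0 \<Longrightarrow> y \<in> W"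
    using zariski_openD[OF W] by (metis (no_types, lifting) mem_Collect_eq)
  have "zariski_open X {x \<in> V. p (g x) \<noteq> 0}"
    using zariski_open_regular_nonzero[OF V regular_on_polynomial_functions_comp[OF V g p(1)]] .
  moreover have "{x \<in> V. p (g x) \<noteq> 0} \<subseteq> {x \<in> V. g x \<in> W}"
    using p g unfolding regular_map_def by auto
  ultimately show "\<exists>U. zariski_open X U \<and> x \<in> U \<and> U \<subseteq> {x \<in> V. g x \<in> W}"
    using x p by blast
qed

lemma regular_on_comp:
  assumes V: "zariski_open X V" and g: "regular_map X V Y g"
    and W: "zariski_open Y W" and f: "regular_on Y W f" and sub: "g ` V \<subseteq> W"
  shows "regular_on X V (\<lambda>x. f (g x))"
proof (rule regular_on_local)
  fix x assume x: "x \<in> V"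
  then obtain p q where pq: "polynomial_on Y p" "polynomial_on Y q" "q (g x) \<noteq> 0"
    "\<And>y. y \<in> W \<Longrightarrow> q y \<noteq> 0 \<Longrightarrow> f y = p y / q y"
    using regular_onE[OF W f, of "g x"] sub by blast
  let ?U = "{x \<in> V. q (g x) \<noteq> 0}"
  have U: "zariski_open X ?U"
    using zariski_open_regular_nonzero[OF V regular_on_polynomial_on_comp[OF V g pq(2)]] .
  have "regular_on X ?U (\<lambda>x. p (g x) / q (g x))"
    by (rule regular_on_divide[OF U])
      (auto intro!: regular_on_subset[OF V U] regular_on_polynomial_on_comp[OF V g] pq)
  moreover have "regular_on X ?U (\<lambda>x. p (g x) / q (g x)) \<longleftrightarrow> regular_on X ?U (\<lambda>x. f (g x))"
    using pq sub by (intro regular_on_cong) auto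
  ultimately show "\<exists>W. zariski_open X W \<and> x \<in> W \<and> W \<subseteq> V \<and> regular_on X W (\<lambda>x. f (g x))"
    using U x pq by (intro exI[of _ ?U]) auto
qed

lemma regular_map_comp:
  assumes "zariski_open X V" "regular_map X V Y g" "zariski_open Y W" "regular_map Y W Z f"
    "g ` V \<subseteq> W"
  shows "regular_map X V Z (f \<circ> g)"
  unfolding regular_map_def
proof (intro conjI ballI)
  show "(f \<circ> g) ` V \<subseteq> points Z" using assms(4,5) unfolding regular_map_def by auto
  fix c assume "c \<in> coords Z"
  from regular_on_comp[OF assms(1-3) regular_mapD[OF assms(4) this] assms(5)]
  show "regular_on X V (\<lambda>x. c ((f \<circ> g) x))" by simp
qed

lemma regular_map_subset:
  assumes "zariski_open X V" "zariski_open X W" "W \<subseteq> V" "regular_map X V Y f"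
  shows "regular_map X W Y f"
  using assms regular_on_subset[OF assms(1-3)] unfolding regular_map_def by blast

lemma regular_map_cong:
  assumes "\<And>x. x \<in> V \<Longrightarrow> f x = g x"
  shows "regular_map X V Y f \<longleftrightarrow> regular_map X V Y g"
proof -
  have "regular_on X V (\<lambda>x. c (f x)) \<longleftrightarrow> regular_on X V (\<lambda>x. c (g x))" for c
    using assms by (intro regular_on_cong) auto
  moreover have "f ` V = g ` V" using assms by (intro image_cong) auto
  ultimately show ?thesis unfolding regular_map_def by simp
qed

text \<open>
  Irreducibility in the form in which it is used: every nonempty open set is dense.
\<close>

definition irreducible_variety :: "'a variety \<Rightarrow> bool" where
  "irreducible_variety X \<longleftrightarrow> points X \<noteq> {} \<and>
    (\<forall>V W. zariski_open X V \<and> V \<noteq> {} \<and> zariski_open X W \<and> W \<noteq> {} \<longrightarrow> V \<inter> W \<noteq> {})"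

lemma irreducible_dense_open_iff:
  "irreducible_variety X \<Longrightarrow> dense_open X V \<longleftrightarrow> zariski_open X V \<and> V \<noteq> {}"
  unfolding dense_open_def irreducible_variety_def by blast

lemma generically_mono:
  assumes "generically X P" "\<And>x. x \<in> points X \<Longrightarrow> P x \<Longrightarrow> Q x"
  shows "generically X Q"
proof -
  obtain V where V: "dense_open X V" "\<And>x. x \<in> V \<Longrightarrow> P x" using assms(1) unfolding generically_def
    by blast
  then have "V \<subseteq> points X" using zariski_open_subset unfolding dense_open_def by blast
  then have "\<forall>x\<in>V. Q x" using assms(2) V(2) by blast
  then show ?thesis unfolding generically_def using V(1) by blast
qed

lemma dense_open_Int:
  assumes "dense_open X V" "dense_open X W"
  shows "dense_open X (V \<inter> W)"
proof -
  have "V \<inter> W \<noteq> {}" using assms unfolding dense_open_def by blast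
  moreover have "V \<inter> W \<inter> V' \<noteq> {}" if "zariski_open X V'" "V' \<noteq> {}" for V'
  proof -
    have "zariski_open X (W \<inter> V')" "W \<inter> V' \<noteq> {}"
      using assms that zariski_open_Int unfolding dense_open_def by blast+
    then show ?thesis using assms unfolding dense_open_def Int_assoc by blast
  qed
  ultimately show ?thesis using assms zariski_open_Int unfolding dense_open_def by blast
qed

lemma generically_conj:
  assumes "generically X P" "generically X Q"
  shows "generically X (\<lambda>x. P x \<and> Q x)"
proof -
  obtain V W where "dense_open X V" "\<forall>x\<in>V. P x" "dense_open X W" "\<forall>x\<in>W. Q x"
    using assms unfolding generically_def by blast
  then show ?thesis unfolding generically_def
    by (intro exI[of _ "V \<inter> W"]) (auto intro: dense_open_Int)
qed

lemma generically_open: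
  assumes "irreducible_variety X" "zariski_open X V" "V \<noteq> {}"
  shows "generically X (\<lambda>x. x \<in> V)"
  using assms irreducible_dense_open_iff unfolding generically_def by blast

section \<open>Birational automorphisms\<close>

text \<open>
  The preimage of a dense open set under a birational map contains a nonempty open set, because
  the image of the map meets every nonempty open set.
\<close>

lemma generically_birational_comp:
  assumes X: "irreducible_variety X" and f: "birational_automorphism X f" and P: "generically X P"
  shows "generically X (\<lambda>x. P (f x))"
proof -
  obtain V V' g where V: "dense_open X V" "dense_open X V'" "regular_map X V X f"
    "g ` V' \<subseteq> V" "\<forall>y\<in>V'. f (g y) = y"
    using f unfolding birational_automorphism_def by blast
  obtain W where W: "dense_open X W" "\<forall>x\<in>W. P x" using P unfolding generically_def by blast
  have "V' \<inter> W \<noteq> {}" using V(2) W(1) unfolding dense_open_def by blast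
  then obtain y where "y \<in> V'" "y \<in> W" by blast
  then have "g y \<in> {x \<in> V. f x \<in> W}" using V by auto
  moreover have "zariski_open X {x \<in> V. f x \<in> W}"
    using zariski_open_preimage[OF _ V(3)] V(1) W(1) unfolding dense_open_def by blast
  ultimately have "generically X (\<lambda>x. x \<in> {x \<in> V. f x \<in> W})"
    by (intro generically_open[OF X]) auto
  then show ?thesis by (rule generically_mono) (use W in auto)
qed

text \<open>
  The composition is defined on the preimage under \<open>g\<close> of the domain of \<open>f\<close>, and its inverse on the
  preimage under the inverse of \<open>f\<close> of the domain of the inverse of \<open>g\<close>. Both are nonempty because
  the range of \<open>g\<close> and the domain of \<open>f\<close> are dense open sets.
\<close>

lemma birational_automorphism_comp:
  assumes X: "irreducible_variety X"
    and f: "birational_automorphism X f" and g: "birational_automorphism X g"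
  shows "birational_automorphism X (f \<circ> g)"
proof -
  obtain V V' f' where V: "dense_open X V" "dense_open X V'"
    "regular_map X V X f" "regular_map X V' X f'" "f ` V \<subseteq> V'" "f' ` V' \<subseteq> V"
    "\<forall>x\<in>V. f' (f x) = x" "\<forall>y\<in>V'. f (f' y) = y"
    using f unfolding birational_automorphism_def by blast
  obtain U U' g' where U: "dense_open X U" "dense_open X U'"
    "regular_map X U X g" "regular_map X U' X g'" "g ` U \<subseteq> U'" "g' ` U' \<subseteq> U"
    "\<forall>x\<in>U. g' (g x) = x" "\<forall>y\<in>U'. g (g' y) = y"
    using g unfolding birational_automorphism_def by blast
  let ?A = "{x \<in> U. g x \<in> V}" and ?B = "{y \<in> V'. f' y \<in> U'}"
  have zo: "zariski_open X V" "zariski_open X V'" "zariski_open X U" "zariski_open X U'"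
    using U V unfolding dense_open_def by auto
  have A: "zariski_open X ?A" using zariski_open_preimage[OF zo(3) U(3) zo(1)] .
  have B: "zariski_open X ?B" using zariski_open_preimage[OF zo(2) V(4) zo(4)] .
  have "U' \<inter> V \<noteq> {}" using U(2) V(1) unfolding dense_open_def by blast
  then obtain z where z: "z \<in> U'" "z \<in> V" by blast
  have "g' z \<in> ?A" "f z \<in> ?B" using z U V by auto
  then have dense: "dense_open X ?A" "dense_open X ?B"
    using irreducible_dense_open_iff[OF X] A B by blast+
  have 1: "regular_map X ?A X (f \<circ> g)"
    using regular_map_subset[OF zo(3) A _ U(3)] by (intro regular_map_comp[OF A _ zo(1) V(3)]) auto
  have 2: "regular_map X ?B X (g' \<circ> f')"
    using regular_map_subset[OF zo(2) B _ V(4)] by (intro regular_map_comp[OF B _ zo(4) U(4)]) auto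
  show ?thesis
    unfolding birational_automorphism_def
    by (rule exI[of _ ?A], rule exI[of _ ?B], rule exI[of _ "g' \<circ> f'"])
      (use dense 1 2 U V in \<open>auto simp: image_subset_iff\<close>)
qed

lemma birational_automorphism_cong:
  assumes X: "irreducible_variety X"
    and f: "birational_automorphism X f" and eq: "rational_eq X f h"
  shows "birational_automorphism X h"
proof -
  obtain V V' f' where V: "dense_open X V" "dense_open X V'"
    "regular_map X V X f" "regular_map X V' X f'" "f ` V \<subseteq> V'" "f' ` V' \<subseteq> V"
    "\<forall>x\<in>V. f' (f x) = x" "\<forall>y\<in>V'. f (f' y) = y"
    using f unfolding birational_automorphism_def by blast
  obtain W where W: "dense_open X W" "\<forall>x\<in>W. f x = h x"
    using eq unfolding rational_eq_def generically_def by blast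
  let ?A = "V \<inter> W" and ?B = "{y \<in> V'. f' y \<in> W}"
  have zo: "zariski_open X V" "zariski_open X V'" "zariski_open X W"
    using V W unfolding dense_open_def by auto
  have A: "zariski_open X ?A" using zariski_open_Int zo by blast
  have B: "zariski_open X ?B" using zariski_open_preimage[OF zo(2) V(4) zo(3)] .
  have "?A \<noteq> {}" using V(1) W(1) unfolding dense_open_def by blast
  then obtain z where z: "z \<in> V" "z \<in> W" by blast
  then have "f z \<in> ?B" using V by auto
  then have dense: "dense_open X ?A" "dense_open X ?B"
    using irreducible_dense_open_iff[OF X] A B \<open>?A \<noteq> {}\<close> by blast+
  have "regular_map X ?A X f" using regular_map_subset[OF zo(1) A _ V(3)] by blast
  then have 1: "regular_map X ?A X h" using W regular_map_cong[of ?A f h X X] by auto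
  have 2: "regular_map X ?B X f'" using regular_map_subset[OF zo(2) B _ V(4)] by auto
  show ?thesis
    unfolding birational_automorphism_def
    by (rule exI[of _ ?A], rule exI[of _ ?B], rule exI[of _ f'])
      (use dense 1 2 V W in \<open>auto simp: image_subset_iff\<close>)
qed

lemma birational_automorphism_involution:
  assumes X: "irreducible_variety X" and V: "zariski_open X V" "V \<noteq> {}"
    and f: "regular_map X V X f" "f ` V \<subseteq> V" "\<And>x. x \<in> V \<Longrightarrow> f (f x) = x"
  shows "birational_automorphism X f"
  unfolding birational_automorphism_def
  by (rule exI[of _ V], rule exI[of _ V], rule exI[of _ f])
    (use assms irreducible_dense_open_iff[OF X] in auto)

lemma birational_automorphism_id:
  assumes X: "irreducible_variety X"
  shows "birational_automorphism X id"
proof (rule birational_automorphism_involution[OF X zariski_open_points])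
  show "points X \<noteq> {}" using X unfolding irreducible_variety_def by blast
  show "regular_map X (points X) X id"
    unfolding regular_map_def
    by (auto intro!: regular_on_polynomial zariski_open_points polynomial_on_coord)
qed auto

lemma rational_eq_sym: "rational_eq X f g \<Longrightarrow> rational_eq X g f"
  unfolding rational_eq_def by (simp add: eq_commute)

section \<open>Powers of a variety\<close>

lemma points_power_variety:
  "xs \<in> points (power_variety X n) \<longleftrightarrow> length xs = n \<and> set xs \<subseteq> points X"
  by (simp add: power_variety_def)

lemma coords_power_variety:
  "coords (power_variety X n) = {\<lambda>xs. c (xs ! k) | c k. c \<in> coords X \<and> k < n}"
  by (simp add: power_variety_def)

lemma power_variety_nth:
  "b \<in> points (power_variety X n) \<Longrightarrow> k < n \<Longrightarrow> b ! k \<in> points X"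
  using nth_mem[of k b] unfolding points_power_variety by blast

lemma coord_factor:
  "c \<in> coords X \<Longrightarrow> k < n \<Longrightarrow> (\<lambda>xs. c (xs ! k)) \<in> coords (power_variety X n)"
  unfolding coords_power_variety by blast

lemma factors_points:
  assumes "xs \<in> points (power_variety X n)" "a + k \<le> n"
  shows "take k (drop a xs) \<in> points (power_variety X k)"
  using assms set_take_subset[of k "drop a xs"] set_drop_subset[of a xs]
  unfolding points_power_variety by auto

lemma polynomial_on_factors:
  assumes ak: "a + k \<le> n" and f: "polynomial_on (power_variety X k) f"
  shows "polynomial_on (power_variety X n) (\<lambda>xs. f (take k (drop a xs)))"
proof -
  obtain p where p: "p \<in> polynomial_functions (coords (power_variety X k))"
    "\<forall>y\<in>points (power_variety X k). f y = p y"
    using f unfolding polynomial_on_def by blast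
  from p(1) have "polynomial_on (power_variety X n) (\<lambda>xs. p (take k (drop a xs)))"
  proof induction
    case (coord f)
    then obtain c i where c: "c \<in> coords X" "i < k" and f: "f = (\<lambda>xs. c (xs ! i))"
      unfolding coords_power_variety by blast
    have "polynomial_on (power_variety X n) (\<lambda>xs. f (take k (drop a xs))) \<longleftrightarrow>
      polynomial_on (power_variety X n) (\<lambda>xs. c (xs ! (a + i)))"
      using c f ak by (intro polynomial_on_cong) (auto simp: points_power_variety)
    moreover have "(\<lambda>xs. c (xs ! (a + i))) \<in> coords (power_variety X n)"
      using c ak unfolding coords_power_variety by (auto intro!: exI[of _ c] exI[of _ "a + i"])
    ultimately show ?case using polynomial_on_coord by blast
  qed (auto intro: polynomial_on_const polynomial_on_add polynomial_on_mult)
  moreover have "polynomial_on (power_variety X n) (\<lambda>xs. f (take k (drop a xs))) \<longleftrightarrow>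
    polynomial_on (power_variety X n) (\<lambda>xs. p (take k (drop a xs)))"
    using p(2) factors_points[OF _ ak] by (intro polynomial_on_cong) auto
  ultimately show ?thesis by simp
qed

lemma regular_map_factors:
  assumes ak: "a + k \<le> n"
  shows "regular_map (power_variety X n) (points (power_variety X n)) (power_variety X k)
    (\<lambda>xs. take k (drop a xs))"
  unfolding regular_map_def
proof (intro conjI ballI)
  show "(\<lambda>xs. take k (drop a xs)) ` points (power_variety X n) \<subseteq> points (power_variety X k)"
    using factors_points[OF _ ak] by blast
qed (intro regular_on_polynomial zariski_open_points polynomial_on_factors[OF ak]
    polynomial_on_coord)

lemma on_factors_points:
  assumes "xs \<in> points (power_variety X n)" "a + k \<le> n"
    "g (take k (drop a xs)) \<in> points (power_variety X k)"
  shows "on_factors a k g xs \<in> points (power_variety X n)"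
  using assms set_take_subset[of a xs] set_drop_subset[of "a + k" xs]
  unfolding points_power_variety on_factors_def by auto

lemma factors_on_factors:
  assumes "length xs = n" "a + k \<le> n" "length (g (take k (drop a xs))) = k"
  shows "take k (drop a (on_factors a k g xs)) = g (take k (drop a xs))"
  using assms unfolding on_factors_def by auto

lemma on_factors_comp:
  assumes "length xs = n" "a + k \<le> n" "length (g (take k (drop a xs))) = k"
  shows "on_factors a k f (on_factors a k g xs) = on_factors a k (f \<circ> g) xs"
  using assms unfolding on_factors_def by auto

lemma on_factors_eq_self:
  assumes "g (take k (drop a xs)) = take k (drop a xs)"
  shows "on_factors a k g xs = xs"
  using assms unfolding on_factors_def
  by (metis append_take_drop_id drop_drop add.commute)

lemma factors_surj:
  assumes "ys \<in> points (power_variety X k)" "a + k \<le> n" "points X \<noteq> {}"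
  obtains xs where "xs \<in> points (power_variety X n)" "take k (drop a xs) = ys"
proof -
  obtain x where "x \<in> points X" using assms by blast
  then have "replicate a x @ ys @ replicate (n - a - k) x \<in> points (power_variety X n)"
    using assms unfolding points_power_variety by auto
  moreover have "take k (drop a (replicate a x @ ys @ replicate (n - a - k) x)) = ys"
    using assms unfolding points_power_variety by simp
  ultimately show ?thesis by (rule that)
qed

lemma on_factors_regular_map:
  assumes ak: "a + k \<le> n" and V: "zariski_open (power_variety X k) V"
    and g: "regular_map (power_variety X k) V (power_variety X k) g"
  defines "W \<equiv> {xs \<in> points (power_variety X n). take k (drop a xs) \<in> V}"
  shows "zariski_open (power_variety X n) W"
    and "regular_map (power_variety X n) W (power_variety X n) (on_factors a k g)"
proof -
  let ?X = "power_variety X n"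
  note fac = regular_map_factors[OF ak, of X]
  show W: "zariski_open ?X W"
    unfolding W_def by (rule zariski_open_preimage[OF zariski_open_points fac V])
  have fac': "regular_map ?X W (power_variety X k) (\<lambda>xs. take k (drop a xs))"
    by (rule regular_map_subset[OF zariski_open_points W _ fac]) (auto simp: W_def)
  have pts: "g ` V \<subseteq> points (power_variety X k)" using g unfolding regular_map_def by blast
  have len: "length xs = n" "length (g (take k (drop a xs))) = k" if "xs \<in> W" for xs
    using that pts unfolding W_def points_power_variety
    by (auto simp: subset_iff points_power_variety)
  show "regular_map ?X W ?X (on_factors a k g)"
    unfolding regular_map_def
  proof (intro conjI ballI)
    show "on_factors a k g ` W \<subseteq> points ?X"
      using pts ak by (auto simp: W_def intro!: on_factors_points)
    fix d assume "d \<in> coords ?X"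
    then obtain c i where c: "c \<in> coords X" "i < n" and d: "d = (\<lambda>xs. c (xs ! i))"
      unfolding coords_power_variety by blast
    show "regular_on ?X W (\<lambda>xs. d (on_factors a k g xs))"
    proof (cases "a \<le> i \<and> i < a + k")
      case True
      have "regular_on ?X W (\<lambda>xs. c (g (take k (drop a xs)) ! (i - a)))"
      proof (rule regular_on_comp[OF W fac' V])
        have "(\<lambda>xs. c (xs ! (i - a))) \<in> coords (power_variety X k)"
          unfolding coords_power_variety using c True
            by (auto intro!: exI[of _ c] exI[of _ "i - a"])
        from regular_mapD[OF g this]
        show "regular_on (power_variety X k) V (\<lambda>xs. c (g xs ! (i - a)))" .
      qed (auto simp: W_def)
      moreover have "d (on_factors a k g xs) = c (g (take k (drop a xs)) ! (i - a))"
        if "xs \<in> W" for xs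
        using len[OF that] True ak unfolding d on_factors_def by (auto simp: nth_append)
      ultimately show ?thesis by (rule regular_on_if_eq)
    next
      case False
      have "(\<lambda>xs. c (xs ! i)) \<in> coords ?X"
        unfolding coords_power_variety using c by blast
      then have "regular_on ?X W (\<lambda>xs. c (xs ! i))"
        by (rule regular_on_polynomial[OF W polynomial_on_coord])
      moreover have "d (on_factors a k g xs) = c (xs ! i)" if "xs \<in> W" for xs
        using len[OF that] False ak c unfolding d on_factors_def by (auto simp: nth_append)
      ultimately show ?thesis by (rule regular_on_if_eq)
    qed
  qed
qed

text \<open>
  Domains and inverses are pulled back along the projection to the chosen factors.
\<close>

lemma birational_automorphism_on_factors:
  assumes ak: "a + k \<le> n"
    and X: "irreducible_variety (power_variety X n)" "points X \<noteq> {}"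
    and g: "birational_automorphism (power_variety X k) g"
  shows "birational_automorphism (power_variety X n) (on_factors a k g)"
proof -
  let ?X = "power_variety X n"
  obtain V V' h where V: "dense_open (power_variety X k) V" "dense_open (power_variety X k) V'"
    "regular_map (power_variety X k) V (power_variety X k) g"
    "regular_map (power_variety X k) V' (power_variety X k) h"
    "g ` V \<subseteq> V'" "h ` V' \<subseteq> V" "\<forall>x\<in>V. h (g x) = x" "\<forall>y\<in>V'. g (h y) = y"
    using g unfolding birational_automorphism_def by blast
  let ?W = "\<lambda>V. {xs \<in> points ?X. take k (drop a xs) \<in> V}"
  have zo: "zariski_open (power_variety X k) V" "zariski_open (power_variety X k) V'"
    using V unfolding dense_open_def by auto
  have sub: "V \<subseteq> points (power_variety X k)" "V' \<subseteq> points (power_variety X k)"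
    using zo zariski_open_subset by blast+
  have dense: "dense_open ?X (?W V)" if V: "dense_open (power_variety X k) V"
    "regular_map (power_variety X k) V (power_variety X k) g" for V g
  proof -
    have zo: "zariski_open (power_variety X k) V" using V unfolding dense_open_def by auto
    obtain ys where ys: "ys \<in> V" using V unfolding dense_open_def by auto
    then have "ys \<in> points (power_variety X k)" using zo zariski_open_subset by blast
    then obtain xs where "xs \<in> points ?X" "take k (drop a xs) = ys"
      using factors_surj[OF _ ak X(2)] by metis
    then show ?thesis
      using on_factors_regular_map(1)[OF ak zo V(2)] irreducible_dense_open_iff[OF X(1)] ys by blast
  qed
  have maps: "on_factors a k g xs \<in> ?W U' \<and> (on_factors a k h (on_factors a k g xs) = xs)"
    if "g ` U \<subseteq> U'" "U' \<subseteq> points (power_variety X k)" "\<forall>x\<in>U. h (g x) = x" "xs \<in> ?W U"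
    for U U' g h xs
  proof -
    have xs: "xs \<in> points ?X" "take k (drop a xs) \<in> U" using that by auto
    then have "g (take k (drop a xs)) \<in> U'" using that by blast
    then have g: "g (take k (drop a xs)) \<in> points (power_variety X k)" using that by blast
    have len: "length xs = n" "length (g (take k (drop a xs))) = k"
      using g xs unfolding points_power_variety by auto
    have "on_factors a k g xs \<in> points ?X"
      by (rule on_factors_points[where X = X and n = n and g = g and xs = xs]) (fact xs(1) ak g)+
    moreover have "take k (drop a (on_factors a k g xs)) \<in> U'"
      using factors_on_factors[of xs n a k g] len ak \<open>g (take k (drop a xs)) \<in> U'\<close> by simp
    moreover have "on_factors a k h (on_factors a k g xs) = xs"
      using on_factors_comp[of xs n a k g h] len ak xs(2) that(3)
        on_factors_eq_self[of "h \<circ> g" k a xs] by simp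
    ultimately show ?thesis by blast
  qed
  show ?thesis
    unfolding birational_automorphism_def
  proof (rule exI[of _ "?W V"], rule exI[of _ "?W V'"], rule exI[of _ "on_factors a k h"],
      intro conjI)
    show "dense_open ?X (?W V)" "dense_open ?X (?W V')" using dense V by blast+
    show "regular_map ?X (?W V) ?X (on_factors a k g)"
      "regular_map ?X (?W V') ?X (on_factors a k h)"
      using on_factors_regular_map(2)[OF ak zo(1) V(3)] on_factors_regular_map(2)[OF ak zo(2) V(4)]
      by simp_all
    show "on_factors a k g ` ?W V \<subseteq> ?W V'"
      "\<forall>x\<in>?W V. on_factors a k h (on_factors a k g x) = x"
      using maps[OF V(5) sub(2) V(7)] by blast+
    show "on_factors a k h ` ?W V' \<subseteq> ?W V"
      "\<forall>x\<in>?W V'. on_factors a k g (on_factors a k h x) = x"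
      using maps[OF V(6) sub(1) V(8)] by blast+
  qed
qed

lemma generically_factors:
  assumes ak: "a + k \<le> n"
    and X: "irreducible_variety (power_variety X n)" "points X \<noteq> {}"
    and P: "generically (power_variety X k) P"
  shows "generically (power_variety X n) (\<lambda>xs. P (take k (drop a xs)))"
proof -
  obtain V where V: "dense_open (power_variety X k) V" "\<forall>x\<in>V. P x"
    using P unfolding generically_def by blast
  then have zo: "zariski_open (power_variety X k) V" unfolding dense_open_def by auto
  obtain ys where ys: "ys \<in> V" using V unfolding dense_open_def by auto
  then have "ys \<in> points (power_variety X k)" using zo zariski_open_subset by blast
  then obtain xs where "xs \<in> points (power_variety X n)" "take k (drop a xs) = ys"
    using factors_surj[OF _ ak X(2)] by metis
  then have "generically (power_variety X n)
    (\<lambda>xs. xs \<in> {xs \<in> points (power_variety X n). take k (drop a xs) \<in> V})"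
    using ys zariski_open_preimage[OF zariski_open_points regular_map_factors[OF ak] zo]
    by (intro generically_open[OF X(1)]) auto
  then show ?thesis by (rule generically_mono) (use V in auto)
qed

section \<open>Eigenvalues and diagonalization\<close>

lemma square_mult_assoc:
  fixes A B C :: "complex mat"
  assumes "A \<in> carrier_mat m m" "B \<in> carrier_mat m m" "C \<in> carrier_mat m m"
  shows "A * B * C = A * (B * C)"
  using assms by (rule assoc_mult_mat)

lemma nonzero_vec_index:
  assumes "v \<in> carrier_vec n" "v \<noteq> 0\<^sub>v n"
  shows "\<exists>i<n. v $ i \<noteq> 0"
  using assms by (metis carrier_vecD eq_vecI index_zero_vec)

lemma nonzero_mat_index:
  assumes "X \<in> carrier_mat n k" "X \<noteq> 0\<^sub>m n k"
  shows "\<exists>i<n. \<exists>j<k. X $$ (i, j) \<noteq> 0"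
  using assms by (metis carrier_matD eq_matI index_zero_mat)

lemma eigenvalue_if_right:
  fixes b X :: "complex mat"
  assumes b: "b \<in> carrier_mat m m" and X: "X \<in> carrier_mat m m" "X \<noteq> 0\<^sub>m m m" "b * X = l \<cdot>\<^sub>m X"
  shows "eigenvalue b l"
proof -
  obtain i j where ij: "i < m" "j < m" "X $$ (i, j) \<noteq> 0"
    using nonzero_mat_index[OF X(1,2)] by blast
  have "b *\<^sub>v col X j = col (b * X) j" using b X(1) ij by (intro eq_vecI) auto
  also have "\<dots> = l \<cdot>\<^sub>v col X j" using X ij by auto
  finally have "b *\<^sub>v col X j = l \<cdot>\<^sub>v col X j" .
  moreover have "col X j \<noteq> 0\<^sub>v m"
  proof
    assume "col X j = 0\<^sub>v m"
    then have "col X j $ i = 0" using ij by simp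
    then show False using ij X by simp
  qed
  ultimately have "eigenvector b (col X j) l" using b X unfolding eigenvector_def by auto
  then show ?thesis unfolding eigenvalue_def by blast
qed

lemma eigenvalue_transpose:
  fixes b :: "complex mat"
  assumes b: "b \<in> carrier_mat m m"
  shows "eigenvalue (transpose_mat b) l \<longleftrightarrow> eigenvalue b l"
  using b eigenvalue_root_char_poly[OF b, of l]
    eigenvalue_root_char_poly[of "transpose_mat b" m l] by simp

lemma eigenvalue_if_left:
  fixes b X :: "complex mat"
  assumes b: "b \<in> carrier_mat m m" and X: "X \<in> carrier_mat m m" "X \<noteq> 0\<^sub>m m m" "X * b = l \<cdot>\<^sub>m X"
  shows "eigenvalue b l"
proof -
  have "transpose_mat b * transpose_mat X = transpose_mat (X * b)"
    using transpose_mult[OF X(1) b] by simp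
  also have "\<dots> = l \<cdot>\<^sub>m transpose_mat X" unfolding X(3) by (rule eq_matI) auto
  finally have "transpose_mat b * transpose_mat X = l \<cdot>\<^sub>m transpose_mat X" .
  moreover have "transpose_mat X \<noteq> 0\<^sub>m m m"
  proof
    assume "transpose_mat X = 0\<^sub>m m m"
    then have "transpose_mat (transpose_mat X) = 0\<^sub>m m m" by simp
    then show False using X(2) by simp
  qed
  ultimately have "eigenvalue (transpose_mat b) l"
    using b X by (intro eigenvalue_if_right[of _ m "transpose_mat X"]) auto
  then show ?thesis using eigenvalue_transpose[OF b] by simp
qed

lemma eigenvalue_right:
  fixes b :: "complex mat"
  assumes b: "b \<in> carrier_mat m m" and l: "eigenvalue b l"
  obtains X where "X \<in> carrier_mat m m" "X \<noteq> 0\<^sub>m m m" "b * X = l \<cdot>\<^sub>m X"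
proof -
  obtain v where v: "v \<in> carrier_vec m" "v \<noteq> 0\<^sub>v m" "b *\<^sub>v v = l \<cdot>\<^sub>v v"
    using l b unfolding eigenvalue_def eigenvector_def by auto
  define X where "X = mat m m (\<lambda>(i, j). v $ i)"
  have col: "col X j = v" if "j < m" for j using v that by (intro eq_vecI) (auto simp: X_def)
  have X: "X \<in> carrier_mat m m" unfolding X_def by simp
  have "b * X = l \<cdot>\<^sub>m X"
  proof (rule eq_matI)
    fix i j assume "i < dim_row (l \<cdot>\<^sub>m X)" "j < dim_col (l \<cdot>\<^sub>m X)"
    then have ij: "i < m" "j < m" using X by auto
    have "(b * X) $$ (i, j) = (b *\<^sub>v v) $ i" using ij b X col[of j] by simp
    also have "\<dots> = l * v $ i" using v ij by simp
    finally show "(b * X) $$ (i, j) = (l \<cdot>\<^sub>m X) $$ (i, j)" using ij X by (simp add: X_def)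
  qed (use b X in auto)
  moreover have "X \<noteq> 0\<^sub>m m m"
  proof
    assume 0: "X = 0\<^sub>m m m"
    have "v $ i = 0" if "i < m" for i
    proof -
      have "v $ i = X $$ (i, i)" using that by (simp add: X_def)
      then show ?thesis using 0 that by simp
    qed
    then have "v = 0\<^sub>v m" using v by (intro eq_vecI) auto
    then show False using v by simp
  qed
  ultimately show ?thesis using X that by blast
qed

lemma eigenvalue_left:
  fixes b :: "complex mat"
  assumes b: "b \<in> carrier_mat m m" and l: "eigenvalue b l"
  obtains X where "X \<in> carrier_mat m m" "X \<noteq> 0\<^sub>m m m" "X * b = l \<cdot>\<^sub>m X"
proof -
  obtain Y where Y: "Y \<in> carrier_mat m m" "Y \<noteq> 0\<^sub>m m m" "transpose_mat b * Y = l \<cdot>\<^sub>m Y"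
    using eigenvalue_right[of "transpose_mat b" m l] b l eigenvalue_transpose[OF b] by auto
  have "transpose_mat Y * b = transpose_mat (transpose_mat b * Y)"
    using transpose_mult[of "transpose_mat b" m m Y m] b Y(1) by simp
  also have "\<dots> = l \<cdot>\<^sub>m transpose_mat Y" unfolding Y(3) by (rule eq_matI) auto
  finally have "transpose_mat Y * b = l \<cdot>\<^sub>m transpose_mat Y" .
  moreover have "transpose_mat Y \<noteq> 0\<^sub>m m m"
  proof
    assume "transpose_mat Y = 0\<^sub>m m m"
    then have "transpose_mat (transpose_mat Y) = 0\<^sub>m m m" by simp
    then show False using Y(2) by simp
  qed
  ultimately show ?thesis using that[of "transpose_mat Y"] Y(1) by simp
qed

lemma points_Ubar:
  "(b, ls) \<in> points (Ubar m) \<longleftrightarrow> b \<in> carrier_mat m m \<and> length ls = m \<and> distinct ls \<and>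
    set ls = {l. eigenvalue b l}"
  by (simp add: Ubar_def)

text \<open>
  An \<open>m\<close> by \<open>m\<close> matrix has at most \<open>m\<close> eigenvalues, so it suffices to exhibit \<open>m\<close> of them.
\<close>

lemma points_UbarI:
  assumes b: "b \<in> carrier_mat m m" and ls: "length ls = m" "distinct ls"
    "\<And>l. l \<in> set ls \<Longrightarrow> eigenvalue b l"
  shows "(b, ls) \<in> points (Ubar m)"
proof -
  have p: "char_poly b \<noteq> 0" "degree (char_poly b) = m"
    using degree_monic_char_poly[OF b] by auto
  have eq: "{l. eigenvalue b l} = {l. poly (char_poly b) l = 0}"
    using eigenvalue_root_char_poly[OF b] by simp
  have "finite {l. eigenvalue b l}" "card {l. eigenvalue b l} \<le> m"
    unfolding eq using poly_roots_finite[OF p(1)] card_poly_roots_bound[OF p(1)] p(2) by auto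
  moreover have "card (set ls) = m" using ls distinct_card by auto
  ultimately have "set ls = {l. eigenvalue b l}"
    using ls(3) by (intro card_seteq) auto
  then show ?thesis unfolding points_Ubar using b ls by simp
qed

text \<open>
  The product of \<open>b - k\<close> over \<open>k\<close> in \<open>ks\<close>; when \<open>ks\<close> lists all eigenvalues of \<open>b\<close> except \<open>l\<close>, it
  is a multiple of the spectral projector of \<open>b\<close> at \<open>l\<close>.
\<close>

definition shift_prod :: "nat \<Rightarrow> complex mat \<Rightarrow> complex list \<Rightarrow> complex mat" where
  "shift_prod m b ks = foldr (\<lambda>k A. (b - k \<cdot>\<^sub>m 1\<^sub>m m) * A) ks (1\<^sub>m m)"

lemma shift_prod_simps[simp]:
  "shift_prod m b [] = 1\<^sub>m m"
  "shift_prod m b (k # ks) = (b - k \<cdot>\<^sub>m 1\<^sub>m m) * shift_prod m b ks"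
  by (simp_all add: shift_prod_def)

lemma shift_prod_carrier[simp]:
  "b \<in> carrier_mat m m \<Longrightarrow> shift_prod m b ks \<in> carrier_mat m m"
  by (induction ks) (auto intro!: mult_carrier_mat minus_carrier_mat)

lemma prod_list_diff_eq_0_iff: "(\<Prod>k\<leftarrow>ks. l - k) = 0 \<longleftrightarrow> l \<in> set ks" for l :: complex
  by (induction ks) auto

lemma scalar_minus_mult_left:
  fixes b X :: "complex mat"
  assumes "b \<in> carrier_mat m m" "X \<in> carrier_mat m m"
  shows "(b - k \<cdot>\<^sub>m 1\<^sub>m m) * X = b * X - k \<cdot>\<^sub>m X"
  using assms by (simp add: minus_mult_distrib_mat[of _ m m] mult_smult_assoc_mat[of _ m m])

lemma scalar_minus_mult_right:
  fixes b X :: "complex mat"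
  assumes "b \<in> carrier_mat m m" "X \<in> carrier_mat m m"
  shows "X * (b - k \<cdot>\<^sub>m 1\<^sub>m m) = X * b - k \<cdot>\<^sub>m X"
  using assms mult_smult_distrib[of X m m "1\<^sub>m m" m k]
  by (simp add: mult_minus_distrib_mat[of _ m m])

lemma smult_diff_mat:
  fixes X :: "complex mat"
  shows "X \<in> carrier_mat m m \<Longrightarrow> l \<cdot>\<^sub>m X - k \<cdot>\<^sub>m X = (l - k) \<cdot>\<^sub>m X"
  by (rule eq_matI) (auto simp: algebra_simps)

lemma smult_smult_mat:
  fixes X :: "complex mat"
  shows "l \<cdot>\<^sub>m (k \<cdot>\<^sub>m X) = (l * k) \<cdot>\<^sub>m X"
  by (rule eq_matI) auto

lemma shift_prod_mult_right:
  assumes b: "b \<in> carrier_mat m m" and X: "X \<in> carrier_mat m m" and eig: "b * X = l \<cdot>\<^sub>m X"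
  shows "shift_prod m b ks * X = (\<Prod>k\<leftarrow>ks. l - k) \<cdot>\<^sub>m X"
proof (induction ks)
  case Nil
  then show ?case using X by (auto intro!: eq_matI)
next
  case (Cons k ks)
  have "shift_prod m b (k # ks) * X = (b - k \<cdot>\<^sub>m 1\<^sub>m m) * (shift_prod m b ks * X)"
    unfolding shift_prod_simps using b X by (intro square_mult_assoc[of _ m]) auto
  also have "\<dots> = (\<Prod>k\<leftarrow>ks. l - k) \<cdot>\<^sub>m ((b - k \<cdot>\<^sub>m 1\<^sub>m m) * X)"
    unfolding Cons.IH using b X by (intro mult_smult_distrib[of _ m m _ m]) auto
  also have "(b - k \<cdot>\<^sub>m 1\<^sub>m m) * X = (l - k) \<cdot>\<^sub>m X"
    using scalar_minus_mult_left[OF b X] eig smult_diff_mat[OF X] by simp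
  finally show ?case by (simp add: smult_smult_mat mult.commute)
qed

lemma shift_prod_mult_left:
  assumes b: "b \<in> carrier_mat m m" and X: "X \<in> carrier_mat m m" and eig: "X * b = l \<cdot>\<^sub>m X"
  shows "X * shift_prod m b ks = (\<Prod>k\<leftarrow>ks. l - k) \<cdot>\<^sub>m X"
proof (induction ks)
  case Nil
  then show ?case using X by (auto intro!: eq_matI)
next
  case (Cons k ks)
  have "X * shift_prod m b (k # ks) = X * (b - k \<cdot>\<^sub>m 1\<^sub>m m) * shift_prod m b ks"
    unfolding shift_prod_simps using b X by (intro square_mult_assoc[of _ m, symmetric]) auto
  also have "X * (b - k \<cdot>\<^sub>m 1\<^sub>m m) = (l - k) \<cdot>\<^sub>m X"
    using scalar_minus_mult_right[OF b X] eig smult_diff_mat[OF X] by simp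
  also have "(l - k) \<cdot>\<^sub>m X * shift_prod m b ks = (l - k) \<cdot>\<^sub>m (X * shift_prod m b ks)"
    using b X by (intro mult_smult_assoc_mat[of _ m m _ m]) auto
  finally show ?case by (simp add: Cons.IH smult_smult_mat)
qed

lemma shift_prod_mult_eigenbasis:
  assumes b: "b \<in> carrier_mat m m" and G: "G \<in> carrier_mat m m"
    and eig: "b * G = G * mat_diag m f"
  shows "shift_prod m b ks * G = G * mat_diag m (\<lambda>j. \<Prod>k\<leftarrow>ks. f j - k)"
proof (induction ks)
  case Nil
  then show ?case using G by simp
next
  case (Cons k ks)
  let ?D = "\<lambda>ks. mat_diag m (\<lambda>j. \<Prod>k\<leftarrow>ks. f j - k)"
  have "shift_prod m b (k # ks) * G = (b - k \<cdot>\<^sub>m 1\<^sub>m m) * (shift_prod m b ks * G)"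
    unfolding shift_prod_simps using b G by (intro square_mult_assoc[of _ m]) auto
  also have "\<dots> = (b - k \<cdot>\<^sub>m 1\<^sub>m m) * G * ?D ks"
    unfolding Cons.IH using b G by (intro square_mult_assoc[of _ m, symmetric]) auto
  also have "(b - k \<cdot>\<^sub>m 1\<^sub>m m) * G = G * mat_diag m (\<lambda>j. f j - k)"
    unfolding scalar_minus_mult_left[OF b G] eig mat_diag_mult_right[OF G]
    using G by (intro eq_matI) (auto simp: algebra_simps)
  also have "G * mat_diag m (\<lambda>j. f j - k) * ?D ks = G * (mat_diag m (\<lambda>j. f j - k) * ?D ks)"
    using G by (intro square_mult_assoc[of _ m]) auto
  finally show ?case by simp
qed

text \<open>
  Eigenvectors for distinct eigenvalues are independent: applied to a linear relation between
  them, the product of \<open>b - k\<close> over all eigenvalues \<open>k\<close> but one leaves a single term.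
\<close>

lemma diagonalization:
  assumes x: "(b, ls) \<in> points (Ubar m)"
  obtains G H where "G \<in> carrier_mat m m" "H \<in> carrier_mat m m" "G * H = 1\<^sub>m m" "H * G = 1\<^sub>m m"
    "b * G = G * mat_diag m ((!) ls)" "b = G * mat_diag m ((!) ls) * H"
proof -
  have b: "b \<in> carrier_mat m m" and ls: "length ls = m" "distinct ls" "set ls = {l. eigenvalue b l}"
    using x unfolding points_Ubar by auto
  have "\<exists>v. eigenvector b v (ls ! i)" if "i < m" for i
    using that ls nth_mem unfolding eigenvalue_def by blast
  then obtain v where v: "\<And>i. i < m \<Longrightarrow> eigenvector b (v i) (ls ! i)" by metis
  have v': "v i \<in> carrier_vec m" "v i \<noteq> 0\<^sub>v m" "b *\<^sub>v v i = ls ! i \<cdot>\<^sub>v v i" if "i < m" for i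
    using v[OF that] b unfolding eigenvector_def by auto
  define G where "G = mat m m (\<lambda>(i, j). v j $ i)"
  have G: "G \<in> carrier_mat m m" unfolding G_def by simp
  have col: "col G j = v j" if "j < m" for j
    using v'(1)[OF that] that by (intro eq_vecI) (auto simp: G_def)
  have eig: "b * G = G * mat_diag m ((!) ls)"
  proof (rule eq_matI)
    fix i j assume "i < dim_row (G * mat_diag m ((!) ls))" "j < dim_col (G * mat_diag m ((!) ls))"
    then have ij: "i < m" "j < m" using G by (auto simp: mat_diag_def)
    have "(b * G) $$ (i, j) = (b *\<^sub>v v j) $ i" using ij b G col[of j] by simp
    also have "\<dots> = ls ! j * v j $ i" using v'[OF ij(2)] ij by simp
    also have "\<dots> = (G * mat_diag m ((!) ls)) $$ (i, j)"
      unfolding mat_diag_mult_right[OF G] using ij by (simp add: G_def)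
    finally show "(b * G) $$ (i, j) = (G * mat_diag m ((!) ls)) $$ (i, j)" .
  qed (use b G in \<open>auto simp: mat_diag_def\<close>)
  have "det G \<noteq> 0"
  proof
    assume "det G = 0"
    then obtain c where c: "c \<in> carrier_vec m" "c \<noteq> 0\<^sub>v m" "G *\<^sub>v c = 0\<^sub>v m"
      using det_0_iff_vec_prod_zero[OF G] by auto
    obtain i where i: "i < m" "c $ i \<noteq> 0"
      using nonzero_vec_index[OF c(1,2)] by blast
    define ks where "ks = remove1 (ls ! i) ls"
    have ks: "set ks = set ls - {ls ! i}" using ls unfolding ks_def by simp
    let ?D = "mat_diag m (\<lambda>j. \<Prod>k\<leftarrow>ks. ls ! j - k)"
    let ?a = "\<Prod>k\<leftarrow>ks. ls ! i - k"
    have zero: "(\<Prod>k\<leftarrow>ks. ls ! j - k) = 0" if "j < m" "j \<noteq> i" for j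
    proof -
      have "ls ! j \<in> set ks" unfolding ks using that ls i nth_eq_iff_index_eq by fastforce
      then show ?thesis unfolding prod_list_diff_eq_0_iff .
    qed
    have nz: "?a \<noteq> 0" unfolding prod_list_diff_eq_0_iff ks by simp
    have "?D *\<^sub>v c = (?a * c $ i) \<cdot>\<^sub>v unit_vec m i"
    proof (rule eq_vecI)
      fix j assume "j < dim_vec ((?a * c $ i) \<cdot>\<^sub>v unit_vec m i)"
      then have j: "j < m" by simp
      have "(?D *\<^sub>v c) $ j = (\<Sum>k = 0..<m. (if j = k then (\<Prod>x\<leftarrow>ks. ls ! k - x) else 0) * c $ k)"
        using j c unfolding mat_diag_def by (auto simp: scalar_prod_def intro!: sum.cong)
      also have "\<dots> = (\<Prod>x\<leftarrow>ks. ls ! j - x) * c $ j"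
        using j by (subst sum.remove[of _ j]) (auto intro!: sum.neutral)
      finally show "(?D *\<^sub>v c) $ j = ((?a * c $ i) \<cdot>\<^sub>v unit_vec m i) $ j"
        using j zero i by (cases "j = i") auto
    qed (auto simp: mat_diag_def)
    then have "G *\<^sub>v (?D *\<^sub>v c) = (?a * c $ i) \<cdot>\<^sub>v (G *\<^sub>v unit_vec m i)"
      using G by (simp add: mult_mat_vec[of _ m m])
    also have "G *\<^sub>v unit_vec m i = v i"
      using G i v'(1)[OF i(1)] by (intro eq_vecI) (auto simp: G_def)
    finally have 1: "G *\<^sub>v (?D *\<^sub>v c) = (?a * c $ i) \<cdot>\<^sub>v v i" .
    have "G *\<^sub>v (?D *\<^sub>v c) = (G * ?D) *\<^sub>v c"
      using G c by (intro assoc_mult_mat_vec[of _ m m _ m, symmetric]) auto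
    also have "\<dots> = (shift_prod m b ks * G) *\<^sub>v c"
      using shift_prod_mult_eigenbasis[OF b G eig] by simp
    also have "\<dots> = shift_prod m b ks *\<^sub>v (G *\<^sub>v c)"
      using G c b by (intro assoc_mult_mat_vec[of _ m m _ m]) auto
    also have "\<dots> = 0\<^sub>v m" unfolding c(3) using shift_prod_carrier[OF b, of ks]
      by (intro eq_vecI) auto
    finally have "(?a * c $ i) \<cdot>\<^sub>v v i = 0\<^sub>v m" using 1 by simp
    moreover obtain k where "k < m" "v i $ k \<noteq> 0"
      using nonzero_vec_index[OF v'(1,2)[OF i(1)]] by blast
    moreover have "((?a * c $ i) \<cdot>\<^sub>v v i) $ k = (?a * c $ i) * v i $ k"
      using v'(1)[OF i(1)] \<open>k < m\<close> by simp
    ultimately have "(?a * c $ i) * v i $ k = 0" by simp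
    then show False using nz i(2) \<open>v i $ k \<noteq> 0\<close> by simp
  qed
  then obtain H where H: "H \<in> carrier_mat m m" "G * H = 1\<^sub>m m" "H * G = 1\<^sub>m m"
    using det_non_zero_imp_unit[OF G, of "()"]
    unfolding Units_def by (auto simp: ring_mat_def)
  have "b = b * (G * H)" using b H by simp
  also have "\<dots> = b * G * H" using b G H by (intro square_mult_assoc[of _ m, symmetric]) auto
  finally have "b = G * mat_diag m ((!) ls) * H" unfolding eig .
  then show ?thesis using that G H eig by blast
qed

lemma points_Ubar_if_eigenbasis:
  assumes b: "b \<in> carrier_mat m m" and G: "G \<in> carrier_mat m m" and H: "H \<in> carrier_mat m m"
    and HG: "H * G = 1\<^sub>m m" and eig: "b * G = G * mat_diag m ((!) ls)"
    and ls: "length ls = m" "distinct ls"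
  shows "(b, ls) \<in> points (Ubar m)"
proof (rule points_UbarI[OF b ls])
  fix l assume "l \<in> set ls"
  then obtain i where i: "i < m" "l = ls ! i" using ls by (metis in_set_conv_nth)
  define X where "X = G * mat_diag m (\<lambda>j. if j = i then 1 else 0)"
  have X: "X \<in> carrier_mat m m" unfolding X_def using G by (intro mult_carrier_mat) auto
  have "b * X = b * G * mat_diag m (\<lambda>j. if j = i then 1 else 0)"
    unfolding X_def using b G by (intro square_mult_assoc[of _ m, symmetric]) auto
  also have "\<dots> = G * (mat_diag m ((!) ls) * mat_diag m (\<lambda>j. if j = i then 1 else 0))"
    unfolding eig using G by (intro square_mult_assoc[of _ m]) auto
  also have "\<dots> = l \<cdot>\<^sub>m X"
    unfolding X_def mat_diag_diag mat_diag_mult_right[OF G] by (rule eq_matI) (auto simp: i)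
  finally have "b * X = l \<cdot>\<^sub>m X" .
  moreover have "X \<noteq> 0\<^sub>m m m"
  proof
    assume "X = 0\<^sub>m m m"
    then have "H * X = 0\<^sub>m m m" using H by simp
    moreover have "H * X = H * G * mat_diag m (\<lambda>j. if j = i then 1 else 0)"
      unfolding X_def using H G by (intro square_mult_assoc[of _ m, symmetric]) auto
    ultimately have "mat_diag m (\<lambda>j. if j = i then 1 else 0 :: complex) = 0\<^sub>m m m"
      unfolding HG using left_mult_one_mat[OF mat_diag_dim] by metis
    then have "mat_diag m (\<lambda>j. if j = i then 1 else 0 :: complex) $$ (i, i) = 0" using i by simp
    then show False using i by (simp add: mat_diag_def)
  qed
  ultimately show "eigenvalue b l" using eigenvalue_if_right[OF b X] by blast
qed

text \<open>
  In an eigenbasis, \<open>shift_prod m b ks\<close> is diagonal, and its entries at all eigenvalues other than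
  \<open>l\<close> vanish. It commutes with \<open>b\<close>, hence the two equations.
\<close>

lemma shift_prod_eigen:
  assumes x: "(b, ls) \<in> points (Ubar m)" and ks: "set ls - {l} \<subseteq> set ks"
  shows "b * shift_prod m b ks = l \<cdot>\<^sub>m shift_prod m b ks"
    and "shift_prod m b ks * b = l \<cdot>\<^sub>m shift_prod m b ks"
proof -
  obtain G H where GH: "G \<in> carrier_mat m m" "H \<in> carrier_mat m m" "G * H = 1\<^sub>m m" "H * G = 1\<^sub>m m"
    and eig: "b * G = G * mat_diag m ((!) ls)" and bGH: "b = G * mat_diag m ((!) ls) * H"
    using diagonalization[OF x] by blast
  have b: "b \<in> carrier_mat m m" and ls: "length ls = m" using x unfolding points_Ubar by auto
  define P where "P = shift_prod m b ks"
  have P: "P \<in> carrier_mat m m" using b unfolding P_def by simp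
  let ?D = "mat_diag m ((!) ls)" and ?E = "mat_diag m (\<lambda>i. \<Prod>k\<leftarrow>ks. ls ! i - k)"
  have PG: "P * G = G * ?E" unfolding P_def by (rule shift_prod_mult_eigenbasis[OF b GH(1) eig])
  have DE: "?D * ?E = l \<cdot>\<^sub>m ?E" "?E * ?D = l \<cdot>\<^sub>m ?E"
  proof -
    have *: "ls ! i * (\<Prod>k\<leftarrow>ks. ls ! i - k) = l * (\<Prod>k\<leftarrow>ks. ls ! i - k)" if "i < m" for i
    proof (cases "ls ! i = l")
      case False
      then have "ls ! i \<in> set ks" using ks that ls nth_mem by blast
      then have "(\<Prod>k\<leftarrow>ks. ls ! i - k) = 0" unfolding prod_list_diff_eq_0_iff .
      then show ?thesis by simp
    qed simp
    show "?D * ?E = l \<cdot>\<^sub>m ?E" "?E * ?D = l \<cdot>\<^sub>m ?E"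
      unfolding mat_diag_diag by (auto intro!: eq_matI simp: mat_diag_def * mult.commute)
  qed
  have cancel: "A = B" if "A * G = B * G" "A \<in> carrier_mat m m" "B \<in> carrier_mat m m" for A B
  proof -
    have *: "Y * G * H = Y" if "Y \<in> carrier_mat m m" for Y :: "complex mat"
      using assoc_mult_mat[OF that GH(1,2)] right_mult_one_mat[OF that] GH(3) by simp
    show ?thesis using *[OF that(2)] unfolding that(1) *[OF that(3)] by (rule sym)
  qed
  have lP: "l \<cdot>\<^sub>m P * G = G * (l \<cdot>\<^sub>m ?E)"
    unfolding mult_smult_assoc_mat[OF P GH(1)] PG mult_smult_distrib[OF GH(1) mat_diag_dim] ..
  have "b * P * G = b * (P * G)" using b P GH(1,2) by (intro square_mult_assoc[of _ m]) auto
  also have "\<dots> = b * G * ?E" unfolding PG using b GH(1,2)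
    by (intro square_mult_assoc[of _ m, symmetric]) auto
  also have "\<dots> = G * (?D * ?E)" unfolding eig using GH(1,2)
    by (intro square_mult_assoc[of _ m]) auto
  finally have "b * P * G = l \<cdot>\<^sub>m P * G" unfolding DE lP .
  then show "b * shift_prod m b ks = l \<cdot>\<^sub>m shift_prod m b ks"
    unfolding P_def[symmetric] by (rule cancel) (use b P in auto)
  have "P * b * G = P * (b * G)" using b P GH(1,2) by (intro square_mult_assoc[of _ m]) auto
  also have "\<dots> = P * G * ?D" unfolding eig using P GH(1,2)
    by (intro square_mult_assoc[of _ m, symmetric]) auto
  also have "\<dots> = G * (?E * ?D)" unfolding PG using GH(1,2) by (intro square_mult_assoc[of _ m]) auto
  finally have "P * b * G = l \<cdot>\<^sub>m P * G" unfolding DE lP .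
  then show "shift_prod m b ks * b = l \<cdot>\<^sub>m shift_prod m b ks"
    unfolding P_def[symmetric] by (rule cancel) (use b P in auto)
qed

section \<open>Factorizations of a matrix polynomial\<close>

abbreviation eval_mat :: "complex \<Rightarrow> complex poly mat \<Rightarrow> complex mat" where
  "eval_mat t \<equiv> map_mat (\<lambda>p. poly p t)"

text \<open>
  A polynomial over the complex numbers is determined by its values, so identities between matrix
  polynomials can be checked after evaluation, where they concern complex matrices.
\<close>

lemma eval_mat_eqI:
  assumes "A \<in> carrier_mat m m" "B \<in> carrier_mat m m" "\<And>t. eval_mat t A = eval_mat t B"
  shows "A = B"
proof (rule eq_matI)
  fix i j assume ij: "i < dim_row B" "j < dim_col B"
  show "A $$ (i, j) = B $$ (i, j)"
  proof (rule poly_ext)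
    fix t
    have "eval_mat t A $$ (i, j) = eval_mat t B $$ (i, j)" using assms(3) by simp
    then show "poly (A $$ (i, j)) t = poly (B $$ (i, j)) t" using ij assms(1,2) by simp
  qed
qed (use assms in auto)

lemma eval_mat_mult:
  "A \<in> carrier_mat m m \<Longrightarrow> B \<in> carrier_mat m m \<Longrightarrow>
    eval_mat t (A * B) = eval_mat t A * eval_mat t B"
  by (rule semiring_hom.mat_hom_mult[OF poly_hom.semiring_hom_axioms])

lemma eval_mat_one: "eval_mat t (1\<^sub>m m) = 1\<^sub>m m"
  by (rule eq_matI) auto

lemma det_eval_mat: "det (eval_mat t A) = poly (det A) t"
  by (rule comm_ring_hom.hom_det[OF poly_hom.comm_ring_hom_axioms])

lemma eval_mat_char_poly_matrix:
  "b \<in> carrier_mat m m \<Longrightarrow> eval_mat t (char_poly_matrix b) = t \<cdot>\<^sub>m 1\<^sub>m m - b"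
  by (rule eq_matI) (auto simp: char_poly_matrix_def)

lemma minus_scalar_mult_left:
  fixes b X :: "complex mat"
  assumes "b \<in> carrier_mat m m" "X \<in> carrier_mat m m"
  shows "(t \<cdot>\<^sub>m 1\<^sub>m m - b) * X = t \<cdot>\<^sub>m X - b * X"
  using assms mult_smult_assoc_mat[of "1\<^sub>m m" m m X m t]
  by (simp add: minus_mult_distrib_mat[of "t \<cdot>\<^sub>m 1\<^sub>m m" m m b X m])

lemma minus_scalar_mult_right:
  fixes b X :: "complex mat"
  assumes "b \<in> carrier_mat m m" "X \<in> carrier_mat m m"
  shows "X * (t \<cdot>\<^sub>m 1\<^sub>m m - b) = t \<cdot>\<^sub>m X - X * b"
  using assms mult_smult_distrib[of X m m "1\<^sub>m m" m t]
  by (simp add: mult_minus_distrib_mat[of X m m "t \<cdot>\<^sub>m 1\<^sub>m m" m b])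

lemma det_minus_scalar:
  fixes b :: "complex mat"
  assumes b: "b \<in> carrier_mat m m"
  shows "det (t \<cdot>\<^sub>m 1\<^sub>m m - b) = 0 \<longleftrightarrow> eigenvalue b t"
proof -
  have "det (t \<cdot>\<^sub>m 1\<^sub>m m - b) = poly (char_poly b) t"
    unfolding char_poly_def eval_mat_char_poly_matrix[OF b, symmetric]
    by (rule det_eval_mat)
  then show ?thesis using eigenvalue_root_char_poly[OF b] by simp
qed

lemma matrix_polynomial_simps[simp]:
  "matrix_polynomial m [] = 1\<^sub>m m"
  "matrix_polynomial m (x # xs) = char_poly_matrix (fst x) * matrix_polynomial m xs"
  by (simp_all add: matrix_polynomial_def)

lemma spectrum_list_simps[simp]:
  "spectrum_list [] = []"
  "spectrum_list (x # xs) = snd x @ spectrum_list xs"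
  "spectrum_list (xs @ ys) = spectrum_list xs @ spectrum_list ys"
  by (simp_all add: spectrum_list_def)

lemma Ubar_carrier: "x \<in> points (Ubar m) \<Longrightarrow> fst x \<in> carrier_mat m m"
  by (auto simp: Ubar_def)

lemma matrix_polynomial_carrier:
  "set xs \<subseteq> points (Ubar m) \<Longrightarrow> matrix_polynomial m xs \<in> carrier_mat m m"
  by (induction xs) (auto intro!: mult_carrier_mat char_poly_matrix_closed dest: Ubar_carrier)

lemma matrix_polynomial_append:
  "set xs \<subseteq> points (Ubar m) \<Longrightarrow> set ys \<subseteq> points (Ubar m) \<Longrightarrow>
    matrix_polynomial m (xs @ ys) = matrix_polynomial m xs * matrix_polynomial m ys"
proof (induction xs)
  case (Cons x xs)
  have "char_poly_matrix (fst x) * (matrix_polynomial m xs * matrix_polynomial m ys) =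
    char_poly_matrix (fst x) * matrix_polynomial m xs * matrix_polynomial m ys"
    using Cons.prems
    by (intro assoc_mult_mat[of _ m m _ m _ m, symmetric] matrix_polynomial_carrier)
      (auto dest: Ubar_carrier)
  then show ?case using Cons by simp
next
  case Nil
  then show ?case using left_mult_one_mat[OF matrix_polynomial_carrier, of ys m] by simp
qed

lemma det_eval_matrix_polynomial:
  assumes "set xs \<subseteq> points (Ubar m)" "t \<notin> set (spectrum_list xs)"
  shows "det (eval_mat t (matrix_polynomial m xs)) \<noteq> 0"
  using assms
proof (induction xs)
  case Nil
  then show ?case by (simp add: eval_mat_one)
next
  case (Cons x xs)
  have b: "fst x \<in> carrier_mat m m" "set (snd x) = {l. eigenvalue (fst x) l}"
    using Cons.prems points_Ubar[of "fst x" "snd x" m] by auto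
  have M: "matrix_polynomial m xs \<in> carrier_mat m m"
    using Cons.prems by (intro matrix_polynomial_carrier) auto
  have "eval_mat t (matrix_polynomial m (x # xs)) =
    (t \<cdot>\<^sub>m 1\<^sub>m m - fst x) * eval_mat t (matrix_polynomial m xs)"
    using b M by (simp add: eval_mat_mult[of _ m] eval_mat_char_poly_matrix)
  then have "det (eval_mat t (matrix_polynomial m (x # xs))) =
    det (t \<cdot>\<^sub>m 1\<^sub>m m - fst x) * det (eval_mat t (matrix_polynomial m xs))"
    using b M det_mult[of "t \<cdot>\<^sub>m 1\<^sub>m m - fst x" m "eval_mat t (matrix_polynomial m xs)"]
    by (simp add: minus_carrier_mat)
  moreover have "det (t \<cdot>\<^sub>m 1\<^sub>m m - fst x) \<noteq> 0"
    using det_minus_scalar[OF b(1)] b(2) Cons.prems(2) by auto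
  ultimately show ?case using Cons by auto
qed

lemma mat_mult_right_cancel:
  fixes A B Q :: "complex mat"
  assumes "A \<in> carrier_mat m m" "Q \<in> carrier_mat m m" "A * Q = 0\<^sub>m m m" "det Q \<noteq> 0"
  shows "A = 0\<^sub>m m m"
proof -
  obtain R where R: "R \<in> carrier_mat m m" "Q * R = 1\<^sub>m m"
    using det_non_zero_imp_unit[OF assms(2,4), of "()"] unfolding Units_def
      by (auto simp: ring_mat_def)
  have "A = A * (Q * R)" using assms R by simp
  also have "\<dots> = A * Q * R" using assms R by (intro assoc_mult_mat[symmetric]) auto
  finally show ?thesis using assms R by simp
qed

text \<open>
  The rows of the inverse of an eigenbasis are left eigenvectors of \<open>b\<close>. If they are left
  eigenvectors of \<open>c\<close> with the same eigenvalues, then \<open>b\<close> and \<open>c\<close> have the same diagonalization.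
\<close>

lemma eq_if_left_eigenspaces:
  assumes x: "(b, ls) \<in> points (Ubar m)" and c: "c \<in> carrier_mat m m"
    and eig: "\<And>X l. l \<in> set ls \<Longrightarrow> X \<in> carrier_mat m m \<Longrightarrow> X * b = l \<cdot>\<^sub>m X \<Longrightarrow> X * c = l \<cdot>\<^sub>m X"
  shows "c = b"
proof -
  obtain G H where GH: "G \<in> carrier_mat m m" "H \<in> carrier_mat m m" "G * H = 1\<^sub>m m" "H * G = 1\<^sub>m m"
    and bGH: "b = G * mat_diag m ((!) ls) * H"
    using diagonalization[OF x] by blast
  have b: "b \<in> carrier_mat m m" and ls: "length ls = m" using x unfolding points_Ubar by auto
  let ?D = "mat_diag m ((!) ls)"
  have "H * b = H * (G * ?D) * H"
    unfolding bGH using GH(1,2) by (intro square_mult_assoc[of _ m, symmetric]) auto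
  also have "H * (G * ?D) = H * G * ?D"
    using GH(1,2) by (intro square_mult_assoc[of _ m, symmetric]) auto
  finally have Hb: "H * b = ?D * H" unfolding GH(4) using left_mult_one_mat[OF mat_diag_dim]
    by metis
  have "H * c = ?D * H"
  proof (rule eq_matI)
    fix i k assume "i < dim_row (?D * H)" "k < dim_col (?D * H)"
    then have ik: "i < m" "k < m" using GH(2) by (auto simp: mat_diag_def)
    let ?E = "mat_diag m (\<lambda>j. if j = i then 1 else 0 :: complex)"
    have E: "?E \<in> carrier_mat m m" by simp
    have EH: "?E * H \<in> carrier_mat m m" using GH(2) by (intro mult_carrier_mat[OF E])
    have "?E * H * b = ?E * (?D * H)"
      unfolding Hb[symmetric] using GH(2) b by (intro square_mult_assoc[of _ m]) auto
    also have "\<dots> = ?E * ?D * H"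
      using GH(2) by (intro square_mult_assoc[of _ m, symmetric]) auto
    also have "\<dots> = ls ! i \<cdot>\<^sub>m (?E * H)"
      unfolding mat_diag_diag mat_diag_mult_left[OF GH(2)] by (rule eq_matI) auto
    finally have "?E * H * c = ls ! i \<cdot>\<^sub>m (?E * H)"
      using eig[OF _ EH] ik ls by simp
    moreover have "?E * H * c = ?E * (H * c)"
      using GH(2) c by (intro square_mult_assoc[of _ m]) auto
    ultimately have "(?E * (H * c)) $$ (i, k) = (ls ! i \<cdot>\<^sub>m (?E * H)) $$ (i, k)" by simp
    then show "(H * c) $$ (i, k) = (?D * H) $$ (i, k)"
      unfolding mat_diag_mult_left[OF GH(2)] mat_diag_mult_left[OF mult_carrier_mat[OF GH(2) c]]
      using ik by simp
  qed (use GH(2) c in \<open>auto simp: mat_diag_def\<close>)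
  then have "G * (H * c) = G * (?D * H)" by simp
  moreover have "G * (H * c) = c"
    using assoc_mult_mat[OF GH(1,2) c] left_mult_one_mat[OF c] unfolding GH(3) by simp
  moreover have "G * (?D * H) = b"
    unfolding bGH using GH(1,2) by (intro square_mult_assoc[of _ m, symmetric]) auto
  ultimately show ?thesis by simp
qed

lemma char_poly_matrix_left_cancel:
  fixes b :: "complex mat"
  assumes b: "b \<in> carrier_mat m m" and Q: "Q \<in> carrier_mat m m" "R \<in> carrier_mat m m"
    and eq: "char_poly_matrix b * Q = char_poly_matrix b * R"
  shows "Q = R"
proof -
  let ?C = "char_poly_matrix b"
  have C: "?C \<in> carrier_mat m m" using b by simp
  have "char_poly b \<cdot>\<^sub>m Y = adj_mat ?C * (?C * Y)" if "Y \<in> carrier_mat m m" for Y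
  proof -
    have "adj_mat ?C * (?C * Y) = adj_mat ?C * ?C * Y"
      using adj_mat(1)[OF C] C that by (intro assoc_mult_mat[symmetric])
    also have "\<dots> = char_poly b \<cdot>\<^sub>m Y"
      unfolding adj_mat(3)[OF C] char_poly_def using that
      by (simp add: mult_smult_assoc_mat[of _ m m _ m])
    finally show ?thesis by simp
  qed
  then have *: "char_poly b \<cdot>\<^sub>m Q = char_poly b \<cdot>\<^sub>m R" using Q eq by simp
  have nz: "char_poly b \<noteq> 0" using degree_monic_char_poly[OF b] by auto
  show ?thesis
  proof (rule eq_matI)
    fix i j assume ij: "i < dim_row R" "j < dim_col R"
    have "(char_poly b \<cdot>\<^sub>m Q) $$ (i, j) = (char_poly b \<cdot>\<^sub>m R) $$ (i, j)" using * by simp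
    then show "Q $$ (i, j) = R $$ (i, j)" using nz ij Q by simp
  qed (use Q in auto)
qed

text \<open>
  Let \<open>X\<close> be a left eigenvector of the first factor \<open>b\<close> of the first list at \<open>l\<close>. Then \<open>X\<close>
  annihilates the common value at \<open>l\<close> of the matrix polynomials. Since the eigenvalues are
  distinct, the product of the remaining factors of the second list is invertible at \<open>l\<close>, so that
  \<open>X\<close> is also a left eigenvector of its first factor \<open>c\<close>. This gives \<open>c = b\<close>; the common first
  factor is cancelled and one proceeds by induction.
\<close>

lemma factorization_unique:
  assumes "set xs \<subseteq> points (Ubar m)" "set ys \<subseteq> points (Ubar m)" "length xs = length ys"
    and "matrix_polynomial m xs = matrix_polynomial m ys"
    and "spectrum_list xs = spectrum_list ys" "distinct (spectrum_list xs)"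
  shows "xs = ys"
  using assms(3,1,2,4-)
proof (induction xs ys rule: list_induct2)
  case (Cons x xs y ys)
  obtain b ls c ls' where xy: "x = (b, ls)" "y = (c, ls')" by (metis surj_pair)
  have pts: "(b, ls) \<in> points (Ubar m)" "(c, ls') \<in> points (Ubar m)" using Cons.prems xy by auto
  then have len: "length ls = m" "length ls' = m" and b: "b \<in> carrier_mat m m"
    and c: "c \<in> carrier_mat m m" unfolding points_Ubar by auto
  have spec: "ls = ls'" "spectrum_list xs = spectrum_list ys"
    using Cons.prems(4) len unfolding xy by auto
  have M: "matrix_polynomial m xs \<in> carrier_mat m m" "matrix_polynomial m ys \<in> carrier_mat m m"
    using Cons.prems by (auto intro: matrix_polynomial_carrier)
  have eq:
    "char_poly_matrix b * matrix_polynomial m xs = char_poly_matrix c * matrix_polynomial m ys"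
    using Cons.prems xy by simp
  have "c = b"
  proof (rule eq_if_left_eigenspaces[OF pts(1) c])
    fix X l assume l: "l \<in> set ls" and X: "X \<in> carrier_mat m m" "X * b = l \<cdot>\<^sub>m X"
    let ?P = "eval_mat l (matrix_polynomial m xs)" and ?Q = "eval_mat l (matrix_polynomial m ys)"
    have "l \<notin> set (spectrum_list ys)" using l Cons.prems(5) spec xy by auto
    then have det: "det ?Q \<noteq> 0" using det_eval_matrix_polynomial Cons.prems by auto
    have "(l \<cdot>\<^sub>m 1\<^sub>m m - b) * ?P = (l \<cdot>\<^sub>m 1\<^sub>m m - c) * ?Q"
      using arg_cong[OF eq, of "eval_mat l"] b c M
      by (simp add: eval_mat_mult[of _ m] eval_mat_char_poly_matrix)
    then have "X * ((l \<cdot>\<^sub>m 1\<^sub>m m - b) * ?P) = X * ((l \<cdot>\<^sub>m 1\<^sub>m m - c) * ?Q)" by simp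
    moreover have "X * ((l \<cdot>\<^sub>m 1\<^sub>m m - b) * ?P) = X * (l \<cdot>\<^sub>m 1\<^sub>m m - b) * ?P"
      "X * ((l \<cdot>\<^sub>m 1\<^sub>m m - c) * ?Q) = X * (l \<cdot>\<^sub>m 1\<^sub>m m - c) * ?Q"
      using X b c M by (intro square_mult_assoc[of _ m, symmetric]; simp add: minus_carrier_mat)+
    moreover have "X * (l \<cdot>\<^sub>m 1\<^sub>m m - b) = 0\<^sub>m m m"
      using minus_scalar_mult_right[OF b X(1)] X by simp
    moreover have "0\<^sub>m m m * ?P = 0\<^sub>m m m" using M by simp
    ultimately have XQ: "X * (l \<cdot>\<^sub>m 1\<^sub>m m - c) * ?Q = 0\<^sub>m m m" by metis
    have "X * (l \<cdot>\<^sub>m 1\<^sub>m m - c) = 0\<^sub>m m m"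
      by (rule mat_mult_right_cancel[of _ m ?Q])
        (use XQ X(1) c M det in \<open>auto intro!: mult_carrier_mat minus_carrier_mat\<close>)
    then have 0: "l \<cdot>\<^sub>m X - X * c = 0\<^sub>m m m" using minus_scalar_mult_right[OF c X(1)] by simp
    show "X * c = l \<cdot>\<^sub>m X"
    proof (rule eq_matI)
      fix i j assume "i < dim_row (l \<cdot>\<^sub>m X)" "j < dim_col (l \<cdot>\<^sub>m X)"
      then have ij: "i < m" "j < m" using X by auto
      have "(l \<cdot>\<^sub>m X - X * c) $$ (i, j) = 0" using 0 ij by simp
      then show "(X * c) $$ (i, j) = (l \<cdot>\<^sub>m X) $$ (i, j)" using ij X(1) c by simp
    qed (use X c in auto)
  qed
  then have "matrix_polynomial m xs = matrix_polynomial m ys"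
    using char_poly_matrix_left_cancel[OF b M] eq by simp
  then have "xs = ys" using Cons spec by auto
  then show ?case using \<open>c = b\<close> spec xy by simp
qed simp

section \<open>Exchanging one eigenvalue between two linear factors\<close>

text \<open>
  The idempotent \<open>p\<close> plays the role of \<open>u w / (w u)\<close> for a right eigenvector \<open>u\<close> of \<open>b1\<close> at \<open>l\<close> and
  a left eigenvector \<open>w\<close> of \<open>b2\<close> at \<open>k\<close>. The eigenvalues \<open>l\<close> and \<open>k\<close> change places, whereas left
  eigenvectors of \<open>b1\<close> and right eigenvectors of \<open>b2\<close> at other eigenvalues are annihilated by \<open>p\<close>
  and therefore persist.
\<close>

lemma exchange_identities:
  fixes b1 b2 p :: "complex mat"
  assumes C: "b1 \<in> carrier_mat m m" "b2 \<in> carrier_mat m m" "p \<in> carrier_mat m m"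
    and p: "b1 * p = l \<cdot>\<^sub>m p" "p * b2 = k \<cdot>\<^sub>m p" "p * p = p"
  defines "c1 \<equiv> b1 + (k - l) \<cdot>\<^sub>m p" and "c2 \<equiv> b2 - (k - l) \<cdot>\<^sub>m p"
  shows "c1 * p = k \<cdot>\<^sub>m p" and "p * c2 = l \<cdot>\<^sub>m p"
    and "X \<in> carrier_mat m m \<Longrightarrow> X * b1 = s \<cdot>\<^sub>m X \<Longrightarrow> s \<noteq> l \<Longrightarrow> X * c1 = s \<cdot>\<^sub>m X"
    and "X \<in> carrier_mat m m \<Longrightarrow> b2 * X = s \<cdot>\<^sub>m X \<Longrightarrow> s \<noteq> k \<Longrightarrow> c2 * X = s \<cdot>\<^sub>m X"
    and "char_poly_matrix b1 * char_poly_matrix b2 = char_poly_matrix c1 * char_poly_matrix c2"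
proof -
  have c: "c1 \<in> carrier_mat m m" "c2 \<in> carrier_mat m m"
    unfolding c1_def c2_def using C by (auto intro!: minus_carrier_mat)
  have kp: "(k - l) \<cdot>\<^sub>m p \<in> carrier_mat m m" using C by simp
  have "c1 * p = b1 * p + (k - l) \<cdot>\<^sub>m (p * p)"
    unfolding c1_def add_mult_distrib_mat[OF C(1) kp C(3)] mult_smult_assoc_mat[OF C(3,3)] ..
  then show c1p: "c1 * p = k \<cdot>\<^sub>m p"
    unfolding p using C(3) by (auto intro!: eq_matI simp: algebra_simps)
  have "p * c2 = p * b2 - (k - l) \<cdot>\<^sub>m (p * p)"
    unfolding c2_def mult_minus_distrib_mat[OF C(3,2) kp] mult_smult_distrib[OF C(3,3)] ..
  then show pc2: "p * c2 = l \<cdot>\<^sub>m p"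
    unfolding p using C(3) by (auto intro!: eq_matI simp: algebra_simps)
  have zero: "Y = 0\<^sub>m m m" if Y: "Y \<in> carrier_mat m m" "s \<cdot>\<^sub>m Y = r \<cdot>\<^sub>m Y" "s \<noteq> r" for Y ::
    "complex mat" and s r
  proof (rule ccontr)
    assume "Y \<noteq> 0\<^sub>m m m"
    then obtain i j where ij: "i < m" "j < m" "Y $$ (i, j) \<noteq> 0" using nonzero_mat_index[OF Y(1)]
      by blast
    have "(s \<cdot>\<^sub>m Y) $$ (i, j) = (r \<cdot>\<^sub>m Y) $$ (i, j)" using Y(2) by simp
    then have "s * Y $$ (i, j) = r * Y $$ (i, j)" using Y(1) ij by simp
    then show False using Y(3) ij by simp
  qed
  show "X * c1 = s \<cdot>\<^sub>m X" if X: "X \<in> carrier_mat m m" "X * b1 = s \<cdot>\<^sub>m X" "s \<noteq> l"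
  proof -
    have "s \<cdot>\<^sub>m (X * p) = X * b1 * p" unfolding X(2) mult_smult_assoc_mat[OF X(1) C(3)] ..
    also have "\<dots> = X * (b1 * p)" using X C by (intro assoc_mult_mat)
    also have "\<dots> = l \<cdot>\<^sub>m (X * p)" unfolding p(1) mult_smult_distrib[OF X(1) C(3)] ..
    finally have "X * p = 0\<^sub>m m m" using X C by (intro zero[of _ s l]) auto
    moreover have "X * c1 = X * b1 + (k - l) \<cdot>\<^sub>m (X * p)"
      unfolding c1_def mult_add_distrib_mat[OF X(1) C(1) kp] mult_smult_distrib[OF X(1) C(3)] ..
    ultimately show ?thesis unfolding X(2) using X(1) by simp
  qed
  show "c2 * X = s \<cdot>\<^sub>m X" if X: "X \<in> carrier_mat m m" "b2 * X = s \<cdot>\<^sub>m X" "s \<noteq> k"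
  proof -
    have "s \<cdot>\<^sub>m (p * X) = p * (b2 * X)" unfolding X(2) mult_smult_distrib[OF C(3) X(1)] ..
    also have "\<dots> = p * b2 * X" using X C by (intro assoc_mult_mat[symmetric])
    also have "\<dots> = k \<cdot>\<^sub>m (p * X)" unfolding p(2) mult_smult_assoc_mat[OF C(3) X(1)] ..
    finally have "p * X = 0\<^sub>m m m" using X C by (intro zero[of _ s k]) auto
    moreover have "c2 * X = b2 * X - (k - l) \<cdot>\<^sub>m (p * X)"
      unfolding c2_def minus_mult_distrib_mat[OF C(2) kp X(1)] mult_smult_assoc_mat[OF C(3) X(1)] ..
    ultimately show ?thesis unfolding X(2) using X(1) by (auto intro!: eq_matI)
  qed
  show "char_poly_matrix b1 * char_poly_matrix b2 = char_poly_matrix c1 * char_poly_matrix c2"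
  proof (rule eval_mat_eqI[of _ m])
    fix t :: complex
    let ?T = "\<lambda>b :: complex mat. t \<cdot>\<^sub>m 1\<^sub>m m - b"
    have T: "?T b \<in> carrier_mat m m" if "b \<in> carrier_mat m m" for b
      using that by (intro minus_carrier_mat) auto
    have "?T c1 = ?T b1 - (k - l) \<cdot>\<^sub>m p"
      unfolding c1_def using C by (intro eq_matI) auto
    then have 1: "?T c1 * ?T c2 = ?T b1 * ?T c2 - (k - l) \<cdot>\<^sub>m (p * ?T c2)"
      using minus_mult_distrib_mat[OF T[OF C(1)] kp T[OF c(2)]]
        mult_smult_assoc_mat[OF C(3) T[OF c(2)], of "k - l"] by simp
    have 2: "p * ?T c2 = t \<cdot>\<^sub>m p - l \<cdot>\<^sub>m p"
      using minus_scalar_mult_right[OF c(2) C(3)] pc2 by simp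
    have 3: "?T c2 = ?T b2 + (k - l) \<cdot>\<^sub>m p"
      unfolding c2_def using C by (intro eq_matI) auto
    have 4: "?T b1 * ?T c2 = ?T b1 * ?T b2 + (k - l) \<cdot>\<^sub>m (?T b1 * p)"
      unfolding 3 using mult_add_distrib_mat[OF T[OF C(1)] T[OF C(2)] kp]
        mult_smult_distrib[OF T[OF C(1)] C(3), of "k - l"] by simp
    have 5: "?T b1 * p = t \<cdot>\<^sub>m p - l \<cdot>\<^sub>m p"
      using minus_scalar_mult_left[OF C(1) C(3)] p(1) by simp
    have cancel: "A + Z - Z = A" if "A \<in> carrier_mat m m" "Z \<in> carrier_mat m m"
      for A Z :: "complex mat"
      using that by (intro eq_matI) auto
    have "?T c1 * ?T c2 = ?T b1 * ?T b2"
      unfolding 1 2 4 5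
      by (rule cancel)
        (use T[OF C(1)] T[OF C(2)] C(3) in \<open>auto intro!: mult_carrier_mat minus_carrier_mat\<close>)
    then show "eval_mat t (char_poly_matrix b1 * char_poly_matrix b2) =
      eval_mat t (char_poly_matrix c1 * char_poly_matrix c2)"
      using C c by (simp add: eval_mat_mult[of _ m] eval_mat_char_poly_matrix)
  qed (intro mult_carrier_mat[of _ m m] char_poly_matrix_closed C c)+
qed

section \<open>Irreducibility of the powers of the variety\<close>

definition rational_off :: "complex set \<Rightarrow> (complex \<Rightarrow> complex) \<Rightarrow> bool" where
  "rational_off F h \<longleftrightarrow> (\<exists>p q. \<forall>z. z \<notin> F \<longrightarrow> poly q z \<noteq> 0 \<and> h z = poly p z / poly q z)"

definition rational_curve :: "'a variety \<Rightarrow> complex set \<Rightarrow> (complex \<Rightarrow> 'a) \<Rightarrow> bool" where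
  "rational_curve X F \<gamma> \<longleftrightarrow> finite F \<and> (\<forall>z. z \<notin> F \<longrightarrow> \<gamma> z \<in> points X) \<and>
    (\<forall>c\<in>coords X. rational_off F (\<lambda>z. c (\<gamma> z)))"

definition rationally_connected :: "'a variety \<Rightarrow> bool" where
  "rationally_connected X \<longleftrightarrow> points X \<noteq> {} \<and>
    (\<forall>x\<in>points X. \<forall>y\<in>points X. \<exists>F \<gamma>. rational_curve X F \<gamma> \<and>
      0 \<notin> F \<and> 1 \<notin> F \<and> \<gamma> 0 = x \<and> \<gamma> 1 = y)"

lemma rationally_connectedE:
  assumes "rationally_connected X" "x \<in> points X" "y \<in> points X"
  obtains F \<gamma> where "rational_curve X F \<gamma>" "0 \<notin> F" "1 \<notin> F" "\<gamma> 0 = x" "\<gamma> 1 = y"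
proof -
  have "\<forall>x\<in>points X. \<forall>y\<in>points X. \<exists>F \<gamma>. rational_curve X F \<gamma> \<and>
      0 \<notin> F \<and> 1 \<notin> F \<and> \<gamma> 0 = x \<and> \<gamma> 1 = y"
    using assms(1) unfolding rationally_connected_def by (rule conjunct2)
  from bspec[OF bspec[OF this assms(2)] assms(3)] show thesis
    by (elim exE conjE) (rule that)
qed

lemma rational_offI:
  "(\<And>z. z \<notin> F \<Longrightarrow> poly q z \<noteq> 0 \<and> h z = poly p z / poly q z) \<Longrightarrow> rational_off F h"
  unfolding rational_off_def by blast

lemma rational_off_polynomial_functions:
  assumes curve: "rational_curve X F \<gamma>" and f: "f \<in> poly_funs X"
  shows "rational_off F (\<lambda>z. f (\<gamma> z))"
  using f
proof induction
  case (const c)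
  show ?case by (rule rational_offI[of _ 1 _ "[:c:]"]) simp
next
  case (coord f)
  then show ?case using curve unfolding rational_curve_def by blast
next
  case (add f g)
  then obtain p q r s where "\<forall>z. z \<notin> F \<longrightarrow> poly q z \<noteq> 0 \<and> f (\<gamma> z) = poly p z / poly q z"
    "\<forall>z. z \<notin> F \<longrightarrow> poly s z \<noteq> 0 \<and> g (\<gamma> z) = poly r z / poly s z"
    unfolding rational_off_def by blast
  then show ?case by (intro rational_offI[of _ "q * s" _ "p * s + r * q"]) (auto simp: add_frac_eq)
next
  case (mult f g)
  then obtain p q r s where "\<forall>z. z \<notin> F \<longrightarrow> poly q z \<noteq> 0 \<and> f (\<gamma> z) = poly p z / poly q z"
    "\<forall>z. z \<notin> F \<longrightarrow> poly s z \<noteq> 0 \<and> g (\<gamma> z) = poly r z / poly s z"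
    unfolding rational_off_def by blast
  then show ?case by (intro rational_offI[of _ "q * s" _ "p * r"]) auto
qed

lemma rational_off_finite_zeros:
  assumes h: "rational_off F h" and z: "z \<notin> F" "h z \<noteq> 0"
  shows "finite {w. w \<notin> F \<and> h w = 0}"
proof -
  obtain p q where pq: "\<And>z. z \<notin> F \<Longrightarrow> poly q z \<noteq> 0 \<and> h z = poly p z / poly q z"
    using h unfolding rational_off_def by blast
  then have "p \<noteq> 0" using z by auto
  then have "finite {w. poly p w = 0}" by (rule poly_roots_finite)
  then show ?thesis by (rule rev_finite_subset) (use pq in auto)
qed

text \<open>
  Let the curve join a point of \<open>V\<close> to a point of \<open>W\<close>. On it, polynomials witnessing that these
  points lie in \<open>V\<close> and in \<open>W\<close> become nonzero rational functions of the parameter, which have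
  finitely many zeros; at any other parameter the curve lies in both sets.
\<close>

lemma irreducible_if_rationally_connected:
  assumes X: "rationally_connected X"
  shows "irreducible_variety X"
  unfolding irreducible_variety_def
proof (intro conjI allI impI)
  show "points X \<noteq> {}" using X unfolding rationally_connected_def by blast
  fix V W assume VW: "zariski_open X V \<and> V \<noteq> {} \<and> zariski_open X W \<and> W \<noteq> {}"
  then obtain x y where xy: "x \<in> V" "y \<in> W" by blast
  obtain f where f: "f \<in> poly_funs X" "f x \<noteq> 0"
    "\<And>y. y \<in> points X \<Longrightarrow> f y \<noteq> 0 \<Longrightarrow> y \<in> V"
    using zariski_openD[of X V x] VW xy by metis
  obtain g where g: "g \<in> poly_funs X" "g y \<noteq> 0"
    "\<And>y. y \<in> points X \<Longrightarrow> g y \<noteq> 0 \<Longrightarrow> y \<in> W"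
    using zariski_openD[of X W y] VW xy by metis
  have "x \<in> points X" "y \<in> points X" using VW xy zariski_open_subset by blast+
  then obtain F \<gamma> where curve: "rational_curve X F \<gamma>" and ends: "0 \<notin> F" "1 \<notin> F" "\<gamma> 0 = x" "\<gamma> 1 = y"
    using rationally_connectedE[OF X \<open>x \<in> points X\<close> \<open>y \<in> points X\<close>] by metis
  have "finite (F \<union> {z. z \<notin> F \<and> f (\<gamma> z) = 0} \<union> {z. z \<notin> F \<and> g (\<gamma> z) = 0})"
    using curve rational_off_finite_zeros[OF rational_off_polynomial_functions[OF curve f(1)] ends(1)]
      rational_off_finite_zeros[OF rational_off_polynomial_functions[OF curve g(1)] ends(2)]
      ends f(2) g(2) unfolding rational_curve_def by simp
  from ex_new_if_finite[OF infinite_UNIV_char_0 this]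
  obtain z where z: "z \<notin> F" "f (\<gamma> z) \<noteq> 0" "g (\<gamma> z) \<noteq> 0" by auto
  have "\<gamma> z \<in> points X" using curve z unfolding rational_curve_def by blast
  then have "\<gamma> z \<in> V \<inter> W" using f(3) g(3) z by auto
  then show "V \<inter> W \<noteq> {}" by blast
qed

lemma rationally_connected_power:
  assumes X: "rationally_connected X"
  shows "rationally_connected (power_variety X n)"
  unfolding rationally_connected_def
proof (intro conjI ballI)
  obtain x where "x \<in> points X" using X unfolding rationally_connected_def by blast
  then have "replicate n x \<in> points (power_variety X n)" unfolding points_power_variety by auto
  then show "points (power_variety X n) \<noteq> {}" by blast
  fix xs ys assume xs: "xs \<in> points (power_variety X n)" and ys: "ys \<in> points (power_variety X n)"
  then have len: "length xs = n" "length ys = n" unfolding points_power_variety by auto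
  have "\<exists>F \<gamma>. rational_curve X F \<gamma> \<and> 0 \<notin> F \<and> 1 \<notin> F \<and> \<gamma> 0 = xs ! k \<and> \<gamma> 1 = ys ! k" if "k < n" for k
  proof -
    have "xs ! k \<in> points X" "ys ! k \<in> points X"
      using that xs ys unfolding points_power_variety by (auto simp: subset_iff)
    from rationally_connectedE[OF X this] show ?thesis by metis
  qed
  then obtain F \<gamma> where c: "\<And>k. k < n \<Longrightarrow> rational_curve X (F k) (\<gamma> k) \<and>
    0 \<notin> F k \<and> 1 \<notin> F k \<and> \<gamma> k 0 = xs ! k \<and> \<gamma> k 1 = ys ! k" by metis
  let ?F = "\<Union>k<n. F k" and ?g = "\<lambda>z. map (\<lambda>k. \<gamma> k z) [0..<n]"
  have "rational_curve (power_variety X n) ?F ?g"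
    unfolding rational_curve_def
  proof (intro conjI allI impI ballI)
    show "finite ?F" using c unfolding rational_curve_def by blast
    show "?g z \<in> points (power_variety X n)" if "z \<notin> ?F" for z
      using that c unfolding points_power_variety rational_curve_def by auto
    fix d assume "d \<in> coords (power_variety X n)"
    then obtain e k where e: "e \<in> coords X" "k < n" and d: "d = (\<lambda>xs. e (xs ! k))"
      unfolding coords_power_variety by blast
    have "rational_off (F k) (\<lambda>z. e (\<gamma> k z))" using c[OF e(2)] e(1) unfolding rational_curve_def
      by blast
    then have "rational_off ?F (\<lambda>z. e (\<gamma> k z))" using e(2) unfolding rational_off_def by blast
    then show "rational_off ?F (\<lambda>z. d (?g z))" unfolding d using e(2) by simp
  qed
  moreover have "?g 0 = xs" "?g 1 = ys" using c len by (auto intro!: nth_equalityI)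
  moreover have "0 \<notin> ?F" "1 \<notin> ?F" using c by auto
  ultimately show
    "\<exists>F g. rational_curve (power_variety X n) F g \<and> 0 \<notin> F \<and> 1 \<notin> F \<and> g 0 = xs \<and> g 1 = ys"
    by blast
qed

text \<open>
  Points are written as \<open>A D A\<inverse>\<close> with \<open>D\<close> the diagonal matrix of the listed eigenvalues. The
  curve moves the entries of \<open>A\<close> and of \<open>D\<close> along line segments; it is defined unless \<open>A\<close> becomes
  singular or two eigenvalues collide, which happens at finitely many parameters only.
\<close>

lemma rationally_connected_Ubar: "rationally_connected (Ubar m)"
  unfolding rationally_connected_def
proof (intro conjI ballI)
  have "(mat_diag m of_nat, map of_nat [0..<m]) \<in> points (Ubar m)"
  proof (rule points_Ubar_if_eigenbasis[of _ m "1\<^sub>m m" "1\<^sub>m m"])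
    show "mat_diag m of_nat * 1\<^sub>m m = 1\<^sub>m m * mat_diag m (\<lambda>i. map of_nat [0..<m] ! i :: complex)"
      by (auto intro!: eq_matI simp: mat_diag_def)
  qed (auto simp: distinct_map)
  then show "points (Ubar m) \<noteq> {}" by blast
  fix x y assume x: "x \<in> points (Ubar m)" and y: "y \<in> points (Ubar m)"
  obtain b ls c ks where xy: "x = (b, ls)" "y = (c, ks)" by (metis surj_pair)
  have ls: "length ls = m" "distinct ls" and ks: "length ks = m" "distinct ks"
    using x y unfolding xy points_Ubar by auto
  obtain A A' where A: "A \<in> carrier_mat m m" "A' \<in> carrier_mat m m" "A * A' = 1\<^sub>m m"
    "A' * A = 1\<^sub>m m"
    "b = A * mat_diag m ((!) ls) * A'"
    using diagonalization x unfolding xy by metis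
  obtain B B' where B: "B \<in> carrier_mat m m" "B' \<in> carrier_mat m m" "B * B' = 1\<^sub>m m"
    "B' * B = 1\<^sub>m m"
    "c = B * mat_diag m ((!) ks) * B'"
    using diagonalization y unfolding xy by metis
  define G where "G = mat m m (\<lambda>(i, j). [:A $$ (i, j), B $$ (i, j) - A $$ (i, j):])"
  define \<mu> where "\<mu> = (\<lambda>i. [:ls ! i, ks ! i - ls ! i:])"
  \<comment> \<open>The adjugate replaces the inverse, so that the entries stay polynomial in the parameter.\<close>
  define M where "M = G * mat_diag m \<mu> * adj_mat G"
  have G: "G \<in> carrier_mat m m" unfolding G_def by simp
  have M: "M \<in> carrier_mat m m" unfolding M_def using G adj_mat(1)[OF G] by auto
  have G01: "eval_mat 0 G = A" "eval_mat 1 G = B"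
    using A B by (auto intro!: eq_matI simp: G_def)
  have \<mu>01: "poly (\<mu> i) 0 = ls ! i" "poly (\<mu> i) 1 = ks ! i" for i
    by (simp_all add: \<mu>_def)
  define F where "F = {z. poly (det G) z = 0} \<union>
    (\<Union>(i, j)\<in>{(i, j). i < m \<and> j < m \<and> i \<noteq> j}. {z. poly (\<mu> i - \<mu> j) z = 0})"
  define \<beta> where "\<beta> z = (1 / poly (det G) z) \<cdot>\<^sub>m eval_mat z M" for z
  define H where "H z = (1 / poly (det G) z) \<cdot>\<^sub>m eval_mat z (adj_mat G)" for z
  define \<gamma> where "\<gamma> z = (\<beta> z, map (\<lambda>i. poly (\<mu> i) z) [0..<m])" for z
  have H: "H z \<in> carrier_mat m m" for z unfolding H_def using adj_mat(1)[OF G] by simp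
  have \<beta>: "\<beta> z \<in> carrier_mat m m" for z unfolding \<beta>_def using M by simp
  have eG: "eval_mat z G \<in> carrier_mat m m" for z using G by simp
  have det_inv: "det Y \<noteq> 0" if "Y \<in> carrier_mat m m" "Z \<in> carrier_mat m m" "Y * Z = 1\<^sub>m m"
    for Y Z :: "complex mat"
    using det_mult[OF that(1,2)] that(3) by auto
  have notF: "0 \<notin> F" "1 \<notin> F"
    using det_eval_mat[of 0 G] det_eval_mat[of 1 G] G01 det_inv[OF A(1-3)] det_inv[OF B(1-3)] ls ks
    unfolding F_def by (auto simp: \<mu>01 nth_eq_iff_index_eq)
  have "finite F"
  proof -
    have "det G \<noteq> 0" using notF unfolding F_def by auto
    moreover have "finite {z. poly (\<mu> i - \<mu> j) z = 0}" if "i < m" "j < m" "i \<noteq> j" for i j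
    proof (rule poly_roots_finite, rule)
      assume "\<mu> i - \<mu> j = 0"
      then have "poly (\<mu> i - \<mu> j) 0 = 0" by simp
      then show False using that ls by (simp add: \<mu>01 nth_eq_iff_index_eq)
    qed
    moreover have "finite {(i, j). i < m \<and> j < m \<and> i \<noteq> j}"
      by (rule finite_subset[of _ "{..<m} \<times> {..<m}"]) auto
    ultimately show ?thesis unfolding F_def
      by (intro finite_UnI finite_UN_I) (auto simp del: poly_diff intro: poly_roots_finite)
  qed
  have HG: "H z * eval_mat z G = 1\<^sub>m m" "eval_mat z G * H z = 1\<^sub>m m" if z: "z \<notin> F" for z
  proof -
    have d: "poly (det G) z \<noteq> 0" using z unfolding F_def by auto
    have "eval_mat z (adj_mat G) * eval_mat z G = eval_mat z (det G \<cdot>\<^sub>m 1\<^sub>m m)"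
      using eval_mat_mult[OF adj_mat(1)[OF G] G] adj_mat(3)[OF G] by simp
    also have "\<dots> = poly (det G) z \<cdot>\<^sub>m 1\<^sub>m m" by (rule eq_matI) auto
    finally have "H z * eval_mat z G = (1 / poly (det G) z) \<cdot>\<^sub>m (poly (det G) z \<cdot>\<^sub>m 1\<^sub>m m)"
      unfolding H_def using adj_mat(1)[OF G] G by (subst mult_smult_assoc_mat[of _ m m _ m]) auto
    then show 1: "H z * eval_mat z G = 1\<^sub>m m" using d by (simp add: smult_smult_mat)
        (auto intro!: eq_matI)
    show "eval_mat z G * H z = 1\<^sub>m m" by (rule mat_mult_left_right_inverse[OF H eG 1])
  qed
  have \<beta>_eq: "\<beta> z = eval_mat z G * mat_diag m (\<lambda>i. poly (\<mu> i) z) * H z" for z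
  proof -
    have D: "eval_mat z (mat_diag m \<mu>) = mat_diag m (\<lambda>i. poly (\<mu> i) z)"
      by (rule eq_matI) (auto simp: mat_diag_def)
    have "eval_mat z M = eval_mat z G * mat_diag m (\<lambda>i. poly (\<mu> i) z) * eval_mat z (adj_mat G)"
      unfolding M_def D[symmetric] using G adj_mat(1)[OF G]
      by (subst eval_mat_mult[of _ m], auto intro!: mult_carrier_mat, subst eval_mat_mult[of _ m]) auto
    then show ?thesis unfolding \<beta>_def H_def using G adj_mat(1)[OF G]
      by (subst mult_smult_distrib[of _ m m _ m]) (auto intro!: mult_carrier_mat)
  qed
  have \<beta>G: "\<beta> z * eval_mat z G = eval_mat z G * mat_diag m (\<lambda>i. poly (\<mu> i) z)" if z: "z \<notin> F" for z
  proof -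
    have GD: "eval_mat z G * mat_diag m (\<lambda>i. poly (\<mu> i) z) \<in> carrier_mat m m"
      by (rule mult_carrier_mat[OF eG mat_diag_dim])
    show ?thesis
      unfolding \<beta>_eq assoc_mult_mat[OF GD H eG] HG(1)[OF z] by (rule right_mult_one_mat[OF GD])
  qed
  have "rational_curve (Ubar m) F \<gamma>"
    unfolding rational_curve_def
  proof (intro conjI allI impI ballI)
    show "finite F" by fact
    show "\<gamma> z \<in> points (Ubar m)" if z: "z \<notin> F" for z
      unfolding \<gamma>_def
    proof (rule points_Ubar_if_eigenbasis[OF \<beta> eG H HG(1)[OF z]])
      have "mat_diag m (\<lambda>i. map (\<lambda>i. poly (\<mu> i) z) [0..<m] ! i) = mat_diag m (\<lambda>i. poly (\<mu> i) z)"
        by (auto intro!: eq_matI simp: mat_diag_def)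
      then show "\<beta> z * eval_mat z G =
        eval_mat z G * mat_diag m (\<lambda>i. map (\<lambda>i. poly (\<mu> i) z) [0..<m] ! i)"
        using \<beta>G[OF z] by simp
      show "distinct (map (\<lambda>i. poly (\<mu> i) z) [0..<m])"
        using z unfolding F_def by (auto simp: distinct_map inj_on_def) metis
    qed simp
    fix d assume "d \<in> coords (Ubar m)"
    then consider i j where "i < m" "j < m" "d = (\<lambda>x. fst x $$ (i, j))"
      | i where "i < m" "d = (\<lambda>x. snd x ! i)"
      unfolding Ubar_def by auto
    then show "rational_off F (\<lambda>z. d (\<gamma> z))"
    proof cases
      case 1
      show ?thesis
        by (rule rational_offI[of _ "det G" _ "M $$ (i, j)"])
          (use 1 M in \<open>auto simp: F_def \<gamma>_def \<beta>_def\<close>)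
    next
      case 2
      show ?thesis
        by (rule rational_offI[of _ 1 _ "\<mu> i"]) (use 2 in \<open>auto simp: \<gamma>_def\<close>)
    qed
  qed
  moreover have "\<gamma> 0 = x" "\<gamma> 1 = y"
  proof -
    have inv: "Z = Z'" if "Y \<in> carrier_mat m m" "Z \<in> carrier_mat m m" "Z' \<in> carrier_mat m m"
      "Z * Y = 1\<^sub>m m" "Y * Z' = 1\<^sub>m m" for Y Z Z' :: "complex mat"
    proof -
      have "Z * Y * Z' = Z * (Y * Z')" using that by (intro assoc_mult_mat)
      then show ?thesis unfolding that(4,5) using that(2,3) by simp
    qed
    have "H 0 = A'" using inv[OF A(1) H A(2) _ A(3)] HG(1)[OF notF(1)] G01 by simp
    then have "\<beta> 0 = b" unfolding \<beta>_eq A(5) G01 \<mu>01 by simp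
    then show "\<gamma> 0 = x" unfolding \<gamma>_def xy using ls by (auto simp: \<mu>01 intro!: nth_equalityI)
    have "H 1 = B'" using inv[OF B(1) H B(2) _ B(3)] HG(1)[OF notF(2)] G01 by simp
    then have "\<beta> 1 = c" unfolding \<beta>_eq B(5) G01 \<mu>01 by simp
    then show "\<gamma> 1 = y" unfolding \<gamma>_def xy using ks by (auto simp: \<mu>01 intro!: nth_equalityI)
  qed
  ultimately show "\<exists>F g. rational_curve (Ubar m) F g \<and> 0 \<notin> F \<and> 1 \<notin> F \<and> g 0 = x \<and> g 1 = y"
    using notF by blast
qed

abbreviation (input) Ubar_power :: "nat \<Rightarrow> nat \<Rightarrow> (complex mat \<times> complex list) list variety" where
  "Ubar_power m n \<equiv> power_variety (Ubar m) n"

lemma irreducible_power_Ubar: "irreducible_variety (Ubar_power m n)"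
  by (intro irreducible_if_rationally_connected rationally_connected_power rationally_connected_Ubar)

lemma points_Ubar_nonempty: "points (Ubar m) \<noteq> {}"
  using rationally_connected_Ubar unfolding rationally_connected_def by blast

section \<open>Permutations of positions\<close>

abbreviation (input) adjacent_swap :: "nat \<Rightarrow> nat \<Rightarrow> nat" where
  "adjacent_swap i \<equiv> Transposition.transpose i (i + 1)"

lemma length_permute_positions[simp]: "length (permute_positions \<sigma> xs) = length xs"
  by (simp add: permute_positions_def del: upt_Suc)

lemma nth_permute_positions:
  "i < length xs \<Longrightarrow> permute_positions \<sigma> xs ! i = xs ! (inv_into UNIV \<sigma> (Suc i) - 1)"
  by (simp add: permute_positions_def del: upt_Suc)

lemma permute_positions_index:
  assumes "\<sigma> permutes {1..n}" "i < n"
  shows "inv_into UNIV \<sigma> (Suc i) - 1 < n"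
    "Suc (inv_into UNIV \<sigma> (Suc i) - 1) = inv_into UNIV \<sigma> (Suc i)"
proof -
  have "inv_into UNIV \<sigma> (Suc i) \<in> {1..n}"
    using permutes_in_image[OF permutes_inv[OF assms(1)]] assms(2) by simp
  then show "inv_into UNIV \<sigma> (Suc i) - 1 < n"
    "Suc (inv_into UNIV \<sigma> (Suc i) - 1) = inv_into UNIV \<sigma> (Suc i)" by auto
qed

lemma permute_positions_id[simp]: "permute_positions id xs = xs"
  by (rule nth_equalityI) (simp_all add: nth_permute_positions)

lemma permute_positions_comp:
  assumes "\<sigma> permutes {1..n}" "\<tau> permutes {1..n}" "length xs = n"
  shows "permute_positions (\<sigma> \<circ> \<tau>) xs = permute_positions \<sigma> (permute_positions \<tau> xs)"
proof (rule nth_equalityI)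
  fix i assume "i < length (permute_positions (\<sigma> \<circ> \<tau>) xs)"
  then have i: "i < n" using assms by simp
  have "inv_into UNIV (\<sigma> \<circ> \<tau>) = inv_into UNIV \<tau> \<circ> inv_into UNIV \<sigma>"
    using permutes_bij[OF assms(1)] permutes_bij[OF assms(2)] by (rule o_inv_distrib)
  then show "permute_positions (\<sigma> \<circ> \<tau>) xs ! i = permute_positions \<sigma> (permute_positions \<tau> xs) ! i"
    using i permute_positions_index[OF assms(1) i] assms(3) by (simp add: nth_permute_positions)
qed simp

lemma distinct_permute_positions:
  assumes "\<sigma> permutes {1..length xs}" "distinct xs"
  shows "distinct (permute_positions \<sigma> xs)"
  unfolding distinct_conv_nth
proof (intro allI impI)
  fix i j assume ij: "i < length (permute_positions \<sigma> xs)" "j < length (permute_positions \<sigma> xs)"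
    "i \<noteq> j"
  then have "i < length xs" "j < length xs" by simp_all
  note idx = permute_positions_index[OF assms(1) this(1)] permute_positions_index[OF assms(1) this(2)]
  have "inv_into UNIV \<sigma> (Suc i) \<noteq> inv_into UNIV \<sigma> (Suc j)"
    using ij(3) inj_eq[OF bij_is_inj[OF permutes_bij[OF permutes_inv[OF assms(1)]]]] by simp
  then have "inv_into UNIV \<sigma> (Suc i) - 1 \<noteq> inv_into UNIV \<sigma> (Suc j) - 1" using idx by metis
  then show "permute_positions \<sigma> xs ! i \<noteq> permute_positions \<sigma> xs ! j"
    using assms(2) idx ij by (simp add: nth_permute_positions nth_eq_iff_index_eq)
qed

text \<open>
  The position \<open>j\<close> counted from \<open>1\<close> is the list index \<open>j - 1\<close>.
\<close>

lemma permute_positions_transpose: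
  assumes "0 < j" "j < length xs"
  shows "permute_positions (adjacent_swap j) xs = xs[j - 1 := xs ! j, j := xs ! (j - 1)]"
proof (rule nth_equalityI)
  fix i assume "i < length (permute_positions (adjacent_swap j) xs)"
  then have i: "i < length xs" by simp
  have "permute_positions (adjacent_swap j) xs ! i =
    xs ! (adjacent_swap j (Suc i) - 1)"
    using i by (simp add: nth_permute_positions)
  also have "\<dots> = xs[j - 1 := xs ! j, j := xs ! (j - 1)] ! i"
  proof (cases "i = j - 1 \<or> i = j")
    case True
    then show ?thesis using assms by (auto simp: nth_list_update)
  next
    case False
    then have "Suc i \<noteq> j" "Suc i \<noteq> j + 1" using assms by auto
    then show ?thesis using False by simp
  qed
  finally show "permute_positions (adjacent_swap j) xs ! i =
    xs[j - 1 := xs ! j, j := xs ! (j - 1)] ! i" .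
qed simp

lemma permute_positions_transpose_append:
  assumes "0 < j" "j < length ys"
  shows "permute_positions (adjacent_swap (length xs + j)) (xs @ ys @ zs) =
    xs @ permute_positions (adjacent_swap j) ys @ zs"
proof -
  obtain k where k: "j = Suc k" using assms by (cases j) auto
  have lt: "0 < length xs + j" "length xs + j < length (xs @ ys @ zs)" using assms by auto
  show ?thesis
    unfolding permute_positions_transpose[OF assms] permute_positions_transpose[OF lt]
    using assms unfolding k by (simp add: list_update_append nth_append)
qed

text \<open>
  Adjacent transpositions generate the symmetric group: conjugating \<open>(i, j)\<close> by \<open>(j, j + 1)\<close> gives
  \<open>(i, j + 1)\<close>.
\<close>

lemma permutes_adjacent_induct:
  fixes n :: nat
  assumes \<sigma>: "\<sigma> permutes {1..n}"
    and id: "P id"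
    and adj: "\<And>i. 0 < i \<Longrightarrow> i < n \<Longrightarrow> P (adjacent_swap i)"
    and comp: "\<And>\<sigma> \<tau>. P \<sigma> \<Longrightarrow> P \<tau> \<Longrightarrow> P (\<sigma> \<circ> \<tau>)"
  shows "P \<sigma>"
proof -
  have gap: "P (Transposition.transpose i (i + Suc d))" if "0 < i" "i + Suc d \<le> n" for i d
    using that(2)
  proof (induction d)
    case 0
    then show ?case using adj[of i] that by simp
  next
    case (Suc d)
    let ?a = "adjacent_swap (i + Suc d)"
    let ?b = "Transposition.transpose i (i + Suc d)"
    have "P (?a \<circ> ?b \<circ> ?a)" using Suc adj[of "i + Suc d"] by (intro comp) auto
    moreover have "?a \<circ> ?b \<circ> ?a = Transposition.transpose i (i + Suc (Suc d))"
      by (auto simp: fun_eq_iff Transposition.transpose_def)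
    ultimately show ?case by simp
  qed
  have trans: "P (Transposition.transpose a b)" if "a \<in> {1..n}" "b \<in> {1..n}" for a b
  proof (cases a b rule: linorder_cases)
    case less
    then obtain d where "b = a + Suc d" using less_imp_Suc_add by auto
    then show ?thesis using gap[of a d] that by simp
  next
    case equal
    then show ?thesis using id by simp
  next
    case greater
    then obtain d where "a = b + Suc d" using less_imp_Suc_add by auto
    then show ?thesis using gap[of b d] that by (simp add: transpose_commute)
  qed
  show ?thesis
    by (rule permutes_induct[where P = P, OF \<sigma> finite_atLeastAtMost id]) (blast intro: comp trans)
qed

section \<open>The generic action\<close>

type_synonym Ubar_point = "complex mat \<times> complex list"

lemma length_spectrum_list:
  "set xs \<subseteq> points (Ubar m) \<Longrightarrow> length (spectrum_list xs) = m * length xs"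
  by (induction xs) (auto simp: Ubar_def)

lemma nth_spectrum_list:
  assumes "set xs \<subseteq> points (Ubar m)" "i < m * length xs"
  shows "spectrum_list xs ! i = snd (xs ! (i div m)) ! (i mod m)"
  using assms
proof (induction xs arbitrary: i)
  case (Cons x xs)
  then have len: "length (snd x) = m" by (auto simp: Ubar_def)
  show ?case
  proof (cases "i < m")
    case True
    then show ?thesis using len by (simp add: nth_append)
  next
    case False
    then have m: "0 < m" using Cons.prems by (cases m) auto
    have "spectrum_list xs ! (i - m) = snd (xs ! ((i - m) div m)) ! ((i - m) mod m)"
      using Cons.prems False by (intro Cons.IH) auto
    then show ?thesis using len False m by (simp add: nth_append le_div_geq le_mod_geq)
  qed
qed simp

lemma mat_diag_points_Ubar:
  fixes f :: "nat \<Rightarrow> complex"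
  assumes "length ls = m" "distinct ls" "set ls \<subseteq> f ` {..<m}"
  shows "(mat_diag m f, ls) \<in> points (Ubar m)"
proof (rule points_UbarI)
  fix l assume "l \<in> set ls"
  then obtain i where i: "i < m" "l = f i" using assms by auto
  let ?X = "mat_diag m (\<lambda>j. if j = i then 1 else 0 :: complex)"
  have "mat_diag m f * ?X = l \<cdot>\<^sub>m ?X"
    unfolding mat_diag_diag by (rule eq_matI) (auto simp: mat_diag_def i)
  moreover have "?X \<noteq> 0\<^sub>m m m"
  proof
    assume "?X = 0\<^sub>m m m"
    then have "?X $$ (i, i) = 0" using i by simp
    then show False using i by (simp add: mat_diag_def)
  qed
  ultimately show "eigenvalue (mat_diag m f) l"
    using eigenvalue_if_right[OF mat_diag_dim mat_diag_dim] by blast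
qed (use assms in auto)

lemma polynomial_on_entry:
  assumes "k < N" "i < m" "j < m"
  shows "polynomial_on (Ubar_power m N) (\<lambda>b. fst (b ! k) $$ (i, j))"
proof (rule polynomial_on_coord)
  have "(\<lambda>x. fst x $$ (i, j)) \<in> coords (Ubar m)" unfolding Ubar_def using assms by auto
  from coord_factor[OF this assms(1)]
  show "(\<lambda>b. fst (b ! k) $$ (i, j)) \<in> coords (Ubar_power m N)" .
qed

lemma polynomial_on_listed_eigenvalue:
  assumes "k < N" "i < m"
  shows "polynomial_on (Ubar_power m N) (\<lambda>b. snd (b ! k) ! i)"
proof (rule polynomial_on_coord)
  have "(\<lambda>x. snd x ! i) \<in> coords (Ubar m)" unfolding Ubar_def using assms by auto
  from coord_factor[OF this assms(1)]
  show "(\<lambda>b. snd (b ! k) ! i) \<in> coords (Ubar_power m N)" .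
qed

text \<open>
  The complement is the zero set of the product of all differences of listed eigenvalues.
\<close>

lemma zariski_open_distinct_spectrum:
  "zariski_open (Ubar_power m N)
    {b \<in> points (Ubar_power m N). distinct (spectrum_list b)}"
proof -
  let ?X = "Ubar_power m N"
  let ?I = "{(i, j). i < m * N \<and> j < m * N \<and> i \<noteq> j}"
  let ?s = "\<lambda>b i. snd (b ! (i div m)) ! (i mod m)"
  define q where "q b = (\<Prod>(i, j)\<in>?I. ?s b i - ?s b j)" for b :: "Ubar_point list"
  have fin: "finite ?I" by (rule finite_subset[of _ "{..<m * N} \<times> {..<m * N}"]) auto
  have s: "polynomial_on ?X (\<lambda>b. ?s b i)" if "i < m * N" for i
  proof -
    have "0 < m" using that by (cases m) auto
    then show ?thesis using that
      by (intro polynomial_on_listed_eigenvalue) (auto simp: less_mult_imp_div_less mult.commute)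
  qed
  have "polynomial_on ?X q"
    unfolding q_def by (rule polynomial_on_prod) (auto intro!: polynomial_on_diff s)
  then have "zariski_open ?X {b \<in> points ?X. q b \<noteq> 0}"
    by (rule zariski_open_polynomial_on[OF _ zariski_open_points])
  moreover have "q b \<noteq> 0 \<longleftrightarrow> distinct (spectrum_list b)" if "b \<in> points ?X" for b
  proof -
    have b: "set b \<subseteq> points (Ubar m)" "length b = N" using that unfolding points_power_variety
      by auto
    have len: "length (spectrum_list b) = m * N" using length_spectrum_list[OF b(1)] b(2) by simp
    have nth: "spectrum_list b ! i = ?s b i" if "i < m * N" for i
      using nth_spectrum_list[OF b(1)] that b(2) by simp
    have "q b \<noteq> 0 \<longleftrightarrow> (\<forall>(i, j)\<in>?I. ?s b i \<noteq> ?s b j)"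
      unfolding q_def using fin by (auto simp: prod_zero_iff)
    also have "\<dots> \<longleftrightarrow> distinct (spectrum_list b)"
      unfolding distinct_conv_nth len using nth by auto
    finally show ?thesis .
  qed
  then have "{b \<in> points ?X. q b \<noteq> 0} = {b \<in> points ?X. distinct (spectrum_list b)}" by blast
  ultimately show ?thesis by simp
qed

lemma generically_distinct_spectrum:
  "generically (Ubar_power m N) (\<lambda>b. distinct (spectrum_list b))"
proof -
  let ?X = "Ubar_power m N"
  let ?x =
    "\<lambda>k. (mat_diag m (\<lambda>i. of_nat (k * m + i)), map (\<lambda>i. of_nat (k * m + i)) [0..<m]) :: Ubar_point"
  let ?b = "map ?x [0..<N]"
  have x: "?x k \<in> points (Ubar m)" for k
    by (rule mat_diag_points_Ubar) (auto simp: distinct_map inj_on_def)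
  then have b: "set ?b \<subseteq> points (Ubar m)" by auto
  have len: "length (spectrum_list ?b) = m * N" using length_spectrum_list[OF b] by simp
  have nth: "spectrum_list ?b ! i = of_nat i" if i: "i < m * N" for i
  proof -
    have "0 < m" using i by (cases m) auto
    moreover have "i div m < N" using i by (simp add: less_mult_imp_div_less mult.commute)
    moreover have "of_nat (i div m) * of_nat m + of_nat (i mod m) = (of_nat i :: complex)"
      by (metis div_mult_mod_eq of_nat_add of_nat_mult)
    ultimately show ?thesis using nth_spectrum_list[OF b, of i] i by simp
  qed
  have "distinct (spectrum_list ?b)"
    unfolding distinct_conv_nth len
  proof (intro allI impI)
    fix i j assume ij: "i < m * N" "j < m * N" "i \<noteq> j"
    show "spectrum_list ?b ! i \<noteq> spectrum_list ?b ! j"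
      unfolding nth[OF ij(1)] nth[OF ij(2)] using ij(3) by simp
  qed
  moreover have "?b \<in> points ?X" unfolding points_power_variety using b by simp
  ultimately have "generically ?X (\<lambda>b. b \<in> {b \<in> points ?X. distinct (spectrum_list b)})"
    using zariski_open_distinct_spectrum by (intro generically_open irreducible_power_Ubar) blast+
  then show ?thesis by (rule generically_mono) simp
qed

lemma refactorization_unique:
  assumes b: "b \<in> points (Ubar_power m N)" "distinct (spectrum_list b)"
    and \<sigma>: "\<sigma> permutes {1..m * N}"
    and r: "refactorization m N \<sigma> b x" "refactorization m N \<sigma> b y"
  shows "x = y"
proof (rule factorization_unique)
  have b': "set b \<subseteq> points (Ubar m)" "length b = N" using b unfolding points_power_variety by auto
  show "set x \<subseteq> points (Ubar m)" "set y \<subseteq> points (Ubar m)" "length x = length y"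
    "matrix_polynomial m x = matrix_polynomial m y" "spectrum_list x = spectrum_list y"
    using r unfolding refactorization_def points_power_variety by auto
  show "distinct (spectrum_list x)"
    using r(1) b(2) \<sigma> length_spectrum_list[OF b'(1)] b'(2)
    unfolding refactorization_def by (auto intro!: distinct_permute_positions)
qed

lemma perm_act_eqI:
  assumes "b \<in> points (Ubar_power m N)" "distinct (spectrum_list b)"
    "\<sigma> permutes {1..m * N}" "refactorization m N \<sigma> b x"
  shows "perm_act m N \<sigma> b = x"
  unfolding perm_act_def
  using assms(4) refactorization_unique[OF assms(1-3)] by (intro the_equality) auto

lemma refactorization_comp:
  assumes "b \<in> points (Ubar_power m N)"
    and "\<sigma> permutes {1..m * N}" "\<tau> permutes {1..m * N}"
    and "refactorization m N \<tau> b x" "refactorization m N \<sigma> x y"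
  shows "refactorization m N (\<sigma> \<circ> \<tau>) b y"
proof -
  have "set b \<subseteq> points (Ubar m)" "length b = N" using assms(1) unfolding points_power_variety
    by auto
  then have "length (spectrum_list b) = m * N" using length_spectrum_list by simp
  then show ?thesis using assms(4,5) permute_positions_comp[OF assms(2,3), of "spectrum_list b"]
    unfolding refactorization_def by simp
qed

text \<open>
  The notion that is propagated from adjacent transpositions to all permutations. It includes that
  the values are refactorizations, since a definite description by itself carries no information
  where existence and uniqueness are not known.
\<close>

definition acts_birationally :: "nat \<Rightarrow> nat \<Rightarrow> (nat \<Rightarrow> nat) \<Rightarrow> bool" where
  "acts_birationally m N \<sigma> \<longleftrightarrow> \<sigma> permutes {1..m * N} \<and>
    birational_automorphism (Ubar_power m N) (perm_act m N \<sigma>) \<and>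
    generically (Ubar_power m N) (\<lambda>b. refactorization m N \<sigma> b (perm_act m N \<sigma> b))"

text \<open>
  By uniqueness, a birational map that generically produces refactorizations agrees generically
  with the one defined by the definite description.
\<close>

lemma acts_birationallyI:
  assumes \<sigma>: "\<sigma> permutes {1..m * N}"
    and f: "birational_automorphism (Ubar_power m N) f"
    and gen: "generically (Ubar_power m N) (\<lambda>b. refactorization m N \<sigma> b (f b))"
  shows "acts_birationally m N \<sigma>"
    and "rational_eq (Ubar_power m N) (perm_act m N \<sigma>) f"
proof -
  let ?X = "Ubar_power m N"
  have *: "generically ?X (\<lambda>b. perm_act m N \<sigma> b = f b \<and> refactorization m N \<sigma> b (f b))"
    by (rule generically_mono[OF generically_conj[OF gen generically_distinct_spectrum]])
      (auto intro: perm_act_eqI[OF _ _ \<sigma>])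
  show eq: "rational_eq ?X (perm_act m N \<sigma>) f"
    unfolding rational_eq_def by (rule generically_mono[OF *]) simp
  have "generically ?X (\<lambda>b. refactorization m N \<sigma> b (perm_act m N \<sigma> b))"
    by (rule generically_mono[OF *]) simp
  moreover have "birational_automorphism ?X (perm_act m N \<sigma>)"
    using birational_automorphism_cong[OF irreducible_power_Ubar f rational_eq_sym[OF eq]] .
  ultimately show "acts_birationally m N \<sigma>" unfolding acts_birationally_def using \<sigma> by blast
qed

lemma acts_birationally_comp:
  assumes \<sigma>: "acts_birationally m N \<sigma>" and \<tau>: "acts_birationally m N \<tau>"
  shows "acts_birationally m N (\<sigma> \<circ> \<tau>)"
    and "rational_eq (Ubar_power m N) (perm_act m N (\<sigma> \<circ> \<tau>))
      (perm_act m N \<sigma> \<circ> perm_act m N \<tau>)"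
proof -
  let ?X = "Ubar_power m N"
  have perm: "\<sigma> permutes {1..m * N}" "\<tau> permutes {1..m * N}"
    and bir: "birational_automorphism ?X (perm_act m N \<sigma>)"
      "birational_automorphism ?X (perm_act m N \<tau>)"
    and gen: "generically ?X (\<lambda>b. refactorization m N \<sigma> b (perm_act m N \<sigma> b))"
      "generically ?X (\<lambda>b. refactorization m N \<tau> b (perm_act m N \<tau> b))"
    using assms unfolding acts_birationally_def by auto
  have "generically ?X (\<lambda>b. refactorization m N \<sigma> (perm_act m N \<tau> b)
    (perm_act m N \<sigma> (perm_act m N \<tau> b)))"
    using generically_birational_comp[OF irreducible_power_Ubar bir(2) gen(1)] .
  then have
    "generically ?X (\<lambda>b. refactorization m N (\<sigma> \<circ> \<tau>) b ((perm_act m N \<sigma> \<circ> perm_act m N \<tau>) b))"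
    by (rule generically_mono[OF generically_conj[OF _ gen(2)]])
      (auto intro: refactorization_comp[OF _ perm])
  from acts_birationallyI[OF permutes_compose[OF perm(2,1)]
      birational_automorphism_comp[OF irreducible_power_Ubar bir] this]
  show "acts_birationally m N (\<sigma> \<circ> \<tau>)"
    "rational_eq ?X (perm_act m N (\<sigma> \<circ> \<tau>)) (perm_act m N \<sigma> \<circ> perm_act m N \<tau>)" .
qed

lemma acts_birationally_id:
  shows "acts_birationally m N id" "rational_eq (Ubar_power m N) (perm_act m N id) id"
proof -
  have gen: "generically (Ubar_power m N) (\<lambda>b. refactorization m N id b (id b))"
    by (rule generically_mono[OF generically_distinct_spectrum]) (simp add: refactorization_def)
  show "acts_birationally m N id" "rational_eq (Ubar_power m N) (perm_act m N id) id"
    using acts_birationallyI[OF permutes_id birational_automorphism_id[OF irreducible_power_Ubar] gen] .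
qed

lemma refactorization_on_factors:
  assumes b: "b \<in> points (Ubar_power m N)" and ak: "a + k \<le> N"
    and r: "refactorization m k \<tau> (take k (drop a b)) (g (take k (drop a b)))"
  shows "matrix_polynomial m b = matrix_polynomial m (on_factors a k g b)"
    and "on_factors a k g b \<in> points (Ubar_power m N)"
    and "spectrum_list (on_factors a k g b) = spectrum_list (take a b) @
      permute_positions \<tau> (spectrum_list (take k (drop a b))) @ spectrum_list (drop (a + k) b)"
proof -
  let ?c = "take k (drop a b)"
  have g: "g ?c \<in> points (Ubar_power m k)" "matrix_polynomial m ?c = matrix_polynomial m (g ?c)"
    "spectrum_list (g ?c) = permute_positions \<tau> (spectrum_list ?c)"
    using r unfolding refactorization_def by auto
  have sub: "set (take a b) \<subseteq> points (Ubar m)" "set ?c \<subseteq> points (Ubar m)"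
    "set (drop (a + k) b) \<subseteq> points (Ubar m)" "set (g ?c) \<subseteq> points (Ubar m)"
    using b g(1) set_take_subset[of a b] set_drop_subset[of "a + k" b] factors_points[OF b ak]
    unfolding points_power_variety by auto
  have "b = take a b @ ?c @ drop (a + k) b"
    by (metis append_take_drop_id drop_drop add.commute)
  then have "matrix_polynomial m b = matrix_polynomial m (take a b @ ?c @ drop (a + k) b)" by simp
  also have "\<dots> = matrix_polynomial m (take a b) *
      (matrix_polynomial m ?c * matrix_polynomial m (drop (a + k) b))"
    using sub by (simp add: matrix_polynomial_append)
  also have "\<dots> = matrix_polynomial m (on_factors a k g b)"
    unfolding on_factors_def g(2) using sub by (simp add: matrix_polynomial_append)
  finally show "matrix_polynomial m b = matrix_polynomial m (on_factors a k g b)" .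
  show "on_factors a k g b \<in> points (Ubar_power m N)"
    by (rule on_factors_points[where n = N and g = g and xs = b]) (fact b ak g(1))+
  show "spectrum_list (on_factors a k g b) = spectrum_list (take a b) @
      permute_positions \<tau> (spectrum_list ?c) @ spectrum_list (drop (a + k) b)"
    unfolding on_factors_def using g(3) by simp
qed

text \<open>
  The matrix polynomial of a list is the product of those of its segments, so refactoring a segment
  is a refactorization of the whole list. This gives locality.
\<close>

lemma acts_birationally_on_factors:
  assumes \<tau>: "acts_birationally m k (adjacent_swap i)"
    and i: "0 < i" "i < m * k" and ak: "a + k \<le> N"
  defines "\<sigma> \<equiv> adjacent_swap (a * m + i)"
  shows "acts_birationally m N \<sigma>"
    and "acts_only_inside (Ubar m) N a k (perm_act m N \<sigma>)"
proof -
  let ?X = "Ubar_power m N" and ?\<tau> = "adjacent_swap i"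
  let ?f = "on_factors a k (perm_act m k ?\<tau>)"
  have bir: "birational_automorphism (Ubar_power m k) (perm_act m k ?\<tau>)"
    and gen: "generically (Ubar_power m k) (\<lambda>b. refactorization m k ?\<tau> b (perm_act m k ?\<tau> b))"
    using \<tau> unfolding acts_birationally_def by auto
  have "a * m + i + 1 \<le> a * m + m * k" using i by simp
  also have "\<dots> = m * (a + k)" by (simp add: algebra_simps)
  also have "\<dots> \<le> m * N" using ak by simp
  finally have \<sigma>: "\<sigma> permutes {1..m * N}"
    unfolding \<sigma>_def using i by (intro permutes_swap_id) auto
  have r: "refactorization m N \<sigma> b (?f b)" if b: "b \<in> points ?X"
    and r: "refactorization m k ?\<tau> (take k (drop a b)) (perm_act m k ?\<tau> (take k (drop a b)))" for b
  proof -
    have len: "length b = N" and sub: "set b \<subseteq> points (Ubar m)" using b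
      unfolding points_power_variety by auto
    have "set (take a b) \<subseteq> points (Ubar m)" "set (take k (drop a b)) \<subseteq> points (Ubar m)"
      using sub set_take_subset[of a b] factors_points[OF b ak] unfolding points_power_variety
        by auto
    then have l: "length (spectrum_list (take a b)) = a * m"
      "length (spectrum_list (take k (drop a b))) = m * k"
      using len ak by (simp_all add: length_spectrum_list)
    have "b = take a b @ take k (drop a b) @ drop (a + k) b"
      by (metis append_take_drop_id drop_drop add.commute)
    then have "spectrum_list b = spectrum_list (take a b) @ spectrum_list (take k (drop a b)) @
      spectrum_list (drop (a + k) b)" using spectrum_list_simps(3) by metis
    then have "permute_positions \<sigma> (spectrum_list b) = spectrum_list (take a b) @
      permute_positions ?\<tau> (spectrum_list (take k (drop a b))) @ spectrum_list (drop (a + k) b)"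
      unfolding \<sigma>_def using permute_positions_transpose_append[OF i(1),
          of "spectrum_list (take k (drop a b))" "spectrum_list (take a b)"] l i(2) by simp
    then show ?thesis
      unfolding refactorization_def
        using refactorization_on_factors[where g = "perm_act m k ?\<tau>", OF b ak r] by simp
  qed
  have f: "birational_automorphism ?X ?f"
    by (rule birational_automorphism_on_factors[OF ak irreducible_power_Ubar points_Ubar_nonempty bir])
  have "generically ?X (\<lambda>b. refactorization m N \<sigma> b (?f b))"
    by (rule generically_mono[OF
          generically_factors[OF ak irreducible_power_Ubar points_Ubar_nonempty gen]]) (rule r)
  note good = acts_birationallyI[OF \<sigma> f this]
  show "acts_birationally m N \<sigma>" by (rule good(1))
  show "acts_only_inside (Ubar m) N a k (perm_act m N \<sigma>)"
    unfolding acts_only_inside_def using bir good(2) by blast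
qed

section \<open>The generating transpositions\<close>

text \<open>
  The matrices stay the same and only the list of eigenvalues is permuted.
\<close>

lemma acts_birationally_inner:
  assumes i: "0 < i" "i < m"
  shows "acts_birationally m 1 (adjacent_swap i)"
proof -
  let ?X = "Ubar_power m 1" and ?\<tau> = "adjacent_swap i"
  define f where "f b = [(fst (b ! 0), permute_positions ?\<tau> (snd (b ! 0)))]"
    for b :: "Ubar_point list"
  have \<tau>: "?\<tau> permutes {1..m * 1}" using i by (intro permutes_swap_id) auto
  have \<tau>': "?\<tau> permutes {1..m}" using \<tau> by simp
  have single: "\<exists>c ls. b = [(c, ls)] \<and> (c, ls) \<in> points (Ubar m)" if "b \<in> points ?X" for b
    using that unfolding points_power_variety by (auto simp: length_Suc_conv)
  have f: "refactorization m 1 ?\<tau> b (f b)" "f (f b) = b" if b: "b \<in> points ?X" for b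
  proof -
    obtain c ls where cls: "b = [(c, ls)]" "(c, ls) \<in> points (Ubar m)" using single[OF b] by blast
    then have ls: "length ls = m" "distinct ls" "set ls = {l. eigenvalue c l}"
      and c: "c \<in> carrier_mat m m" unfolding points_Ubar by auto
    have "set (permute_positions ?\<tau> ls) = set ls"
      unfolding permute_positions_transpose[OF i(1) i(2)[folded ls(1)]]
      using i ls(1) set_swap[of "i - 1" ls i] by (simp add: list_update_swap)
    then have "(c, permute_positions ?\<tau> ls) \<in> points (Ubar m)"
      using ls c distinct_permute_positions[of ?\<tau> ls] \<tau>' unfolding points_Ubar by simp
    then show "refactorization m 1 ?\<tau> b (f b)"
      unfolding refactorization_def points_power_variety cls f_def by simp
    have "permute_positions ?\<tau> (permute_positions ?\<tau> ls) = ls"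
      unfolding permute_positions_comp[OF \<tau>' \<tau>' ls(1), symmetric] by simp
    then show "f (f b) = b" unfolding cls f_def by simp
  qed
  have maps: "f ` points ?X \<subseteq> points ?X" using f(1) unfolding refactorization_def by blast
  have "regular_map ?X (points ?X) ?X f"
    unfolding regular_map_def
  proof (intro conjI ballI maps regular_on_polynomial zariski_open_points)
    fix d assume "d \<in> coords ?X"
    then obtain c where c: "c \<in> coords (Ubar m)" and d: "d = (\<lambda>b. c (b ! 0))"
      unfolding coords_power_variety by auto
    from c consider r s where "r < m" "s < m" "c = (\<lambda>x. fst x $$ (r, s))"
      | r where "r < m" "c = (\<lambda>x. snd x ! r)" unfolding Ubar_def by auto
    then show "polynomial_on ?X (\<lambda>b. d (f b))"
    proof cases
      case 1
      then show ?thesis unfolding d f_def using polynomial_on_entry[of 0 1 r m s] by simp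
    next
      case 2
      let ?r = "inv_into UNIV ?\<tau> (Suc r) - 1"
      have "?r < m" using permute_positions_index(1)[OF \<tau>' 2(1)] .
      then have "polynomial_on ?X (\<lambda>b. snd (b ! 0) ! ?r)"
        by (intro polynomial_on_listed_eigenvalue) simp
      moreover have "d (f b) = snd (b ! 0) ! ?r" if b: "b \<in> points ?X" for b
      proof -
        obtain c' ls where "b = [(c', ls)]" "(c', ls) \<in> points (Ubar m)" using single[OF b] by blast
        then show ?thesis
          unfolding d f_def 2(2) using 2(1)
            by (simp add: points_Ubar nth_permute_positions del: inv_swap_id)
      qed
      ultimately show ?thesis by (rule polynomial_on_if_eq)
    qed
  qed
  moreover have "points ?X \<noteq> {}" using irreducible_power_Ubar[of m 1]
    unfolding irreducible_variety_def by blast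
  ultimately have bir: "birational_automorphism ?X f"
    using maps f(2)
      by (intro birational_automorphism_involution[OF irreducible_power_Ubar zariski_open_points])
  have "generically ?X (\<lambda>b. refactorization m 1 ?\<tau> b (f b))"
    by (rule generically_mono[OF generically_distinct_spectrum]) (rule f(1))
  from acts_birationallyI(1)[OF \<tau> bir this] show ?thesis .
qed

definition polynomial_mat :: "'a variety \<Rightarrow> nat \<Rightarrow> ('a \<Rightarrow> complex mat) \<Rightarrow> bool" where
  "polynomial_mat X m F \<longleftrightarrow> (\<forall>x\<in>points X. F x \<in> carrier_mat m m) \<and>
    (\<forall>i<m. \<forall>j<m. polynomial_on X (\<lambda>x. F x $$ (i, j)))"

lemma polynomial_mat_mult:
  assumes F: "polynomial_mat X m F" and G: "polynomial_mat X m G"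
  shows "polynomial_mat X m (\<lambda>x. F x * G x)"
  unfolding polynomial_mat_def
proof (intro conjI ballI allI impI)
  show "F x * G x \<in> carrier_mat m m" if "x \<in> points X" for x
    using assms that unfolding polynomial_mat_def by (auto intro!: mult_carrier_mat)
  fix i j assume ij: "i < m" "j < m"
  have "polynomial_on X (\<lambda>x. \<Sum>k\<in>{0..<m}. F x $$ (i, k) * G x $$ (k, j))"
    using assms ij unfolding polynomial_mat_def by (intro polynomial_on_sum polynomial_on_mult) auto
  moreover have "(F x * G x) $$ (i, j) = (\<Sum>k\<in>{0..<m}. F x $$ (i, k) * G x $$ (k, j))"
    if "x \<in> points X" for x
  proof -
    have "F x \<in> carrier_mat m m" "G x \<in> carrier_mat m m"
      using assms that unfolding polynomial_mat_def by auto
    then show ?thesis using ij by (auto simp: scalar_prod_def intro!: sum.cong)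
  qed
  ultimately show "polynomial_on X (\<lambda>x. (F x * G x) $$ (i, j))"
    by (rule polynomial_on_if_eq)
qed

lemma polynomial_mat_shift_prod:
  assumes F: "polynomial_mat X m F" and L: "\<And>i. i \<in> set is \<Longrightarrow> polynomial_on X (\<lambda>x. L x i)"
  shows "polynomial_mat X m (\<lambda>x. shift_prod m (F x) (map (L x) is))"
  using L
proof (induction "is")
  case Nil
  then show ?case by (simp add: polynomial_mat_def polynomial_on_const)
next
  case (Cons i "is")
  have "polynomial_mat X m (\<lambda>x. F x - L x i \<cdot>\<^sub>m 1\<^sub>m m)"
    unfolding polynomial_mat_def
  proof (intro conjI ballI allI impI)
    show "F x - L x i \<cdot>\<^sub>m 1\<^sub>m m \<in> carrier_mat m m" if "x \<in> points X" for x by auto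
    fix r s assume rs: "r < m" "s < m"
    have "polynomial_on X (\<lambda>x. F x $$ (r, s) - L x i * 1\<^sub>m m $$ (r, s))"
      using F rs Cons.prems unfolding polynomial_mat_def
      by (intro polynomial_on_diff polynomial_on_mult polynomial_on_const) auto
    then show "polynomial_on X (\<lambda>x. (F x - L x i \<cdot>\<^sub>m 1\<^sub>m m) $$ (r, s))" using rs by simp
  qed
  then show ?case using Cons by (auto intro!: polynomial_mat_mult)
qed

text \<open>
  Up to scalars these are the spectral projectors of the first factor at the last eigenvalue of its
  list and of the second factor at the first eigenvalue of its list, that is, at the two eigenvalues
  exchanged by the boundary transposition.
\<close>

definition last_projector :: "nat \<Rightarrow> Ubar_point list \<Rightarrow> complex mat" where
  "last_projector m b = shift_prod m (fst (b ! 0)) (butlast (snd (b ! 0)))"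

definition first_projector :: "nat \<Rightarrow> Ubar_point list \<Rightarrow> complex mat" where
  "first_projector m b = shift_prod m (fst (b ! 1)) (tl (snd (b ! 1)))"

text \<open>
  If the projectors are \<open>u v\<close> and \<open>u' w\<close>, with columns \<open>u\<close>, \<open>u'\<close>
    and rows \<open>v\<close>, \<open>w\<close>, then the product is
  \<open>(w u) u' v\<close>; so the last condition says that \<open>w u \<noteq> 0\<close>.
\<close>

definition exchange_domain :: "nat \<Rightarrow> Ubar_point list set" where
  "exchange_domain m = {b \<in> points (Ubar_power m 2). distinct (spectrum_list b) \<and>
    first_projector m b * last_projector m b \<noteq> 0\<^sub>m m m}"

text \<open>
  The denominator \<open>w u\<close> of the exchange formula for \<open>u\<close> the column \<open>i\<close> of the last projector and
  \<open>w\<close> the row \<open>j\<close> of the first projector.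
\<close>

definition pivot :: "nat \<Rightarrow> nat \<Rightarrow> nat \<Rightarrow> Ubar_point list \<Rightarrow> complex" where
  "pivot m i j b = (first_projector m b * last_projector m b) $$ (j, i)"

definition col_times_row :: "nat \<Rightarrow> complex mat \<Rightarrow> nat \<Rightarrow> complex mat \<Rightarrow> nat \<Rightarrow> complex mat" where
  "col_times_row m P i Q j = mat m m (\<lambda>(r, s). P $$ (r, i) * Q $$ (j, s))"

text \<open>
  In general no single choice of \<open>i\<close>
    and \<open>j\<close> works on the whole exchange domain; the resulting point does not
  depend on the choice, by uniqueness of refactorizations.
\<close>

definition exchange ::
  "nat \<Rightarrow> nat \<Rightarrow> nat \<Rightarrow> Ubar_point list \<Rightarrow> Ubar_point list" where
  "exchange m i j b =
    (let l = snd (b ! 0) ! (m - 1); k = snd (b ! 1) ! 0;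
         p = (1 / pivot m i j b) \<cdot>\<^sub>m col_times_row m (last_projector m b) i (first_projector m b) j in
      [(fst (b ! 0) + (k - l) \<cdot>\<^sub>m p, (snd (b ! 0))[m - 1 := k]),
       (fst (b ! 1) - (k - l) \<cdot>\<^sub>m p, (snd (b ! 1))[0 := l])])"

lemma index_mult_mat_sum:
  assumes "A \<in> carrier_mat m m" "B \<in> carrier_mat m m" "r < m" "s < m"
  shows "(A * B) $$ (r, s) = (\<Sum>t\<in>{0..<m}. A $$ (r, t) * B $$ (t, s))"
  using assms by (auto simp: scalar_prod_def intro!: sum.cong)

lemma col_times_row_carrier[simp]: "col_times_row m P i Q j \<in> carrier_mat m m"
  unfolding col_times_row_def by simp

lemma col_times_row_dim[simp]:
  "dim_row (col_times_row m P i Q j) = m" "dim_col (col_times_row m P i Q j) = m"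
  unfolding col_times_row_def by simp_all

lemma col_times_row_index:
  "r < m \<Longrightarrow> s < m \<Longrightarrow> col_times_row m P i Q j $$ (r, s) = P $$ (r, i) * Q $$ (j, s)"
  unfolding col_times_row_def by simp

lemma col_times_row_left:
  assumes C: "b \<in> carrier_mat m m" "P \<in> carrier_mat m m" and i: "i < m" and eig: "b * P = l \<cdot>\<^sub>m P"
  shows "b * col_times_row m P i Q j = l \<cdot>\<^sub>m col_times_row m P i Q j" (is "b * ?R = _")
proof (rule eq_matI)
  fix r s assume "r < dim_row (l \<cdot>\<^sub>m ?R)" "s < dim_col (l \<cdot>\<^sub>m ?R)"
  then have rs: "r < m" "s < m" by auto
  have "(b * ?R) $$ (r, s) = (\<Sum>t\<in>{0..<m}. b $$ (r, t) * P $$ (t, i)) * Q $$ (j, s)"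
    using rs by (simp add: index_mult_mat_sum[OF C(1) col_times_row_carrier] col_times_row_index
        sum_distrib_right mult.assoc)
  also have "\<dots> = (l \<cdot>\<^sub>m P) $$ (r, i) * Q $$ (j, s)"
    using index_mult_mat_sum[OF C rs(1) i] eig by simp
  finally show "(b * ?R) $$ (r, s) = (l \<cdot>\<^sub>m ?R) $$ (r, s)"
    using rs i C by (simp add: col_times_row_index)
qed (use C in auto)

lemma col_times_row_right:
  assumes C: "b \<in> carrier_mat m m" "Q \<in> carrier_mat m m" and j: "j < m" and eig: "Q * b = k \<cdot>\<^sub>m Q"
  shows "col_times_row m P i Q j * b = k \<cdot>\<^sub>m col_times_row m P i Q j" (is "?R * b = _")
proof (rule eq_matI)
  fix r s assume "r < dim_row (k \<cdot>\<^sub>m ?R)" "s < dim_col (k \<cdot>\<^sub>m ?R)"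
  then have rs: "r < m" "s < m" by auto
  have "(?R * b) $$ (r, s) = P $$ (r, i) * (\<Sum>t\<in>{0..<m}. Q $$ (j, t) * b $$ (t, s))"
    using rs by (simp add: index_mult_mat_sum[OF col_times_row_carrier C(1)] col_times_row_index
        sum_distrib_left mult.assoc)
  also have "\<dots> = P $$ (r, i) * (k \<cdot>\<^sub>m Q) $$ (j, s)"
    using index_mult_mat_sum[OF C(2,1) j rs(2)] eig by simp
  finally show "(?R * b) $$ (r, s) = (k \<cdot>\<^sub>m ?R) $$ (r, s)"
    using rs j C by (simp add: col_times_row_index)
qed (use C in auto)

lemma col_times_row_square:
  assumes C: "P \<in> carrier_mat m m" "Q \<in> carrier_mat m m" and ij: "i < m" "j < m"
  shows "col_times_row m P i Q j * col_times_row m P i Q j =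
    (Q * P) $$ (j, i) \<cdot>\<^sub>m col_times_row m P i Q j" (is "?R * ?R = ?d \<cdot>\<^sub>m _")
proof (rule eq_matI)
  fix r s assume "r < dim_row (?d \<cdot>\<^sub>m ?R)" "s < dim_col (?d \<cdot>\<^sub>m ?R)"
  then have rs: "r < m" "s < m" by auto
  have "(?R * ?R) $$ (r, s) =
    P $$ (r, i) * (\<Sum>t\<in>{0..<m}. Q $$ (j, t) * P $$ (t, i)) * Q $$ (j, s)"
    using rs by (simp add: index_mult_mat_sum[OF col_times_row_carrier col_times_row_carrier]
        col_times_row_index sum_distrib_left sum_distrib_right mult.assoc
        del: index_mult_mat(1))
  also have "(\<Sum>t\<in>{0..<m}. Q $$ (j, t) * P $$ (t, i)) = ?d"
    using index_mult_mat_sum[OF C(2,1) ij(2,1)] by simp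
  finally show "(?R * ?R) $$ (r, s) = (?d \<cdot>\<^sub>m ?R) $$ (r, s)"
    using rs by (simp add: col_times_row_index)
qed auto

text \<open>
  The trace of \<open>u w\<close> is \<open>w u\<close>.
\<close>

lemma col_times_row_nonzero:
  assumes C: "P \<in> carrier_mat m m" "Q \<in> carrier_mat m m" and ij: "i < m" "j < m"
    and nz: "(Q * P) $$ (j, i) \<noteq> 0"
  shows "col_times_row m P i Q j \<noteq> 0\<^sub>m m m"
proof
  assume 0: "col_times_row m P i Q j = 0\<^sub>m m m"
  have "(Q * P) $$ (j, i) = (\<Sum>t\<in>{0..<m}. col_times_row m P i Q j $$ (t, t))"
    unfolding index_mult_mat_sum[OF C(2,1) ij(2,1)]
    by (intro sum.cong) (auto simp: col_times_row_index)
  then show False using nz unfolding 0 by simp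
qed

lemma permute_positions_boundary:
  assumes "0 < m" "length xs = m" "length ys = m"
  shows "permute_positions (adjacent_swap m) (xs @ ys) =
    xs[m - 1 := ys ! 0] @ ys[0 := xs ! (m - 1)]"
proof -
  have lt: "m < length (xs @ ys)" using assms by simp
  show ?thesis
    unfolding permute_positions_transpose[OF assms(1) lt] using assms
    by (simp add: list_update_append nth_append)
qed

text \<open>
  Sandwiching \<open>Q * P\<close> between two copies of \<open>p\<close> gives a nonzero multiple of \<open>p\<close>.
\<close>

lemma projector_product_nonzero:
  assumes C: "P \<in> carrier_mat m m" "Q \<in> carrier_mat m m" "p \<in> carrier_mat m m"
    and p: "p \<noteq> 0\<^sub>m m m" "p * p = p"
    and act: "P * p = \<alpha> \<cdot>\<^sub>m p" "p * Q = \<beta> \<cdot>\<^sub>m p" "\<alpha> \<noteq> 0" "\<beta> \<noteq> (0 :: complex)"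
  shows "Q * P \<noteq> 0\<^sub>m m m"
proof
  assume 0: "Q * P = 0\<^sub>m m m"
  have "(p * Q) * (P * p) = p * (Q * (P * p))"
    using C by (intro square_mult_assoc[of _ m]) auto
  also have "Q * (P * p) = Q * P * p"
    using C by (intro square_mult_assoc[of _ m, symmetric]) auto
  also have "p * (Q * P * p) = 0\<^sub>m m m" unfolding 0 using C by simp
  finally have "(p * Q) * (P * p) = 0\<^sub>m m m" .
  moreover have "(p * Q) * (P * p) = (\<beta> * \<alpha>) \<cdot>\<^sub>m p"
    unfolding act using C p(2) by (simp add: mult_smult_assoc_mat[of _ m m _ m]
        mult_smult_distrib[of _ m m _ m] smult_smult_mat mult.commute)
  moreover obtain r s where rs: "r < m" "s < m" "p $$ (r, s) \<noteq> 0"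
    using nonzero_mat_index[OF C(3) p(1)] by blast
  ultimately have "((\<beta> * \<alpha>) \<cdot>\<^sub>m p) $$ (r, s) = 0" by simp
  then show False using act rs C by simp
qed

lemma exchange_correct:
  assumes m: "0 < m" and b: "b \<in> points (Ubar_power m 2)" "distinct (spectrum_list b)"
    and ij: "i < m" "j < m" and pivot: "pivot m i j b \<noteq> 0"
  shows "refactorization m 2 (adjacent_swap m) b (exchange m i j b)"
    and "exchange m i j b \<in> exchange_domain m"
proof -
  obtain b1 ls b2 ks where beq: "b = [(b1, ls), (b2, ks)]"
    and pts: "(b1, ls) \<in> points (Ubar m)" "(b2, ks) \<in> points (Ubar m)"
    using b(1) unfolding points_power_variety by (auto simp: length_Suc_conv numeral_2_eq_2)
  have C: "b1 \<in> carrier_mat m m" "b2 \<in> carrier_mat m m"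
    and ls: "length ls = m" "distinct ls" "set ls = {l. eigenvalue b1 l}"
    and ks: "length ks = m" "distinct ks" "set ks = {l. eigenvalue b2 l}"
    using pts unfolding points_Ubar by auto
  have dist: "distinct (ls @ ks)" using b(2) beq by simp
  define l k where "l = ls ! (m - 1)" and "k = ks ! 0"
  have lk: "l \<in> set ls" "k \<in> set ks" unfolding l_def k_def using ls ks m by auto
  then have "l \<noteq> k" using dist by auto
  have ls': "ls = butlast ls @ [l]" unfolding l_def using ls(1) m
    by (metis append_butlast_last_id last_conv_nth length_greater_0_conv)
  have ks': "ks = k # tl ks" unfolding k_def using ks(1) m by (cases ks) auto
  define P Q d where "P = last_projector m b" and "Q = first_projector m b" and "d = pivot m i j b"
  have P: "P = shift_prod m b1 (butlast ls)" and Q: "Q = shift_prod m b2 (tl ks)"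
    unfolding P_def Q_def last_projector_def first_projector_def beq by simp_all
  have PC: "P \<in> carrier_mat m m" and QC: "Q \<in> carrier_mat m m" unfolding P Q using C by simp_all
  have "set ls - {l} \<subseteq> set (butlast ls)" by (subst ls') auto
  from shift_prod_eigen(1)[OF pts(1) this] have b1P: "b1 * P = l \<cdot>\<^sub>m P" unfolding P .
  have "set ks - {k} \<subseteq> set (tl ks)" by (subst ks') auto
  from shift_prod_eigen(2)[OF pts(2) this] have Qb2: "Q * b2 = k \<cdot>\<^sub>m Q" unfolding Q .
  define R where "R = col_times_row m P i Q j"
  define p where "p = (1 / d) \<cdot>\<^sub>m R"
  have RC: "R \<in> carrier_mat m m" and pC: "p \<in> carrier_mat m m" unfolding p_def R_def by simp_all
  have d: "d \<noteq> 0" "d = (Q * P) $$ (j, i)" using pivot unfolding d_def pivot_def P_def Q_def by auto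
  have b1p: "b1 * p = l \<cdot>\<^sub>m p"
    using col_times_row_left[OF C(1) PC ij(1) b1P] mult_smult_distrib[OF C(1) RC, of "1 / d"]
    unfolding p_def R_def by (simp add: smult_smult_mat mult.commute)
  have pb2: "p * b2 = k \<cdot>\<^sub>m p"
    using col_times_row_right[OF C(2) QC ij(2) Qb2] mult_smult_assoc_mat[OF RC C(2), of "1 / d"]
    unfolding p_def R_def by (simp add: smult_smult_mat mult.commute)
  have pp: "p * p = p"
  proof -
    have "p * p = (1 / d) \<cdot>\<^sub>m ((1 / d) \<cdot>\<^sub>m (R * R))"
      unfolding p_def
      using mult_smult_assoc_mat[OF RC pC, of "1 / d"] mult_smult_distrib[OF RC RC, of "1 / d"]
      unfolding p_def by simp
    also have "R * R = d \<cdot>\<^sub>m R" unfolding R_def d(2) by (rule col_times_row_square[OF PC QC ij])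
    finally show ?thesis unfolding p_def using d(1) by (simp add: smult_smult_mat)
  qed
  have p0: "p \<noteq> 0\<^sub>m m m"
  proof
    assume "p = 0\<^sub>m m m"
    then have "d \<cdot>\<^sub>m p = 0\<^sub>m m m" by (auto intro: eq_matI)
    moreover have "d \<cdot>\<^sub>m p = R" unfolding p_def smult_smult_mat using d(1) RC
      by (auto intro!: eq_matI)
    ultimately show False using col_times_row_nonzero[OF PC QC ij] d unfolding R_def by auto
  qed
  define c1 c2 where "c1 = b1 + (k - l) \<cdot>\<^sub>m p" and "c2 = b2 - (k - l) \<cdot>\<^sub>m p"
  note ex = exchange_identities[OF C pC b1p pb2 pp, folded c1_def c2_def]
  have cC: "c1 \<in> carrier_mat m m" "c2 \<in> carrier_mat m m"
    unfolding c1_def c2_def using C pC by (auto intro!: minus_carrier_mat)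
  define ls2 ks2 where "ls2 = ls[m - 1 := k]" and "ks2 = ks[0 := l]"
  have ls2: "ls2 = butlast ls @ [k]"
    unfolding ls2_def by (subst ls') (use ls(1) in \<open>simp add: list_update_append\<close>)
  have ks2: "ks2 = l # tl ks" unfolding ks2_def by (subst ks') simp
  have dist2: "distinct (ls2 @ ks2)"
  proof -
    have "distinct ((butlast ls @ [l]) @ (k # tl ks))" using dist ls' ks' by metis
    then show ?thesis unfolding ls2 ks2 by auto
  qed
  have len2: "length ls2 = m" "length ks2 = m" unfolding ls2_def ks2_def using ls ks by simp_all
  have "(c1, ls2) \<in> points (Ubar m)"
  proof (rule points_UbarI[OF cC(1) len2(1)])
    show "distinct ls2" using dist2 by simp
    fix s assume "s \<in> set ls2"
    then consider "s = k" | "s \<in> set (butlast ls)" unfolding ls2 by auto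
    then show "eigenvalue c1 s"
    proof cases
      case 1
      then show ?thesis using eigenvalue_if_right[OF cC(1) pC p0] ex(1) by simp
    next
      case 2
      have "distinct (butlast ls @ [l])" using ls(2) ls' by simp
      then have "s \<noteq> l" using 2 by auto
      have "eigenvalue b1 s" using 2 ls(3) in_set_butlastD by fast
      then obtain X where X: "X \<in> carrier_mat m m" "X \<noteq> 0\<^sub>m m m" "X * b1 = s \<cdot>\<^sub>m X"
        using eigenvalue_left[OF C(1)] by blast
      then show ?thesis using eigenvalue_if_left[OF cC(1) X(1,2)] ex(3)[OF X(1,3) \<open>s \<noteq> l\<close>] by blast
    qed
  qed
  moreover have "(c2, ks2) \<in> points (Ubar m)"
  proof (rule points_UbarI[OF cC(2) len2(2)])
    show "distinct ks2" using dist2 by simp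
    fix s assume "s \<in> set ks2"
    then consider "s = l" | "s \<in> set (tl ks)" unfolding ks2 by auto
    then show "eigenvalue c2 s"
    proof cases
      case 1
      then show ?thesis using eigenvalue_if_left[OF cC(2) pC p0] ex(2) by simp
    next
      case 2
      have "distinct (k # tl ks)" using ks(2) ks' by simp
      then have "s \<noteq> k" using 2 by auto
      have "s \<in> set ks" by (subst ks') (use 2 in simp)
      then have "eigenvalue b2 s" using ks(3) by simp
      then obtain X where X: "X \<in> carrier_mat m m" "X \<noteq> 0\<^sub>m m m" "b2 * X = s \<cdot>\<^sub>m X"
        using eigenvalue_right[OF C(2)] by blast
      then show ?thesis using eigenvalue_if_right[OF cC(2) X(1,2)] ex(4)[OF X(1,3) \<open>s \<noteq> k\<close>] by blast
    qed
  qed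
  ultimately have pts2: "[(c1, ls2), (c2, ks2)] \<in> points (Ubar_power m 2)"
    unfolding points_power_variety by simp
  have eq: "exchange m i j b = [(c1, ls2), (c2, ks2)]"
    unfolding exchange_def Let_def c1_def c2_def ls2_def ks2_def l_def k_def
      p_def d_def R_def P_def Q_def
    unfolding beq by simp
  have "matrix_polynomial m b = matrix_polynomial m [(c1, ls2), (c2, ks2)]"
    unfolding beq using ex(5) right_mult_one_mat[OF char_poly_matrix_closed[OF C(2)]]
      right_mult_one_mat[OF char_poly_matrix_closed[OF cC(2)]] by simp
  moreover have "permute_positions (adjacent_swap m) (spectrum_list b) = ls2 @ ks2"
    unfolding beq ls2_def ks2_def l_def k_def using permute_positions_boundary[OF m ls(1) ks(1)]
      by simp
  ultimately show "refactorization m 2 (adjacent_swap m) b (exchange m i j b)"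
    unfolding refactorization_def eq using pts2 by simp
  have b2: "butlast ls2 = butlast ls" "tl ks2 = tl ks" unfolding ls2 ks2 by simp_all
  have "shift_prod m c2 (tl ks) * shift_prod m c1 (butlast ls) \<noteq> 0\<^sub>m m m"
  proof (rule projector_product_nonzero[OF _ _ pC p0 pp])
    show "shift_prod m c1 (butlast ls) * p = (\<Prod>s\<leftarrow>butlast ls. k - s) \<cdot>\<^sub>m p"
      by (rule shift_prod_mult_right[OF cC(1) pC ex(1)])
    show "p * shift_prod m c2 (tl ks) = (\<Prod>s\<leftarrow>tl ks. l - s) \<cdot>\<^sub>m p"
      by (rule shift_prod_mult_left[OF cC(2) pC ex(2)])
    show "(\<Prod>s\<leftarrow>butlast ls. k - s) \<noteq> 0" "(\<Prod>s\<leftarrow>tl ks. l - s) \<noteq> 0"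
      unfolding prod_list_diff_eq_0_iff using dist2 unfolding ls2 ks2 by auto
  qed (use cC in auto)
  then show "exchange m i j b \<in> exchange_domain m"
    unfolding eq exchange_domain_def first_projector_def last_projector_def
    using pts2 dist2 b2 by simp
qed

lemma projectors_polynomial:
  "polynomial_mat (Ubar_power m 2) m (last_projector m)"
  "polynomial_mat (Ubar_power m 2) m (first_projector m)"
proof -
  let ?X = "Ubar_power m 2"
  have fst: "polynomial_mat ?X m (\<lambda>b. fst (b ! k))" if "k < 2" for k
    unfolding polynomial_mat_def using that
    by (auto intro!: polynomial_on_entry Ubar_carrier power_variety_nth)
  have transfer: "polynomial_mat ?X m F" if GF: "polynomial_mat ?X m G"
    and eq: "\<And>b. b \<in> points ?X \<Longrightarrow> F b = G b" for F G
  proof -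
    have "polynomial_on ?X (\<lambda>x. F x $$ (i, j))" if ij: "i < m" "j < m" for i j
      by (rule polynomial_on_if_eq[where g = "\<lambda>x. G x $$ (i, j)"])
        (use ij GF eq in \<open>auto simp: polynomial_mat_def\<close>)
    then show ?thesis using GF eq unfolding polynomial_mat_def by auto
  qed
  have len: "length (snd (b ! k)) = m" if "b \<in> points ?X" "k < 2" for b k
  proof -
    have "b ! k \<in> points (Ubar m)" using that by (rule power_variety_nth)
    then show ?thesis by (auto simp: Ubar_def)
  qed
  have
    "polynomial_mat ?X m (\<lambda>b. shift_prod m (fst (b ! 0)) (map (\<lambda>i. snd (b ! 0) ! i) [0..<m - 1]))"
    by (intro polynomial_mat_shift_prod fst polynomial_on_listed_eigenvalue) auto
  then show "polynomial_mat ?X m (last_projector m)"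
  proof (rule transfer)
    fix b assume b: "b \<in> points ?X"
    have "butlast (snd (b ! 0)) = map (\<lambda>i. snd (b ! 0) ! i) [0..<m - 1]"
      using len[OF b, of 0] by (intro nth_equalityI) (auto simp: nth_butlast)
    then show
      "last_projector m b = shift_prod m (fst (b ! 0)) (map (\<lambda>i. snd (b ! 0) ! i) [0..<m - 1])"
      unfolding last_projector_def by simp
  qed
  have "polynomial_mat ?X m (\<lambda>b. shift_prod m (fst (b ! 1)) (map (\<lambda>i. snd (b ! 1) ! i) [1..<m]))"
    by (intro polynomial_mat_shift_prod fst polynomial_on_listed_eigenvalue) auto
  then show "polynomial_mat ?X m (first_projector m)"
  proof (rule transfer)
    fix b assume b: "b \<in> points ?X"
    have "tl (snd (b ! 1)) = map (\<lambda>i. snd (b ! 1) ! i) [1..<m]"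
      using len[OF b, of 1] by (intro nth_equalityI) (auto simp: nth_tl)
    then show "first_projector m b = shift_prod m (fst (b ! 1)) (map (\<lambda>i. snd (b ! 1) ! i) [1..<m])"
      unfolding first_projector_def by simp
  qed
qed

lemma polynomial_on_pivot:
  assumes "i < m" "j < m"
  shows "polynomial_on (Ubar_power m 2) (pivot m i j)"
  using polynomial_mat_mult[OF projectors_polynomial(2,1), of m] assms
  unfolding polynomial_mat_def pivot_def by blast

lemma exchange_domain_pivot:
  assumes "b \<in> exchange_domain m"
  obtains i j where "i < m" "j < m" "pivot m i j b \<noteq> 0"
proof -
  have b: "b \<in> points (Ubar_power m 2)" "first_projector m b * last_projector m b \<noteq> 0\<^sub>m m m"
    using assms unfolding exchange_domain_def by auto
  have "first_projector m b * last_projector m b \<in> carrier_mat m m"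
    using polynomial_mat_mult[OF projectors_polynomial(2,1)] b(1) unfolding polynomial_mat_def
      by blast
  from nonzero_mat_index[OF this b(2)] show thesis using that unfolding pivot_def by blast
qed

lemma zariski_open_exchange_domain:
  "zariski_open (Ubar_power m 2) (exchange_domain m)"
proof (rule zariski_open_local)
  let ?X = "Ubar_power m 2"
  fix b assume b: "b \<in> exchange_domain m"
  obtain i j where ij: "i < m" "j < m" "pivot m i j b \<noteq> 0" using exchange_domain_pivot[OF b] .
  let ?W = "{b \<in> {b \<in> points ?X. distinct (spectrum_list b)}. pivot m i j b \<noteq> 0}"
  have "zariski_open ?X ?W"
    by (rule zariski_open_polynomial_on[OF
          polynomial_on_pivot[OF ij(1,2)] zariski_open_distinct_spectrum])
  moreover have "b \<in> ?W" using b ij unfolding exchange_domain_def by simp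
  moreover have "?W \<subseteq> exchange_domain m" using ij(1,2) unfolding exchange_domain_def pivot_def
    by auto
  ultimately show "\<exists>W. zariski_open ?X W \<and> b \<in> W \<and> W \<subseteq> exchange_domain m" by blast
qed

text \<open>
  For diagonal matrices \<open>u\<close> and \<open>w\<close> are unit vectors; the list of the second matrix is reversed
  so that they are the same unit vector.
\<close>

lemma exchange_domain_nonempty:
  assumes m: "0 < m"
  shows "exchange_domain m \<noteq> {}"
proof -
  let ?f = "\<lambda>i. of_nat i :: complex" and ?g = "\<lambda>i. of_nat (m + i) :: complex"
  define ls where "ls = map ?f [0..<m]"
  define ks where "ks = map ?g (rev [0..<m])"
  have pts: "(mat_diag m ?f, ls) \<in> points (Ubar m)" "(mat_diag m ?g, ks) \<in> points (Ubar m)"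
    unfolding ls_def ks_def by (intro mat_diag_points_Ubar; auto simp: distinct_map inj_on_def)+
  define b where "b = [(mat_diag m ?f, ls), (mat_diag m ?g, ks)]"
  have b: "b \<in> points (Ubar_power m 2)" unfolding points_power_variety b_def using pts by simp
  have dist: "distinct (ls @ ks)" unfolding ls_def ks_def
    by (auto simp: distinct_map inj_on_def simp del: of_nat_add)
  obtain n where n: "m = Suc n" using m by (cases m) auto
  have but: "butlast ls = map ?f [0..<n]" unfolding ls_def n by simp
  have tl: "tl ks = map ?g (rev [0..<n])" unfolding ks_def n by simp
  define p where "p = mat_diag m (\<lambda>i. if i = n then 1 else 0 :: complex)"
  have pC: "p \<in> carrier_mat m m" unfolding p_def by simp
  have p0: "p \<noteq> 0\<^sub>m m m"
  proof
    assume "p = 0\<^sub>m m m"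
    then have "p $$ (n, n) = 0" using n by simp
    then show False unfolding p_def n by (simp add: mat_diag_def)
  qed
  have pp: "p * p = p" unfolding p_def mat_diag_diag
    by (intro arg_cong[where f = "mat_diag m"]) auto
  have fp: "mat_diag m ?f * p = of_nat n \<cdot>\<^sub>m p" "p * mat_diag m ?g = of_nat (m + n) \<cdot>\<^sub>m p"
    unfolding p_def mat_diag_diag by (auto intro!: eq_matI simp: mat_diag_def)
  have "shift_prod m (mat_diag m ?g) (tl ks) * shift_prod m (mat_diag m ?f) (butlast ls) \<noteq> 0\<^sub>m m m"
  proof (rule projector_product_nonzero[OF _ _ pC p0 pp])
    show "shift_prod m (mat_diag m ?f) (butlast ls) * p = (\<Prod>s\<leftarrow>butlast ls. of_nat n - s) \<cdot>\<^sub>m p"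
      by (rule shift_prod_mult_right[OF mat_diag_dim pC fp(1)])
    show "p * shift_prod m (mat_diag m ?g) (tl ks) = (\<Prod>s\<leftarrow>tl ks. of_nat (m + n) - s) \<cdot>\<^sub>m p"
      by (rule shift_prod_mult_left[OF mat_diag_dim pC fp(2)])
    show "(\<Prod>s\<leftarrow>butlast ls. of_nat n - s) \<noteq> 0" "(\<Prod>s\<leftarrow>tl ks. of_nat (m + n) - s) \<noteq> 0"
      unfolding prod_list_diff_eq_0_iff but tl by auto
  qed auto
  then have "b \<in> exchange_domain m"
    unfolding exchange_domain_def first_projector_def last_projector_def
    using b dist by (simp add: b_def)
  then show ?thesis by blast
qed

lemma exchange_regular:
  assumes ij: "i < m" "j < m" and W: "zariski_open (Ubar_power m 2) W"
    and pivot: "\<And>b. b \<in> W \<Longrightarrow> pivot m i j b \<noteq> 0"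
    and d: "d \<in> coords (Ubar_power m 2)"
  shows "regular_on (Ubar_power m 2) W (\<lambda>b. d (exchange m i j b))"
proof -
  let ?X = "Ubar_power m 2"
  note poly = regular_on_polynomial[OF W]
  let ?k = "\<lambda>b. snd (b ! 1) ! 0" and ?l = "\<lambda>b. snd (b ! 0) ! (m - 1)"
  have kl: "polynomial_on ?X ?k" "polynomial_on ?X ?l"
    using ij by (auto intro: polynomial_on_listed_eigenvalue)
  let ?q = "\<lambda>r s b. (?k b - ?l b) * (inverse (pivot m i j b) *
    (last_projector m b $$ (r, i) * first_projector m b $$ (j, s)))"
  have q: "regular_on ?X W (?q r s)" if "r < m" "s < m" for r s
    using projectors_polynomial[of m] that ij unfolding polynomial_mat_def
    by (intro regular_on_mult[OF W] regular_on_inverse[OF W] pivot poly polynomial_on_diff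
        polynomial_on_mult kl polynomial_on_pivot) auto
  have carrier: "fst (b ! n) \<in> carrier_mat m m" "length (snd (b ! n)) = m"
    if "b \<in> W" "n < 2" for b n
  proof -
    have "b ! n \<in> points (Ubar m)"
      using that zariski_open_subset[OF W] power_variety_nth[of b "Ubar m" 2] by blast
    then show "fst (b ! n) \<in> carrier_mat m m" "length (snd (b ! n)) = m" by (auto simp: Ubar_def)
  qed
  obtain c n where c: "c \<in> coords (Ubar m)" "n < 2" and d: "d = (\<lambda>b. c (b ! n))"
    using d unfolding coords_power_variety by blast
  from c consider r s where "r < m" "s < m" "c = (\<lambda>x. fst x $$ (r, s))"
    | r where "r < m" "c = (\<lambda>x. snd x ! r)" unfolding Ubar_def by auto
  then show ?thesis
  proof cases
    case 1
    show ?thesis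
    proof (cases "n = 0")
      case True
      have "regular_on ?X W (\<lambda>b. fst (b ! 0) $$ (r, s) + ?q r s b)"
        using 1 by (intro regular_on_add[OF W] q poly polynomial_on_entry) auto
      moreover have "d (exchange m i j b) = fst (b ! 0) $$ (r, s) + ?q r s b" if "b \<in> W" for b
        unfolding d True 1 exchange_def Let_def using 1 carrier[OF that, of 0] ij
        by (simp add: col_times_row_index divide_inverse)
      ultimately show ?thesis by (rule regular_on_if_eq)
    next
      case False
      then have n: "n = 1" using c(2) by simp
      have "regular_on ?X W (\<lambda>b. fst (b ! 1) $$ (r, s) + - 1 * ?q r s b)"
        using 1 by (intro regular_on_add[OF W] regular_on_mult[OF W, of "\<lambda>_. - 1"] q poly
            polynomial_on_entry polynomial_on_const) auto
      moreover have "d (exchange m i j b) = fst (b ! 1) $$ (r, s) + - 1 * ?q r s b" if "b \<in> W" for b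
        unfolding d n 1 exchange_def Let_def using 1 carrier[OF that, of 1] ij
        by (simp add: col_times_row_index divide_inverse)
      ultimately show ?thesis by (rule regular_on_if_eq)
    qed
  next
    case 2
    show ?thesis
    proof (cases "n = 0")
      case True
      have "regular_on ?X W (\<lambda>b. if r = m - 1 then ?k b else snd (b ! 0) ! r)"
        using 2 kl by (cases "r = m - 1") (auto intro!: poly polynomial_on_listed_eigenvalue)
      moreover have "d (exchange m i j b) = (if r = m - 1 then ?k b else snd (b ! 0) ! r)"
        if "b \<in> W" for b
        unfolding d True 2 exchange_def Let_def using 2 carrier(2)[OF that, of 0] by simp
      ultimately show ?thesis by (rule regular_on_if_eq)
    next
      case False
      then have n: "n = 1" using c(2) by simp
      have "regular_on ?X W (\<lambda>b. if r = 0 then ?l b else snd (b ! 1) ! r)"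
        using 2 kl by (cases "r = 0") (auto intro!: poly polynomial_on_listed_eigenvalue)
      moreover have "d (exchange m i j b) = (if r = 0 then ?l b else snd (b ! 1) ! r)"
        if "b \<in> W" for b
        unfolding d n 2 exchange_def Let_def using 2 carrier(2)[OF that, of 1] by simp
      ultimately show ?thesis by (rule regular_on_if_eq)
    qed
  qed
qed

text \<open>
  On the exchange domain the map is regular, as it is given locally by \<open>exchange\<close>, and it is an
  involution by uniqueness, since the transposition is one.
\<close>

lemma acts_birationally_boundary:
  assumes m: "0 < m"
  shows "acts_birationally m 2 (adjacent_swap m)"
proof -
  let ?X = "Ubar_power m 2" and ?\<tau> = "adjacent_swap m"
  define f where "f = perm_act m 2 ?\<tau>"
  define V where "V = exchange_domain m"
  have V: "zariski_open ?X V" "V \<noteq> {}"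
    unfolding V_def using zariski_open_exchange_domain exchange_domain_nonempty[OF m] .
  have sub: "V \<subseteq> points ?X" by (rule zariski_open_subset[OF V(1)])
  have \<tau>: "?\<tau> permutes {1..m * 2}" using m by (intro permutes_swap_id) auto
  have dist: "distinct (spectrum_list b)" if "b \<in> V" for b
    using that unfolding V_def exchange_domain_def by simp
  have f_eq: "f b = exchange m i j b" if "b \<in> V" "i < m" "j < m" "pivot m i j b \<noteq> 0" for b i j
    unfolding f_def using that sub dist[OF that(1)] exchange_correct(1)[OF m _ _ that(2-4)]
    by (intro perm_act_eqI[OF _ _ \<tau>]) auto
  have f: "refactorization m 2 ?\<tau> b (f b)" "f b \<in> V" if b: "b \<in> V" for b
  proof -
    obtain i j where ij: "i < m" "j < m" "pivot m i j b \<noteq> 0"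
      using exchange_domain_pivot b unfolding V_def by metis
    have pts: "b \<in> points ?X" using b sub by blast
    show "refactorization m 2 ?\<tau> b (f b)" "f b \<in> V"
      unfolding f_eq[OF b ij] V_def using exchange_correct[OF m pts dist[OF b] ij] .
  qed
  have inv: "f (f b) = b" if b: "b \<in> V" for b
  proof -
    have pts: "b \<in> points ?X" using b sub by blast
    have "refactorization m 2 (?\<tau> \<circ> ?\<tau>) b (f (f b))"
      using refactorization_comp[OF pts \<tau> \<tau> f(1)[OF b] f(1)[OF f(2)[OF b]]] .
    moreover have "refactorization m 2 (?\<tau> \<circ> ?\<tau>) b b" using pts by (simp add: refactorization_def)
    ultimately show ?thesis
      using refactorization_unique[OF pts dist[OF b] permutes_compose[OF \<tau> \<tau>]] by blast
  qed
  have "regular_map ?X V ?X f"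
    unfolding regular_map_def
  proof (intro conjI ballI)
    show "f ` V \<subseteq> points ?X" using f(2) sub by blast
    fix d assume d: "d \<in> coords ?X"
    show "regular_on ?X V (\<lambda>b. d (f b))"
    proof (rule regular_on_local)
      fix b assume b: "b \<in> V"
      obtain i j where ij: "i < m" "j < m" "pivot m i j b \<noteq> 0"
        using exchange_domain_pivot b unfolding V_def by metis
      let ?W = "{b \<in> V. pivot m i j b \<noteq> 0}"
      have W: "zariski_open ?X ?W"
        by (rule zariski_open_polynomial_on[OF polynomial_on_pivot[OF ij(1,2)] V(1)])
      have "regular_on ?X ?W (\<lambda>b. d (exchange m i j b))"
        by (rule exchange_regular[OF ij(1,2) W _ d]) simp
      moreover have "d (f b) = d (exchange m i j b)" if "b \<in> ?W" for b
        using that f_eq ij(1,2) by simp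
      ultimately have "regular_on ?X ?W (\<lambda>b. d (f b))" by (rule regular_on_if_eq)
      then show "\<exists>W. zariski_open ?X W \<and> b \<in> W \<and> W \<subseteq> V \<and> regular_on ?X W (\<lambda>b. d (f b))"
        using W b ij by (intro exI[of _ ?W]) auto
    qed
  qed
  then have bir: "birational_automorphism ?X f"
    using f(2) inv by (intro birational_automorphism_involution[OF irreducible_power_Ubar V]) auto
  have "generically ?X (\<lambda>b. b \<in> V)" by (rule generically_open[OF irreducible_power_Ubar V])
  then have "generically ?X (\<lambda>b. refactorization m 2 ?\<tau> b (f b))"
    by (rule generically_mono) (rule f(1))
  from acts_birationallyI(1)[OF \<tau> bir this] show ?thesis .
qed

lemma transposition_acts:
  assumes i: "0 < i" "i < m * N"
  defines "\<sigma> \<equiv> adjacent_swap i"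
  shows "acts_birationally m N \<sigma>"
    and "i mod m \<noteq> 0 \<Longrightarrow> acts_only_inside (Ubar m) N (i div m) 1 (perm_act m N \<sigma>)"
    and "i mod m = 0 \<Longrightarrow> acts_only_inside (Ubar m) N (i div m - 1) 2 (perm_act m N \<sigma>)"
proof -
  have m: "0 < m" using i by (cases m) auto
  have div: "i div m < N" using i by (simp add: less_mult_imp_div_less mult.commute)
  have inner: "acts_birationally m N \<sigma> \<and> acts_only_inside (Ubar m) N (i div m) 1 (perm_act m N \<sigma>)"
    if "i mod m \<noteq> 0"
  proof -
    have lt: "0 < i mod m" "i mod m < m" "i mod m < m * 1" using that m by auto
    have "i div m + 1 \<le> N" using div by simp
    from acts_birationally_on_factors[OF acts_birationally_inner[OF lt(1,2)] lt(1,3) this]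
    show ?thesis unfolding \<sigma>_def by simp
  qed
  have boundary:
    "acts_birationally m N \<sigma> \<and> acts_only_inside (Ubar m) N (i div m - 1) 2 (perm_act m N \<sigma>)"
    if "i mod m = 0"
  proof -
    have eq: "i = i div m * m" using that by auto
    then have pos: "0 < i div m" using i by (metis gr0I mult_zero_left)
    then have "i div m - 1 + 2 \<le> N" using div by simp
    moreover have "(i div m - 1) * m + m = i" using eq pos by (cases "i div m") auto
    ultimately show ?thesis
      using acts_birationally_on_factors[OF acts_birationally_boundary[OF m] m, of "i div m - 1" N] m
      unfolding \<sigma>_def by simp
  qed
  show "acts_birationally m N \<sigma>" using inner boundary by blast
  show "acts_only_inside (Ubar m) N (i div m) 1 (perm_act m N \<sigma>)" if "i mod m \<noteq> 0"
    using inner[OF that] by (rule conjunct2)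
  show "acts_only_inside (Ubar m) N (i div m - 1) 2 (perm_act m N \<sigma>)" if "i mod m = 0"
    using boundary[OF that] by (rule conjunct2)
qed

lemma permutation_acts:
  assumes "\<sigma> permutes {1..m * N}"
  shows "acts_birationally m N \<sigma>"
  using assms
proof (rule permutes_adjacent_induct)
  show "acts_birationally m N id" by (rule acts_birationally_id)
  show "acts_birationally m N (adjacent_swap i)" if "0 < i" "i < m * N" for i
    using transposition_acts(1)[OF that] .
qed (rule acts_birationally_comp(1))

section \<open>The twisted transposition\<close>

text \<open>
  The transpositions have disjoint supports, so at most one of them moves a given position.
\<close>

lemma block_swap_apply:
  "block_swap m i = (if i \<in> {1..m} then m + i else if i \<in> {m + 1..2 * m} then i - m else i)"
proof -
  have "foldr (\<lambda>j \<pi>. Transposition.transpose j (m + j) \<circ> \<pi>) js id i =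
    (if i \<in> set js then m + i else if m < i \<and> i - m \<in> set js then i - m else i)"
    if "distinct js" "set js \<subseteq> {1..m}" for js
    using that
  proof (induction js)
    case (Cons j js)
    then show ?case by (auto simp: Transposition.transpose_def)
  qed simp
  moreover have "set [1..<m + 1] = {1..m}" by auto
  ultimately have "block_swap m i =
    (if i \<in> {1..m} then m + i else if m < i \<and> i - m \<in> {1..m} then i - m else i)"
    unfolding block_swap_def by (metis distinct_upt order_refl)
  then show ?thesis by auto
qed

lemma block_swap_involution: "block_swap m \<circ> block_swap m = id"
  by (auto simp: fun_eq_iff block_swap_apply)

lemma block_swap_permutes: "block_swap m permutes {1..m * 2}"
proof -
  have "bij (block_swap m)" using block_swap_involution o_bij by blast
  moreover have "block_swap m i = i" if "i \<notin> {1..m * 2}" for i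
    using that by (auto simp: block_swap_apply)
  ultimately show ?thesis unfolding permutes_def bij_iff by blast
qed

lemma permute_positions_block_swap:
  assumes "length xs = m" "length ys = m"
  shows "permute_positions (block_swap m) (xs @ ys) = ys @ xs"
proof (rule nth_equalityI)
  fix i assume "i < length (permute_positions (block_swap m) (xs @ ys))"
  then have i: "i < length (xs @ ys)" by simp
  have "inv_into UNIV (block_swap m) = block_swap m"
    using block_swap_involution inv_unique_comp by blast
  then show "permute_positions (block_swap m) (xs @ ys) ! i = (ys @ xs) ! i"
    using i assms by (auto simp: nth_permute_positions block_swap_apply nth_append)
qed (use assms in simp)

text \<open>
  For three factors, the relation between a point and its image under the block swap of the factors
  \<open>a\<close> and \<open>a + 1\<close>, with the matrices known through the matrix polynomial only.
\<close>

definition swaps_blocks :: "nat \<Rightarrow> Ubar_point list \<Rightarrow>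
    Ubar_point list \<Rightarrow> nat \<Rightarrow> bool" where
  "swaps_blocks m b c a \<longleftrightarrow> c \<in> points (Ubar_power m 3) \<and>
    matrix_polynomial m c = matrix_polynomial m b \<and>
    map snd c = (map snd b)[a := snd (b ! (a + 1)), a + 1 := snd (b ! a)]"

lemma swaps_blocks_on_factors:
  assumes b: "b \<in> points (Ubar_power m 3)" and a: "a \<le> 1"
    and r: "refactorization m 2 (block_swap m) (take 2 (drop a b)) (g (take 2 (drop a b)))"
  shows "swaps_blocks m b (on_factors a 2 g b) a"
proof -
  have a3: "a + 2 \<le> 3" using a by simp
  note on = refactorization_on_factors[where g = g, OF b a3 r]
  have len: "length b = 3" "\<And>k. k < 3 \<Longrightarrow> length (snd (b ! k)) = m"
  proof -
    show "length b = 3" using b unfolding points_power_variety by simp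
    show "length (snd (b ! k)) = m" if "k < 3" for k
      using power_variety_nth[OF b that] by (auto simp: Ubar_def)
  qed
  obtain x y where xy: "g (take 2 (drop a b)) = [x, y]" "x \<in> points (Ubar m)" "y \<in> points (Ubar m)"
    using r unfolding refactorization_def points_power_variety
    by (auto simp: length_Suc_conv numeral_2_eq_2)
  have c: "take 2 (drop a b) = [b ! a, b ! (a + 1)]"
    using len a by (intro nth_equalityI) (auto simp: less_Suc_eq numeral_2_eq_2)
  have xy': "g [b ! a, b ! (a + 1)] = [x, y]" using xy(1) c by simp
  have "snd x @ snd y = snd (b ! (a + 1)) @ snd (b ! a)"
    using r len a unfolding refactorization_def c xy'
    by (simp add: permute_positions_block_swap)
  moreover have "length (snd x) = length (snd (b ! (a + 1)))" using xy(2) len a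
    by (auto simp: Ubar_def)
  ultimately have snd: "snd x = snd (b ! (a + 1))" "snd y = snd (b ! a)" by auto
  have "map snd (on_factors a 2 g b) = (map snd b)[a := snd (b ! (a + 1)), a + 1 := snd (b ! a)]"
  proof -
    obtain b0 b1 b2 where b: "b = [b0, b1, b2]"
      using len(1) by (auto simp: length_Suc_conv numeral_3_eq_3)
    have "a = 0 \<or> a = 1" using a by auto
    then show ?thesis unfolding on_factors_def xy(1) using snd unfolding b by auto
  qed
  then show ?thesis unfolding swaps_blocks_def using on by simp
qed

lemma spectrum_list_map_snd: "map snd b = map snd c \<Longrightarrow> spectrum_list b = spectrum_list c"
  unfolding spectrum_list_def by simp

text \<open>
  Both sides of each relation preserve the matrix polynomial, and they rearrange the three blocks
  of eigenvalues in the same way, so uniqueness of factorizations applies.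
\<close>

lemma twisted_transposition_block_swap:
  "twisted_transposition (Ubar m) (perm_act m 2 (block_swap m))"
proof -
  let ?\<mu> = "perm_act m 2 (block_swap m)" and ?X = "Ubar_power m 3"
  let ?s = "\<lambda>a. on_factors a 2 ?\<mu>"
  let ?S = "swaps_blocks m"
  have good: "birational_automorphism (Ubar_power m 2) ?\<mu>"
    "generically (Ubar_power m 2) (\<lambda>b. refactorization m 2 (block_swap m) b (?\<mu> b))"
    using permutation_acts[OF block_swap_permutes] unfolding acts_birationally_def by auto
  have bir: "birational_automorphism ?X (?s a)" if "a \<le> 1" for a
    using that by (intro birational_automorphism_on_factors[OF _
          irreducible_power_Ubar points_Ubar_nonempty good(1)]) simp
  have swap: "generically ?X (\<lambda>b. ?S b (?s a b) a)" if "a \<le> 1" for a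
  proof (rule generically_mono)
    show "generically ?X (\<lambda>b. refactorization m 2 (block_swap m) (take 2 (drop a b))
        (?\<mu> (take 2 (drop a b))))"
      using that
        by (intro generically_factors[OF _ irreducible_power_Ubar points_Ubar_nonempty good(2)]) simp
  qed (rule swaps_blocks_on_factors[OF _ that])
  have after: "generically ?X (\<lambda>b. P (?s a b))" if "generically ?X P" "a \<le> 1" for P a
    by (rule generically_birational_comp[OF irreducible_power_Ubar bir[OF that(2)] that(1)])
  have unique: "b = c"
    if "b \<in> points ?X" "c \<in> points ?X" "matrix_polynomial m b = matrix_polynomial m c"
      "map snd b = map snd c" "distinct (spectrum_list b)" for b c
    by (rule factorization_unique[of _ m])
      (use that spectrum_list_map_snd[OF that(4)] in \<open>auto simp: points_power_variety\<close>)
  have involution: "rational_eq ?X (?s a \<circ> ?s a) id" if a: "a \<le> 1" for a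
    unfolding rational_eq_def
  proof (rule generically_mono)
    show "generically ?X (\<lambda>b. distinct (spectrum_list b) \<and> ?S b (?s a b) a \<and>
        ?S (?s a b) (?s a (?s a b)) a)"
      by (intro generically_conj generically_distinct_spectrum swap[OF a] after[OF swap[OF a] a])
    fix b assume b: "b \<in> points ?X"
      and S: "distinct (spectrum_list b) \<and> ?S b (?s a b) a \<and> ?S (?s a b) (?s a (?s a b)) a"
    have len: "length b = 3" using b unfolding points_power_variety by simp
    define c where "c = ?s a b"
    have c: "length c = 3" "map snd c = (map snd b)[a := snd (b ! (a + 1)), a + 1 := snd (b ! a)]"
      using S unfolding c_def swaps_blocks_def points_power_variety by auto
    have nth: "snd (c ! k) = (map snd b)[a := snd (b ! (a + 1)), a + 1 := snd (b ! a)] ! k"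
      if "k < 3" for k
      using c that by (metis nth_map)
    have "map snd (?s a c) = (map snd c)[a := snd (c ! (a + 1)), a + 1 := snd (c ! a)]"
      using S unfolding c_def swaps_blocks_def by simp
    also have "\<dots> = map snd b"
      unfolding c(2) using a len nth[of a] nth[of "a + 1"]
      by (intro nth_equalityI) (auto simp: nth_list_update)
    finally have "b = ?s a c"
      using S b unfolding c_def swaps_blocks_def by (intro unique) auto
    then show "(?s a \<circ> ?s a) b = id b" unfolding c_def by simp
  qed
  let ?B = "\<lambda>b. distinct (spectrum_list b) \<and>
      (?S b (?s 0 b) 0 \<and> ?S (?s 0 b) (?s 1 (?s 0 b)) 1 \<and>
        ?S (?s 1 (?s 0 b)) (?s 0 (?s 1 (?s 0 b))) 0) \<and>
      (?S b (?s 1 b) 1 \<and> ?S (?s 1 b) (?s 0 (?s 1 b)) 0 \<and>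
        ?S (?s 0 (?s 1 b)) (?s 1 (?s 0 (?s 1 b))) 1)"
  have braid: "rational_eq ?X (?s 0 \<circ> ?s 1 \<circ> ?s 0) (?s 1 \<circ> ?s 0 \<circ> ?s 1)"
    unfolding rational_eq_def
  proof (rule generically_mono)
    show "generically ?X ?B"
      by (intro generically_conj generically_distinct_spectrum swap after
          after[where P = "\<lambda>b. ?S (?s 1 b) (?s 0 (?s 1 b)) 0"]
          after[where P = "\<lambda>b. ?S (?s 0 b) (?s 1 (?s 0 b)) 1"]) auto
    fix b assume b: "b \<in> points ?X" and S: "?B b"
    have step: "\<exists>x' y' z'. map snd c = [x', y', z'] \<and>
        (if a = 0 then x' = y \<and> y' = x \<and> z' = z else x' = x \<and> y' = z \<and> z' = y)"
      if "?S d c a" "map snd d = [x, y, z]" "a \<le> 1" for c d a x y z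
    proof -
      have "snd (d ! 0) = x" "snd (d ! 1) = y" "snd (d ! 2) = z" "length d = 3"
        using that(2) by (auto simp: map_eq_Cons_conv)
      moreover have "a = 0 \<or> a = 1" using that(3) by auto
      ultimately show ?thesis using that(1,2) unfolding swaps_blocks_def
        by (auto simp: numeral_2_eq_2)
    qed
    obtain x y z where xyz: "map snd b = [x, y, z]"
      using b unfolding points_power_variety by (auto simp: length_Suc_conv numeral_3_eq_3)
    have "map snd (?s 0 (?s 1 (?s 0 b))) = [z, y, x]"
      using step[of b "?s 0 b" 0 x y z] step[of "?s 0 b" "?s 1 (?s 0 b)" 1 y x z]
        step[of "?s 1 (?s 0 b)" "?s 0 (?s 1 (?s 0 b))" 0 y z x] S xyz by auto
    moreover have "map snd (?s 1 (?s 0 (?s 1 b))) = [z, y, x]"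
      using step[of b "?s 1 b" 1 x y z] step[of "?s 1 b" "?s 0 (?s 1 b)" 0 x z y]
        step[of "?s 0 (?s 1 b)" "?s 1 (?s 0 (?s 1 b))" 1 z x y] S xyz by auto
    moreover have "distinct (spectrum_list (?s 0 (?s 1 (?s 0 b))))"
    proof -
      have "distinct (x @ y @ z)" using S xyz unfolding spectrum_list_def by simp
      then have "distinct (concat [z, y, x])" by auto
      then show ?thesis unfolding spectrum_list_def calculation(1) .
    qed
    ultimately show "(?s 0 \<circ> ?s 1 \<circ> ?s 0) b = (?s 1 \<circ> ?s 0 \<circ> ?s 1) b"
      using S unfolding o_apply swaps_blocks_def by (intro unique) auto
  qed
  show ?thesis
    unfolding twisted_transposition_def Let_def
      using good(1) involution[of 0] involution[of 1] braid by simp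
qed

theorem mainTheorem2:
  fixes m N :: nat
  assumes "1 \<le> m" and "1 \<le> N"
  shows
    "(\<forall>\<sigma>. \<sigma> permutes {1..m * N} \<longrightarrow>
        generically (power_variety (Ubar m) N) (\<lambda>b. \<exists>!b'. refactorization m N \<sigma> b b')) \<and>
     birational_action {\<sigma>. \<sigma> permutes {1..m * N}} (power_variety (Ubar m) N) (perm_act m N) \<and>
     (\<forall>\<alpha> i. \<alpha> \<le> N - 1 \<and> \<alpha> * m < i \<and> i < (\<alpha> + 1) * m \<longrightarrow>
        acts_only_inside (Ubar m) N \<alpha> 1
          (perm_act m N (Transposition.transpose i (i + 1)))) \<and>
     (\<forall>\<alpha>. 1 \<le> \<alpha> \<and> \<alpha> \<le> N - 1 \<longrightarrow>
        acts_only_inside (Ubar m) N (\<alpha> - 1) 2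
          (perm_act m N (Transposition.transpose (\<alpha> * m) (\<alpha> * m + 1)))) \<and>
     twisted_transposition (Ubar m) (perm_act m 2 (block_swap m))"
proof (intro conjI allI impI)
  let ?X = "power_variety (Ubar m) N"
  show "generically ?X (\<lambda>b. \<exists>!b'. refactorization m N \<sigma> b b')" if \<sigma>: "\<sigma> permutes {1..m * N}" for \<sigma>
  proof (rule generically_mono)
    show
      "generically ?X (\<lambda>b. distinct (spectrum_list b) \<and> refactorization m N \<sigma> b (perm_act m N \<sigma> b))"
      using permutation_acts[OF \<sigma>] unfolding acts_birationally_def
      by (intro generically_conj generically_distinct_spectrum) blast
  qed (use refactorization_unique[OF _ _ \<sigma>] in blast)
  show "birational_action {\<sigma>. \<sigma> permutes {1..m * N}} ?X (perm_act m N)"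
    unfolding birational_action_def
    using permutation_acts acts_birationally_comp(2) acts_birationally_id(2)
    unfolding acts_birationally_def by auto
  show "acts_only_inside (Ubar m) N \<alpha> 1 (perm_act m N (Transposition.transpose i (i + 1)))"
    if "\<alpha> \<le> N - 1 \<and> \<alpha> * m < i \<and> i < (\<alpha> + 1) * m" for \<alpha> i
  proof -
    have "(\<alpha> + 1) * m \<le> N * m" using that assms by (intro mult_le_mono1) auto
    then have "i < m * N" "0 < i" using that by (auto simp: mult.commute)
    moreover have "i div m = \<alpha>" using that by (intro div_nat_eqI) (auto simp: algebra_simps)
    moreover have "i mod m \<noteq> 0"
      using that \<open>i div m = \<alpha>\<close> by (metis add.right_neutral div_mult_mod_eq less_irrefl)
    ultimately show ?thesis using transposition_acts(2)[of i m N] by simp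
  qed
  show "acts_only_inside (Ubar m) N (\<alpha> - 1) 2
      (perm_act m N (Transposition.transpose (\<alpha> * m) (\<alpha> * m + 1)))"
    if "1 \<le> \<alpha> \<and> \<alpha> \<le> N - 1" for \<alpha>
  proof -
    have "0 < \<alpha> * m" "\<alpha> * m < m * N" using that assms by auto
    then show ?thesis using transposition_acts(3)[of "\<alpha> * m" m N] assms(1) by simp
  qed
qed (rule twisted_transposition_block_swap)

end
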